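(* Let $q\ge 6$ be a prime power. Let $\bar{\mathcal C}$ be an $\mathbb F_q$-conic in an $\mathbb F_q$-subplane $\bar\pi$ of $\mathrm{PG}(2,q^3)$ that is exterior to $\ell_\infty$, and let $\bar E,\bar E^{\bar{\mathsf c}_\pi}\in\ell_\infty$ be the $(\bar\pi,\ell_\infty)$-carriers of $\bar\pi$ on $\ell_\infty$. In the exact-at-infinity Bruck-Bose representation in $\mathrm{PG}(6,q)$ we have the following. 1. If $\bar{\mathcal C}^+\cap\ell_\infty=\{\bar E,\bar E^{\bar{\mathsf c}_\pi}\}$, then $\mathcal V([\mathcal C])$ consists of a 3-dimensional normal rational curve $\mathcal N_3$ of $\mathrm{PG}(6,q)$. Further, $\mathcal V([\mathcal C])^\star\cap\Sigma_\infty^\star$ is the three T-lines $h=E(E^{\mathsf c_\pi})^{q^2}$ (the line joining $E$ and $(E^{\mathsf c_\pi})^{q^2}$), $h^q$, $h^{q^2}$. Further, $\mathcal N_3^\star\cap\Sigma_\infty^\star=\{R,R^q,R^{q^2}\}$ where $R\in h$, and $R$ is not contained in an extended spread plane. 2. Otherwise $\bar{\mathcal C}^+$ meets $\ell_\infty$ in two points $\bar P,\bar Q$ which are not $(\bar\pi,\ell_\infty)$-carriers, possibly repeated, possibly in the quadratic extension. In this case $\mathcal V([\mathcal C])$ is a 6-dimensional normal rational curve $\mathcal N_6$ of $\mathrm{PG}(6,q)$. Further, $\mathcal N_6^\star$ meets $\Sigma_\infty^\star$ in six points $\{P,P^q,P^{q^2},Q,Q^q,Q^{q^2}\}$, where $P,Q\in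 g$, possibly repeated, or possibly in the extension $g^{\star\star}\setminus g$ (the intersection then being that of $\mathcal N_6^{\star\star}$ with $\Sigma_\infty^{\star\star}$), in which case $Q=P^{q^3}$.
   Context: **$\mathbb F_q$-conics.** An $\mathbb F_q$-subplane of $\mathrm{PG}(2,q^3)$ is a subplane of order $q$; it is secant, tangent or exterior to a line if it meets it in $q+1$, $1$ or $0$ points. An $\mathbb F_q$-conic is a non-degenerate conic of an $\mathbb F_q$-subplane. For an $\mathbb F_q$-conic $\bar{\mathcal C}$, $\bar{\mathcal C}^{+}$ is the unique non-degenerate conic of $\mathrm{PG}(2,q^3)$ containing it, and $\bar{\mathcal C}^{++}$ the unique non-degenerate conic of $\mathrm{PG}(2,q^6)$ containing $\bar{\mathcal C}^+$ (if $\bar{\mathcal C}^+\cap\ell_\infty=\emptyset$, the points $\bar P,\bar Q$ are the intersections of $\bar{\mathcal C}^{++}$ with the extension of $\ell_\infty$ to $\mathrm{PG}(2,q^6)$). A line $\ell_\infty$ of $\mathrm{PG}(2,q^3)$ is fixed as line at infinity. **Normal rational curves.** An $r$-dimensional normal rational curve in $\mathrm{PG}(n,q)$ is a set of points lying in an $r$-space and projectively equivalent to $\{(1,\theta,\dots,\theta^r):\theta\in\mathbb F_q\}\cup\{(0,\dots,0,1)\}$; it extends naturally to a normal rational curve over extension fields. **Conjugacy and carriers.** For an $\mathbb F_q$-subplane $\bar\pi$, $\bar{\mathsf c}_\pi$ is the collineation $\bar X\mapsto B\bar X^q$ ($B\in\mathrm{GL}(3,q^3)$) of $\mathrm{PG}(2,q^3)$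 that has order 3 and fixes $\bar\pi$ pointwise; the same formula defines it on $\mathrm{PG}(2,q^6)$, where it has order 6. If $\bar\pi$ is exterior to $\ell_\infty$, the $(\bar\pi,\ell_\infty)$-carriers are the three points $\ell_\infty\cap\ell_\infty^{\bar{\mathsf c}_\pi}$, $\ell_\infty\cap\ell_\infty^{\bar{\mathsf c}_\pi^2}$, $\ell_\infty^{\bar{\mathsf c}_\pi}\cap\ell_\infty^{\bar{\mathsf c}_\pi^2}$; two of them lie on $\ell_\infty$, and they are denoted $\bar E,\bar E^{\bar{\mathsf c}_\pi},\bar E^{\bar{\mathsf c}_\pi^2}$ with $\bar E,\bar E^{\bar{\mathsf c}_\pi}\in\ell_\infty$. **Bose representation.** Embed $\mathrm{PG}(8,q)\subset\mathrm{PG}(8,q^3)\subset\mathrm{PG}(8,q^6)$; $X^q$ is obtained by raising coordinates to the $q$-th power. For a subspace or variety $\mathcal K$ given over $\mathbb F_q$ (including normal rational curves), $\mathcal K^\star$ and $\mathcal K^{\star\star}$ denote its extensions to $\mathbb F_{q^3}$ and $\mathbb F_{q^6}$; for a subspace $\Sigma$ of $\mathrm{PG}(8,q^3)$, $\Sigma^{\star\star}$ is its extension to $\mathrm{PG}(8,q^6)$. Let $\Gamma$ be a plane of $\mathrm{PG}(8,q^3)$ disjoint from $\mathrm{PG}(8,q)$ such that $\Gamma,\Gamma^q,\Gamma^{q^2}$ span $\mathrm{PG}(8,q^3)$. The planes $[\![X]\!]=\langle X,X^q,X^{q^2}\rangle\cap\mathrm{PG}(8,q)$, $X\in\Gamma$,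 form a regular 2-spread of $\mathrm{PG}(8,q)$. Identify $\mathrm{PG}(2,q^3)$ with $\Gamma$ (and $\mathrm{PG}(2,q^6)$ with $\Gamma^{\star\star}$) by a linear isomorphism, $\bar X\leftrightarrow X$; dropping the bar denotes the corresponding object in $\Gamma$ or $\Gamma^{\star\star}$ (so $\mathcal C,\mathcal C^+,\mathcal C^{++},\mathsf c_\pi$). **Scroll-planes.** For $X\in\Gamma^{\star\star}$, the $\pi$-scroll-plane is $(\!(X)\!)_\pi=\langle X,(X^{\mathsf c_\pi^5})^q,(X^{\mathsf c_\pi^4})^{q^2}\rangle$; for $X\in\Gamma$ this is $\langle X,(X^{\mathsf c_\pi^2})^q,(X^{\mathsf c_\pi})^{q^2}\rangle$. **Exact-at-infinity Bruck-Bose representation.** Let $g\subset\Gamma$ be the line corresponding to $\ell_\infty$, $\Sigma_\infty=\langle g,g^q,g^{q^2}\rangle\cap\mathrm{PG}(8,q)$ (a 5-space), and $\Sigma_{6,q}\cong\mathrm{PG}(6,q)$ a 6-space of $\mathrm{PG}(8,q)$ containing $\Sigma_\infty$ as its hyperplane at infinity. The planes $[\![X]\!]$, $X\in g$, form a regular 2-spread $\mathcal S$ of $\Sigma_\infty$, with transversal lines $g,g^q,g^{q^2}$; its elements are the spread planes, and an extended spread plane is the extension $\langle X,X^q,X^{q^2}\rangle$ of one. A T-line of $\Sigma_\infty^\star$ is a line meeting two of $g,g^q,g^{q^2}$. For a point $\bar X$ let $[X]=[\![X]\!]\cap\Sigma_{6,q}$: a point of $\Sigma_{6,q}\setminus\Sigma_\infty$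 if $\bar X\notin\ell_\infty$, the spread plane $[\![X]\!]$ if $\bar X\in\ell_\infty$. $[\mathcal C]$ is the set of points lying in the $[X]$, $\bar X\in\bar{\mathcal C}$. **Varieties.** It is known that the pointset of $\{[\![X]\!]:X\in\mathcal C\}$ is an intersection $\mathcal V([\![\mathcal C]\!])$ of nine quadrics of $\mathrm{PG}(8,q)$, that $\mathcal V([\![\mathcal C]\!])^\star$ is the set of points on the planes $(\!(X)\!)_\pi$, $X\in\mathcal C^+$, and $\mathcal V([\![\mathcal C]\!])^{\star\star}$ is the set of points on the planes $(\!(X)\!)_\pi$, $X\in\mathcal C^{++}$. Put $\mathcal V([\mathcal C])=\mathcal V([\![\mathcal C]\!])\cap\Sigma_{6,q}$ (its pointset is $[\mathcal C]$), with extension $\mathcal V([\mathcal C])^\star=\mathcal V([\![\mathcal C]\!])^\star\cap\Sigma_{6,q}^\star$. *)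

theory Defs
  imports "HOL-Analysis.Analysis" "HOL-Number_Theory.Prime_Powers"
begin

text \<open>
  Everything lives over one ambient finite field \<open>'a\<close> of order \<open>q^6\<close>. A subspace of
  \<open>PG(n,q^d)\<close>, \<open>d\<close> dividing 6, is encoded by the \<open>'a\<close>-linear subspace \<open>U\<close> that it spans; a point
  is the case \<open>dim U = 1\<close>. A subspace and its extensions to larger subfields are thus the same
  \<open>U\<close>, and \<open>pts F U\<close> recovers its points over \<open>F\<close>. Incidence is inclusion.
\<close>

section \<open>Projective spaces over the subfields\<close>

text \<open>If \<open>'a\<close> has order \<open>q^6\<close> and \<open>d\<close> divides 6, this is the subfield of order \<open>q^d\<close>.\<close>

definition GF :: "nat \<Rightarrow> nat \<Rightarrow> 'a::field set" where
  "GF q d = {x. x ^ (q ^ d) = x}"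

definition vec_over :: "'a set \<Rightarrow> 'a::field ^ 'n \<Rightarrow> bool" where
  "vec_over F x \<longleftrightarrow> (\<forall>i. x $ i \<in> F)"

definition mat_over :: "'a set \<Rightarrow> 'a::field ^ 'm ^ 'n \<Rightarrow> bool" where
  "mat_over F M \<longleftrightarrow> (\<forall>i. vec_over F (M $ i))"

definition proj_pt :: "'a::field ^ 'n \<Rightarrow> ('a ^ 'n) set" where
  "proj_pt x = vec.span {x}"

definition PG :: "'a::field set \<Rightarrow> ('a ^ 'n) set set" where
  "PG F = {proj_pt x | x. x \<noteq> 0 \<and> vec_over F x}"

definition pts :: "'a::field set \<Rightarrow> ('a ^ 'n) set \<Rightarrow> ('a ^ 'n) set set" where
  "pts F U = {P \<in> PG F. P \<subseteq> U}"

text \<open>\<open>U\<close> is (the extension of) a subspace of projective dimension \<open>k\<close> of \<open>PG(n,F)\<close>.\<close>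

definition proj_subspace :: "'a::field set \<Rightarrow> nat \<Rightarrow> ('a ^ 'n) set \<Rightarrow> bool" where
  "proj_subspace F k U \<longleftrightarrow>
     vec.subspace U \<and> U = vec.span {x \<in> U. vec_over F x} \<and> vec.dim U = k + 1"

text \<open>\<open>frob m ` U\<close> is \<open>U\<close> with all coordinates raised to the power \<open>m\<close>; for \<open>m\<close> a power of
  \<open>q\<close> this maps subspaces to subspaces of the same dimension.\<close>

definition frob :: "nat \<Rightarrow> 'a::field ^ 'n \<Rightarrow> 'a ^ 'n" where
  "frob m x = (\<chi> i. (x $ i) ^ m)"

section \<open>Quadrics, conics and normal rational curves\<close>

text \<open>The matrix is not assumed symmetric, so that all quadratic forms are covered in
  characteristic 2 as well.\<close>

definition qform :: "'a::field ^ 'n ^ 'n \<Rightarrow> 'a ^ 'n \<Rightarrow> 'a" where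
  "qform M x = (\<Sum>i\<in>UNIV. \<Sum>j\<in>UNIV. M $ i $ j * x $ i * x $ j)"

definition quadric :: "'a::field set \<Rightarrow> 'a ^ 'n ^ 'n \<Rightarrow> ('a ^ 'n) set set" where
  "quadric F M = {P \<in> PG F. \<forall>x\<in>P. qform M x = 0}"

text \<open>No singular point: a zero of the form at which all its partial derivatives vanish.\<close>

definition nondegenerate :: "'a::field ^ 'n ^ 'n \<Rightarrow> bool" where
  "nondegenerate M \<longleftrightarrow>
     \<not> (\<exists>x. x \<noteq> 0 \<and> qform M x = 0 \<and> (\<forall>j. (\<Sum>i\<in>UNIV. (M $ i $ j + M $ j $ i) * x $ i) = 0))"

definition nondeg_conic :: "'a::field set \<Rightarrow> ('a ^ 3) set set \<Rightarrow> bool" where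
  "nondeg_conic F D \<longleftrightarrow> (\<exists>M. mat_over F M \<and> nondegenerate M \<and> D = quadric F M)"

text \<open>The unique non-degenerate conic of \<open>PG(2,F)\<close> containing a given conic.\<close>

definition conic_ext :: "'a::field set \<Rightarrow> ('a ^ 3) set set \<Rightarrow> ('a ^ 3) set set" where
  "conic_ext F D = (THE D'. nondeg_conic F D' \<and> D \<subseteq> D')"

text \<open>A normal rational curve of dimension \<open>r\<close> is given by the images \<open>v 0, \<dots>, v r\<close> of the
  standard basis vectors under the projective equivalence with the standard curve. \<open>nrc F r v\<close> is
  its set of points over \<open>F\<close>; if \<open>v\<close> has coordinates in \<open>F\<close>, then \<open>nrc F' r v\<close> is the extension to a
  larger field \<open>F'\<close>. (For small \<open>F\<close> the points over \<open>F\<close> alone need not determine the extension: for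
  \<open>r = 6\<close> and order 7 they are just a frame.)\<close>

definition nrc_basis :: "'a::field set \<Rightarrow> ('a ^ 'n) set \<Rightarrow> nat \<Rightarrow> (nat \<Rightarrow> 'a ^ 'n) \<Rightarrow> bool" where
  "nrc_basis F U r v \<longleftrightarrow>
     (\<forall>i\<le>r. v i \<in> U \<and> vec_over F (v i)) \<and> inj_on v {..r} \<and> vec.independent (v ` {..r})"

definition nrc :: "'a::field set \<Rightarrow> nat \<Rightarrow> (nat \<Rightarrow> 'a ^ 'n) \<Rightarrow> ('a ^ 'n) set set" where
  "nrc F r v = {proj_pt (\<Sum>i\<le>r. \<theta> ^ i *s v i) | \<theta>. \<theta> \<in> F} \<union> {proj_pt (v r)}"

section \<open>Subplanes, conics of subplanes, conjugacy and carriers\<close>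

definition secant_lines :: "'a::field set \<Rightarrow> ('a ^ 3) set set \<Rightarrow> ('a ^ 3) set set" where
  "secant_lines F \<pi> = {L. proj_subspace F 1 L \<and> (\<exists>P\<in>\<pi>. \<exists>Q\<in>\<pi>. P \<noteq> Q \<and> P \<subseteq> L \<and> Q \<subseteq> L)}"

text \<open>A set \<open>\<pi>\<close> of points of \<open>PG(2,F)\<close> that, together with the lines joining its points, is a
  projective plane of order \<open>n\<close>.\<close>

definition subplane :: "'a::field set \<Rightarrow> nat \<Rightarrow> ('a ^ 3) set set \<Rightarrow> bool" where
  "subplane F n \<pi> \<longleftrightarrow>
     \<pi> \<subseteq> PG F \<and>
     (\<forall>L\<in>secant_lines F \<pi>. \<forall>M\<in>secant_lines F \<pi>. L \<noteq> M \<longrightarrow> (\<exists>P\<in>\<pi>. P \<subseteq> L \<and> P \<subseteq> M)) \<and>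
     (\<forall>L\<in>secant_lines F \<pi>. card {P \<in> \<pi>. P \<subseteq> L} = n + 1) \<and>
     (\<exists>S\<subseteq>\<pi>. card S = 4 \<and> (\<forall>L. proj_subspace F 1 L \<longrightarrow> card {P \<in> S. P \<subseteq> L} \<le> 2))"

text \<open>\<open>\<C>\<close> is a non-degenerate conic of the subplane \<open>\<pi>\<close> of \<open>PG(2,q^3)\<close>, where \<open>\<pi>\<close> is coordinatised by
  a projectivity \<open>A\<close> from \<open>PG(2,q)\<close> onto \<open>\<pi>\<close>.\<close>

definition subplane_conic :: "nat \<Rightarrow> ('a::field ^ 3) set set \<Rightarrow> ('a ^ 3) set set \<Rightarrow> bool" where
  "subplane_conic q \<pi> \<C> \<longleftrightarrow>
     (\<exists>A D. mat_over (GF q 3) A \<and> invertible A \<and> \<pi> = (\<lambda>P. (*v) A ` P) ` PG (GF q 1) \<and>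
        nondeg_conic (GF q 1) D \<and> \<C> = (\<lambda>P. (*v) A ` P) ` D)"

definition exterior :: "('a ^ 3) set set \<Rightarrow> ('a::field ^ 3) set \<Rightarrow> bool" where
  "exterior \<pi> L \<longleftrightarrow> (\<forall>P\<in>\<pi>. \<not> P \<subseteq> L)"

text \<open>The collineation \<open>X \<mapsto> B X^q\<close>, acting on points and lines alike.\<close>

definition conj_map :: "nat \<Rightarrow> 'a::field ^ 3 ^ 3 \<Rightarrow> ('a ^ 3) set \<Rightarrow> ('a ^ 3) set" where
  "conj_map q B U = (\<lambda>x. B *v frob q x) ` U"

text \<open>\<open>B\<close> induces the collineation of order 3 of \<open>PG(2,q^3)\<close> fixing \<open>\<pi>\<close> pointwise.\<close>

definition subplane_conj :: "nat \<Rightarrow> ('a::field ^ 3) set set \<Rightarrow> 'a ^ 3 ^ 3 \<Rightarrow> bool" where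
  "subplane_conj q \<pi> B \<longleftrightarrow>
     mat_over (GF q 3) B \<and> invertible B \<and>
     (\<forall>k. (\<forall>P\<in>PG (GF q 3). (conj_map q B ^^ k) P = P) \<longleftrightarrow> 3 dvd k) \<and>
     (\<forall>P\<in>\<pi>. conj_map q B P = P)"

definition carriers :: "nat \<Rightarrow> 'a::field ^ 3 ^ 3 \<Rightarrow> ('a ^ 3) set \<Rightarrow> ('a ^ 3) set set" where
  "carriers q B L =
     (let c = conj_map q B in {L \<inter> c L, L \<inter> c (c L), c L \<inter> c (c L)})"

section \<open>The Bose and Bruck-Bose representations\<close>

definition conj_span :: "nat \<Rightarrow> ('a::field ^ 9) set \<Rightarrow> ('a ^ 9) set" where
  "conj_span q U = vec.span (U \<union> frob q ` U \<union> frob (q^2) ` U)"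

text \<open>\<open>J\<close> is the matrix of a linear isomorphism from \<open>PG(2,q^3)\<close> (and hence from \<open>PG(2,q^6)\<close>) onto
  the plane \<open>\<Gamma>\<close>.\<close>

definition bose_frame :: "nat \<Rightarrow> ('a::field ^ 9) set \<Rightarrow> 'a ^ 3 ^ 9 \<Rightarrow> bool" where
  "bose_frame q \<Gamma> J \<longleftrightarrow>
     proj_subspace (GF q 3) 2 \<Gamma> \<and> pts (GF q 1) \<Gamma> = {} \<and>
     conj_span q \<Gamma> = UNIV \<and>
     mat_over (GF q 3) J \<and> inj ((*v) J) \<and> range ((*v) J) = \<Gamma>"

text \<open>The points of the planes \<open>\<lbrakk>X\<rbrakk>\<close>, \<open>X \<in> \<C>\<close>.\<close>

definition bose_points ::
  "nat \<Rightarrow> 'a::field ^ 3 ^ 9 \<Rightarrow> ('a ^ 3) set set \<Rightarrow> ('a ^ 9) set set" where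
  "bose_points q J \<C> = (\<Union>X\<in>\<C>. pts (GF q 1) (conj_span q ((*v) J ` X)))"

text \<open>The points over \<open>F\<close> of the variety \<open>\<V>(\<lbrakk>\<C>\<rbrakk>)\<close>: the quadrics of \<open>PG(8,q)\<close> that contain the
  points of the planes \<open>\<lbrakk>X\<rbrakk>\<close> are intersected, and for the extensions of the variety the same
  quadrics are intersected over \<open>F\<close>. For \<open>q \<ge> 4\<close>, any nine of these quadrics that cut out the scroll
  of the scroll-planes give the same sets: on the scroll a quadric is described by binary forms of
  degree at most 4 in the parameter of the conic; if it contains the planes \<open>\<lbrakk>X\<rbrakk>\<close>, these forms
  vanish at the \<open>q + 1\<close> points of \<open>\<C>\<close>, hence identically.\<close>

definition bose_variety ::
  "nat \<Rightarrow> 'a::field ^ 3 ^ 9 \<Rightarrow> ('a ^ 3) set set \<Rightarrow> 'a set \<Rightarrow> ('a ^ 9) set set" where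
  "bose_variety q J \<C> F =
     {P \<in> PG F. \<forall>M. mat_over (GF q 1) M \<and> bose_points q J \<C> \<subseteq> quadric (GF q 1) M
        \<longrightarrow> P \<in> quadric F M}"

text \<open>The points over \<open>F\<close> of \<open>\<V>([\<C>])\<close>, the section by the 6-space \<open>\<Sigma>\<close>.\<close>

definition bb_variety ::
  "nat \<Rightarrow> 'a::field ^ 3 ^ 9 \<Rightarrow> ('a ^ 9) set \<Rightarrow> ('a ^ 3) set set \<Rightarrow> 'a set \<Rightarrow> ('a ^ 9) set set" where
  "bb_variety q J \<Sigma> \<C> F = bose_variety q J \<C> F \<inter> pts F \<Sigma>"

text \<open>Here \<open>g\<close> is the transversal line in \<open>\<Gamma>\<close>.\<close>

definition T_line :: "nat \<Rightarrow> ('a::field ^ 9) set \<Rightarrow> ('a ^ 9) set \<Rightarrow> bool" where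
  "T_line q g L \<longleftrightarrow>
     proj_subspace (GF q 3) 1 L \<and> L \<subseteq> conj_span q g \<and>
     (\<exists>i<3. \<exists>j<3. i \<noteq> j \<and> pts (GF q 3) (L \<inter> frob (q^i) ` g) \<noteq> {} \<and>
        pts (GF q 3) (L \<inter> frob (q^j) ` g) \<noteq> {})"

end

theory Submission
  imports Defs "HOL-Computational_Algebra.Polynomial"
begin

text \<open>
  Write the conic of the subplane as \<open>x(t) = (1, t, t\<^sup>2)\<close> in coordinates that identify the subplane
  with \<open>PG(2,q)\<close>. Then \<open>PG(8,q\<^sup>6)\<close> has coordinates \<open>(a\<^sub>0, a\<^sub>1, a\<^sub>2)\<close> in three copies of \<open>K\<^sup>3\<close>, which the
  Frobenius map permutes cyclically, and the variety of the conic is the scroll of the points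
  \<open>(w\<^sub>0 x(t), w\<^sub>1 x(t), w\<^sub>2 x(t))\<close>: a quadric through the given points vanishes on all of it by counting
  zeros, and the determinantal equations of the scroll are recovered from quadrics over \<open>GF(q)\<close> by
  taking traces. If \<open>f\<^sub>0\<close> is the quadratic polynomial obtained by restricting an equation of the line at
  infinity to the conic, and \<open>f\<^sub>1\<close>, \<open>f\<^sub>2\<close> are its conjugates, then the 6-space imposes
  \<open>w\<^sub>0 f\<^sub>0(t) = w\<^sub>1 f\<^sub>1(t) = w\<^sub>2 f\<^sub>2(t)\<close>. If \<open>f\<^sub>0, f\<^sub>1, f\<^sub>2\<close> are pairwise coprime, the solution
  \<open>w = (f\<^sub>1 f\<^sub>2, f\<^sub>0 f\<^sub>2, f\<^sub>0 f\<^sub>1)\<close> is a normal rational curve of degree 6. Two of them have a common root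
  precisely if \<open>f\<^sub>0\<close> has roots \<open>e\<close> and \<open>e\<^sup>q\<close> with \<open>e\<close> in \<open>GF(q\<^sup>3)\<close>, that is, if the conic passes through the
  carriers; then a common factor of degree 3 splits off, the curve is a cubic, and at the common roots
  the scroll contributes the three T-lines.
\<close>


section \<open>Finite fields of order \<open>q ^ 6\<close>\<close>

text \<open>Both curves fit one scheme. The weights are polynomials \<open>c k\<close> with
  \<open>c k * Fp k = h\<close> for one \<open>h\<close> and every \<open>k\<close>, which keeps the
  curve in the 6-space. Its \<open>r + 1\<close> coefficient vectors are independent because the
  quadratic multiples of the \<open>c k\<close> generate all polynomials of degree at most
  \<open>r\<close>: a linear relation is a functional that kills every generator. Equal products
  suffice only after rescaling the equation of the line: a point of the 6-space over
  \<open>GF q 1\<close> off infinity gives the values d, d^q, d^(q^2), and dividing the equation by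
  d makes them all 1. All linear algebra is over the field of order q^6, so facts over a subfield
  come from counting its elements or from invariance under the Frobenius map. A form over the large
  field is recovered from the traces of all its multiples by \<mu>: at a fixed point they are a
  polynomial in \<mu> of degree at most q^5, which cannot vanish on q^6 elements unless all its
  coefficients are zero. The T-lines do not show over \<open>GF q 1\<close> because no f_k has a
  root there; they appear over \<open>GF q 3\<close>.\<close>

lemma power_card_eq_self: "x ^ CARD('a) = x" for x :: "'a::{field,finite}"
proof (cases "x = 0")
  case False
  let ?S = "UNIV - {0::'a}"
  have "bij_betw ((*) x) ?S ?S"
    by (rule bij_betwI[where g = "\<lambda>y. y / x"]) (use False in auto)
  then have "(\<Prod>y\<in>?S. x * y) = \<Prod>?S"
    using prod.reindex_bij_betw[of "(*) x" ?S ?S "\<lambda>y. y"] by simp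
  then have "x ^ card ?S * \<Prod>?S = \<Prod>?S"
    by (simp add: prod.distrib)
  moreover have "\<Prod>?S \<noteq> 0" by simp
  ultimately have "x ^ card ?S = 1" by simp
  moreover have "CARD('a) = Suc (card ?S)"
    using card_Suc_Diff1[of UNIV "0::'a"] by simp
  ultimately show ?thesis by (metis mult_1_right power_Suc)
qed simp

text \<open>Translation by 1 permutes the field, so summing x + 1 and x over all elements gives the
  same value.\<close>

lemma of_nat_CARD_eq_0: "of_nat CARD('a) = (0 :: 'a::{field,finite})"
proof -
  have "bij_betw (\<lambda>x::'a. x + 1) UNIV UNIV"
    by (rule bij_betwI[where g = "\<lambda>y. y - 1"]) auto
  then have "(\<Sum>x\<in>UNIV. x + 1) = \<Sum>(UNIV :: 'a set)"
    using sum.reindex_bij_betw[of "\<lambda>x::'a. x + 1" UNIV UNIV "\<lambda>y. y"] by simp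
  then show ?thesis by (simp add: sum.distrib)
qed

lemma coeffs_zero_of_roots:
  fixes c :: "nat \<Rightarrow> 'a::{field,finite}"
  assumes "\<And>x. x \<in> S \<Longrightarrow> (\<Sum>i\<le>n. c i * x ^ i) = 0" "card S > n" "i \<le> n"
  shows "c i = 0"
proof -
  define p where "p = (\<Sum>i\<le>n. monom (c i) i)"
  have coeff: "coeff p i = (if i \<le> n then c i else 0)" for i
    by (simp add: p_def coeff_sum)
  have "poly p x = (\<Sum>i\<le>n. c i * x ^ i)" for x
    by (simp add: p_def poly_sum poly_monom)
  then have S: "S \<subseteq> {x. poly p x = 0}" using assms(1) by auto
  have "degree p \<le> n" by (rule degree_le) (simp add: coeff)
  moreover have "card S \<le> card {x. poly p x = 0}" by (rule card_mono) (use S in auto)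
  ultimately have "p = 0"
    using card_poly_roots_bound[of p] assms(2) by fastforce
  then show ?thesis using coeff[of i] assms(3) by simp
qed

text \<open>The sparse version of the root bound. The exponents that occur later are q^k, q^i + q^j
  and multiples of a fixed number, so only injectivity of the exponent map and the top degree have
  to be checked.\<close>

lemma coeffs_zero_of_roots_exps:
  fixes c :: "'b \<Rightarrow> 'a::{field,finite}"
  assumes "finite I" "inj_on e I" "\<And>i. i \<in> I \<Longrightarrow> e i \<le> n"
    and zero: "\<And>x. x \<in> S \<Longrightarrow> (\<Sum>i\<in>I. c i * x ^ e i) = 0" and "card S > n" "i \<in> I"
  shows "c i = 0"
proof -
  define d where "d k = (if k \<in> e ` I then c (the_inv_into I e k) else 0)" for k
  have "(\<Sum>k\<le>n. d k * x ^ k) = (\<Sum>i\<in>I. c i * x ^ e i)" for x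
  proof -
    have "(\<Sum>k\<le>n. d k * x ^ k) = (\<Sum>k\<in>e ` I. d k * x ^ k)"
      by (rule sum.mono_neutral_right) (use assms(3) in \<open>auto simp: d_def\<close>)
    also have "\<dots> = (\<Sum>i\<in>I. c i * x ^ e i)"
      unfolding sum.reindex[OF assms(2)]
      by (rule sum.cong) (auto simp: d_def the_inv_into_f_f[OF assms(2)])
    finally show ?thesis .
  qed
  then have "d (e i) = 0"
    using coeffs_zero_of_roots[of S d n "e i"] zero assms by simp
  then show ?thesis using assms by (simp add: d_def the_inv_into_f_f[OF assms(2)])
qed

lemma quadratic_two_roots:
  fixes a b c :: "'a::field"
  assumes "a * x^2 + b * x + c = 0" "a * y^2 + b * y + c = 0" "x \<noteq> y"
  shows "a * z^2 + b * z + c = a * (z - x) * (z - y)"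
proof -
  have "(x - y) * (a * (x + y) + b) = 0" using assms(1,2) by algebra
  then have "a * (x + y) + b = 0" using assms(3) by simp
  then show ?thesis using assms(1) by algebra
qed

locale sextic_field =
  fixes q :: nat and ty :: "'a::{field,finite} itself"
  assumes primepow_q: "primepow q" and q_ge: "q \<ge> 6" and card_field: "CARD('a) = q ^ 6"
begin

lemma q_pos [simp]: "q > 0" "q \<noteq> 0" using q_ge by auto

lemma prime_CHAR: "prime CHAR('a)"
proof -
  have "CHAR('a) > 0" by (rule finite_imp_CHAR_pos) simp
  then show ?thesis by (rule prime_CHAR_semidom)
qed

text \<open>The characteristic divides q^6 and hence equals the prime below q. This makes every map
  x to x^(q^k) additive.\<close>

lemma q_CHAR_power: "\<exists>n. q = CHAR('a) ^ n"
proof -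
  obtain p n where pn: "prime p" "n > 0" "q = p ^ n"
    using primepow_q unfolding primepow_def by auto
  have "CHAR('a) dvd q ^ 6"
    using of_nat_CARD_eq_0[where 'a='a] of_nat_eq_0_iff_char_dvd[where 'a='a] card_field by metis
  then have "CHAR('a) dvd p" using prime_CHAR pn(3) by (metis prime_dvd_power)
  then have "CHAR('a) = p" using prime_CHAR pn(1) primes_dvd_imp_eq by blast
  then show ?thesis using pn by auto
qed

lemma q_pow_CHAR_power: "\<exists>n. q ^ k = CHAR('a) ^ n"
  using q_CHAR_power by (metis power_mult)

lemma pow_add: "(x + y :: 'a) ^ q ^ k = x ^ q ^ k + y ^ q ^ k"
  using freshmans_dream'[OF prime_CHAR] q_pow_CHAR_power by metis

lemma pow_sum: "(sum f A :: 'a) ^ q ^ k = (\<Sum>i\<in>A. f i ^ q ^ k)"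
proof -
  obtain n where "q ^ k = CHAR('a) ^ n" using q_pow_CHAR_power by blast
  then show ?thesis by (rule freshmans_dream_sum'[OF prime_CHAR])
qed

lemma pow_minus: "(- x :: 'a) ^ q ^ k = - (x ^ q ^ k)"
  using pow_add[of x "- x" k] by (simp add: zero_power eq_neg_iff_add_eq_0 add.commute)

lemma pow_diff: "(x - y :: 'a) ^ q ^ k = x ^ q ^ k - y ^ q ^ k"
  using pow_add[of x "- y" k] by (simp add: pow_minus)

lemma pow_minus1: "(- x :: 'a) ^ q = - (x ^ q)" using pow_minus[of x 1] by simp
lemma pow_sum1: "(sum f A :: 'a) ^ q = (\<Sum>i\<in>A. f i ^ q)" using pow_sum[of f A 1] by simp

lemma pow_q6: "(x :: 'a) ^ q ^ 6 = x"
  using power_card_eq_self[of x] card_field by simp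

lemma pow_pow: "((x :: 'a) ^ q ^ j) ^ q ^ k = x ^ q ^ (j + k)"
  by (simp add: power_mult[symmetric] power_add)

lemma pow_q_pow: "((x :: 'a) ^ q ^ k) ^ q = x ^ q ^ Suc k"
  by (simp add: power_mult[symmetric] mult.commute)

lemma pow_pow_q: "((x :: 'a) ^ q) ^ q ^ k = x ^ q ^ Suc k"
  by (simp add: power_mult[symmetric])

lemma pow_mod6: "(x :: 'a) ^ q ^ k = x ^ q ^ (k mod 6)"
proof -
  have "(x :: 'a) ^ q ^ (6 * n) = x" for n
    by (induction n) (simp_all add: pow_q6 flip: pow_pow)
  then have "x ^ q ^ (6 * (k div 6) + k mod 6) = x ^ q ^ (k mod 6)"
    by (simp only: flip: pow_pow)
  then show ?thesis by simp
qed

text \<open>Since 5k + k = 6k, the exponent \<open>5 * k\<close> serves as -k and inverse Frobenius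
  maps stay powers with natural exponents.\<close>

lemma pow_inverse: "((x :: 'a) ^ q ^ (5 * k)) ^ q ^ k = x" "(x ^ q ^ k) ^ q ^ (5 * k) = x"
  using pow_mod6[of x "6 * k"] by (simp_all add: pow_pow add.commute)

lemma pow_inj: "(x :: 'a) ^ q ^ k = y ^ q ^ k \<longleftrightarrow> x = y"
  by (metis pow_inverse(2))

lemma pow_inj1: "(x :: 'a) ^ q = y ^ q \<longleftrightarrow> x = y"
  using pow_inj[of x 1 y] by simp

lemma pow_surj: "\<exists>y :: 'a. y ^ q ^ k = x"
  using pow_inverse(1) by blast

lemma GF_iff: "(x :: 'a) \<in> GF q d \<longleftrightarrow> x ^ q ^ d = x" by (simp add: GF_def)

lemma GF_0 [simp]: "(0 :: 'a) \<in> GF q d" and GF_1 [simp]: "(1 :: 'a) \<in> GF q d"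
  by (simp_all add: GF_def zero_power)

lemma GF_add: "x \<in> GF q d \<Longrightarrow> y \<in> GF q d \<Longrightarrow> (x + y :: 'a) \<in> GF q d"
  and GF_diff: "x \<in> GF q d \<Longrightarrow> y \<in> GF q d \<Longrightarrow> (x - y :: 'a) \<in> GF q d"
  and GF_uminus: "x \<in> GF q d \<Longrightarrow> (- x :: 'a) \<in> GF q d"
  and GF_mult: "x \<in> GF q d \<Longrightarrow> y \<in> GF q d \<Longrightarrow> (x * y :: 'a) \<in> GF q d"
  and GF_divide: "x \<in> GF q d \<Longrightarrow> y \<in> GF q d \<Longrightarrow> (x / y :: 'a) \<in> GF q d"
  and GF_inverse: "x \<in> GF q d \<Longrightarrow> (inverse x :: 'a) \<in> GF q d"
  by (auto simp: GF_def pow_add pow_diff pow_minus power_mult_distrib power_divide power_inverse)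

lemma GF_power: "x \<in> GF q d \<Longrightarrow> (x ^ n :: 'a) \<in> GF q d"
  by (induction n) (auto simp: GF_mult)

lemma GF_sum: "(\<And>i. i \<in> A \<Longrightarrow> f i \<in> GF q d) \<Longrightarrow> (sum f A :: 'a) \<in> GF q d"
  by (simp add: GF_def pow_sum)

lemmas GF_closed = GF_add GF_diff GF_uminus GF_mult GF_divide GF_inverse GF_power GF_sum

lemma GF_6: "GF q 6 = (UNIV :: 'a set)" by (simp add: GF_def pow_q6)

lemma GF_mono: "d dvd e \<Longrightarrow> GF q d \<subseteq> (GF q e :: 'a set)"
proof
  fix x :: 'a assume "d dvd e" and x: "x \<in> GF q d"
  then obtain k where "e = d * k" by blast
  moreover have "x ^ q ^ (d * k) = x" for k
    using x by (induction k) (simp_all add: GF_def flip: pow_pow)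
  ultimately show "x \<in> GF q e" by (simp add: GF_def)
qed

lemma GF_1_any: "x \<in> GF q 1 \<Longrightarrow> (x::'a) \<in> GF q d" using GF_mono[of 1 d] by auto

text \<open>\<open>q ^ d - 1\<close> divides \<open>q ^ 6 - 1\<close>, and the cofactor of \<open>X ^ (q ^ d - 1) - 1\<close> in
  \<open>X ^ (q ^ 6 - 1) - 1\<close> has too few roots to account for all nonzero elements.\<close>

lemma card_GF_ge: assumes "d dvd 6" shows "card (GF q d :: 'a set) \<ge> q ^ d"
proof -
  obtain e where e: "6 = d * e" using assms by blast
  then have d0: "d > 0" and e0: "e > 0" by (auto intro: Nat.gr0I)
  define m where "m = q ^ d - 1"
  have qd: "q ^ d = m + 1" by (simp add: m_def)
  have "q ^ d > 1" using q_ge d0 by (intro one_less_power) auto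
  then have m0: "m > 0" by (simp add: m_def)
  have "\<exists>r. (m + 1) ^ e = m * r + 1" for e
  proof (induction e)
    case (Suc e)
    then obtain r where "(m + 1) ^ e = m * r + 1" by blast
    then have "(m + 1) ^ Suc e = m * (m * r + 1 + r) + 1" by (simp add: algebra_simps)
    then show ?case by blast
  qed (auto intro: exI[of _ 0])
  then obtain r where "(m + 1) ^ e = m * r + 1" by blast
  then have q6: "q ^ 6 = m * r + 1" unfolding e power_mult qd .
  then have r0: "r > 0" using q_ge one_less_power[of q 6] by (auto intro: Nat.gr0I)
  \<comment> \<open>Here \<open>r\<close> is the quotient (q^6 - 1) / (q^d - 1), and
    \<open>S\<close> holds the zeros of the cofactor 1 + y + ... + y^(r-1) at y = x^m.\<close>
  define S where "S = {x::'a. (\<Sum>j<r. (x ^ m) ^ j) = 0}"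
  have cS: "card S \<le> m * (r - 1)"
  proof (rule ccontr)
    assume "\<not> card S \<le> m * (r - 1)"
    then have "(\<lambda>_. 1::'a) 0 = 0"
      by (intro coeffs_zero_of_roots_exps[of "{..<r}" "\<lambda>j. m * j" "m * (r - 1)" S "\<lambda>_. 1::'a" 0])
         (use m0 r0 in \<open>auto simp: S_def inj_on_def power_mult\<close>)
    then show False by simp
  qed
  define T where "T = {x::'a. x ^ m = 1}"
  have "UNIV - {0::'a} \<subseteq> T \<union> S"
  proof
    fix x :: 'a assume "x \<in> UNIV - {0}"
    then have x: "x \<noteq> 0" by simp
    have "x * x ^ (m * r) = x" using pow_q6[of x] q6 by simp
    then have "(x ^ m) ^ r = 1" using x by (simp add: power_mult)
    then have "(x ^ m - 1) * (\<Sum>j<r. (x ^ m) ^ j) = 0"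
      by (simp flip: power_diff_1_eq)
    then show "x \<in> T \<union> S" by (auto simp: S_def T_def)
  qed
  then have "card (UNIV - {0::'a}) \<le> card (T \<union> S)" by (intro card_mono) auto
  also have "\<dots> \<le> card T + card S" by (rule card_Un_le)
  finally have "m * r \<le> card T + m * (r - 1)"
    using cS card_field q6 by (simp add: card_Diff_singleton)
  moreover have "m * r = m * (r - 1) + m" using r0 by (cases r) auto
  ultimately have "m \<le> card T" by simp
  moreover have "insert 0 T \<subseteq> GF q d"
    by (auto simp: T_def GF_def qd)
  then have "card (insert 0 T) \<le> card (GF q d :: 'a set)" by (intro card_mono) auto
  moreover have "0 \<notin> T" using m0 by (simp add: T_def zero_power)
  ultimately show ?thesis using qd by simp
qed

lemma card_GF: assumes "d dvd 6" shows "card (GF q d :: 'a set) = q ^ d"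
proof (rule antisym)
  have d0: "d > 0" using assms by (auto intro: Nat.gr0I)
  then have qd: "q ^ d > 1" using q_ge by (intro one_less_power) auto
  show "card (GF q d :: 'a set) \<le> q ^ d"
  proof (rule ccontr)
    assume *: "\<not> card (GF q d :: 'a set) \<le> q ^ d"
    \<comment> \<open>The coefficients of X^(q^d) - X; too many zeros would force the coefficient -1
      to vanish.\<close>
    define c :: "nat \<Rightarrow> 'a" where "c i = (if i = 1 then - 1 else 1)" for i
    have "c 1 = 0"
      by (rule coeffs_zero_of_roots_exps[of "{1, q ^ d}" id "q ^ d" "GF q d"])
         (use * qd in \<open>auto simp: GF_def c_def\<close>)
    then show False by (simp add: c_def)
  qed
qed (rule card_GF_ge[OF assms])

text \<open>Independence of the six powers of the Frobenius map: the degree is at most q^5, the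
  number of zeros q^6. This is the tool that undoes a trace taken over all multiples.\<close>

lemma linearized_zero:
  fixes t :: "nat \<Rightarrow> 'a"
  assumes "\<And>\<mu>. (\<Sum>k<6. t k * \<mu> ^ q ^ k) = 0" "k < 6"
  shows "t k = 0"
proof (rule coeffs_zero_of_roots_exps[of "{..<6}" "\<lambda>k. q ^ k" "q ^ 5" UNIV])
  show "inj_on (\<lambda>k. q ^ k) {..<6::nat}"
    using q_ge by (auto simp: inj_on_def power_inject_exp)
  show "q ^ i \<le> q ^ 5" if "i \<in> {..<6}" for i
    using that q_ge by (intro power_increasing) auto
  show "CARD('a) > q ^ 5"
    unfolding card_field using q_ge by (intro power_strict_increasing) auto
qed (use assms in auto)

text \<open>For an exponent pair \<open>i \<le> j\<close> the number \<open>q ^ i + q ^ j\<close> determines \<open>{i, j}\<close>, and all of them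
  are smaller than the number of elements of the subfield.\<close>

lemma quadratic_form_linearized_zero:
  fixes c :: "nat \<Rightarrow> nat \<Rightarrow> 'a"
  assumes "\<And>x. x \<in> GF q 3 \<Longrightarrow> (\<Sum>i<3. \<Sum>j<3. c i j * x ^ q ^ i * x ^ q ^ j) = 0"
  shows "(\<Sum>i<3. \<Sum>j<3. c i j * w i * w j) = 0"
proof -
  \<comment> \<open>The terms for (i, j) and (j, i) share an exponent and must be merged before
    coefficients can be compared.\<close>
  define I :: "(nat \<times> nat) set" where "I = {(0,0), (0,1), (0,2), (1,1), (1,2), (2,2)}"
  define e where "e = (\<lambda>(i, j). q ^ i + q ^ j)"
  define d where "d = (\<lambda>(i, j). if i = j then c i i else c i j + c j i)"
  have sums: "(\<Sum>i<3. \<Sum>j<3. c i j * u i * u j) = (\<Sum>p\<in>I. d p * (u (fst p) * u (snd p)))" for u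
    by (simp add: I_def d_def numeral_3_eq_3 numeral_2_eq_2 lessThan_Suc algebra_simps)
  have q2: "q ^ 2 \<ge> 6 * q" using q_ge by (simp add: power2_eq_square)
  have "q ^ 3 \<ge> 6 * q ^ 2" using q_ge by (simp add: power3_eq_cube power2_eq_square)
  moreover have "q ^ 2 > 0" by simp
  ultimately have big: "q ^ 3 > 2 * q ^ 2" by linarith
  have "d p = 0" if "p \<in> I" for p
  proof (rule coeffs_zero_of_roots_exps[of I e "2 * q ^ 2" "GF q 3" d p])
    show "inj_on e I" unfolding I_def e_def inj_on_def using q2 q_ge by simp
    show "e i \<le> 2 * q ^ 2" if "i \<in> I" for i using that q2 q_ge by (auto simp: I_def e_def)
    show "(\<Sum>p\<in>I. d p * x ^ e p) = 0" if "x \<in> GF q 3" for x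
      using assms[OF that] unfolding sums by (simp add: e_def case_prod_beta power_add)
    show "2 * q ^ 2 < card (GF q 3 :: 'a set)" using big by (simp add: card_GF)
  qed (use that in \<open>auto simp: I_def\<close>)
  then show ?thesis unfolding sums by (simp add: sum.neutral)
qed

end

section \<open>Splitting of quadratic polynomials, by counting\<close>

lemma card_le_two_card_image:
  assumes "finite A" "\<And>x y. x \<in> A \<Longrightarrow> y \<in> A \<Longrightarrow> f x = f y \<Longrightarrow> y = x \<or> y = h x"
  shows "card A \<le> 2 * card (f ` A)"
proof -
  \<comment> \<open>One representative per fibre; the fibre consists of it and its partner under
    \<open>h\<close>.\<close>
  let ?r = "inv_into A f"
  have "A \<subseteq> ?r ` f ` A \<union> (h \<circ> ?r) ` f ` A"
  proof
    fix y assume y: "y \<in> A"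
    then have "?r (f y) \<in> A" "f (?r (f y)) = f y" by (auto intro: inv_into_into f_inv_into_f)
    then have "y = ?r (f y) \<or> y = h (?r (f y))" using assms(2) y by blast
    then show "y \<in> ?r ` f ` A \<union> (h \<circ> ?r) ` f ` A" using y by auto
  qed
  then have "card A \<le> card (?r ` f ` A \<union> (h \<circ> ?r) ` f ` A)"
    using assms(1) by (intro card_mono) auto
  also have "\<dots> \<le> card (?r ` f ` A) + card ((h \<circ> ?r) ` f ` A)" by (rule card_Un_le)
  also have "\<dots> \<le> card (f ` A) + card (f ` A)"
    using assms(1) by (intro add_mono card_image_le) auto
  finally show ?thesis by simp
qed

lemma sum_prod_eq_cases:
  fixes x y :: "'b::field"
  assumes "x + y = x' + y'" "x * y = x' * y'"
  shows "x' = x \<and> y' = y \<or> x' = y \<and> y' = x"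
proof -
  have "(x' - x) * (x' - y) = 0" using assms by algebra
  then show ?thesis using assms(1) by auto
qed

context sextic_field begin

text \<open>Every monic quadratic over \<open>GF q 3\<close> arises from two elements of \<open>GF q 3\<close> or from a conjugate
  pair: there are as many of these as there are quadratics.\<close>

lemma quadratic_splits_monic:
  assumes "s \<in> GF q 3" "p \<in> GF q 3"
  obtains x y :: 'a where "s = x + y" "p = x * y"
    "x \<in> GF q 3 \<and> y \<in> GF q 3 \<or> x \<notin> GF q 3 \<and> y = x ^ q ^ 3"
proof -
  define N where "N = q ^ 3"
  have N1: "N > 0" by (simp add: N_def)
  let ?F = "GF q 3 :: 'a set"
  define f where "f = (\<lambda>(x, y). (x + y, x * y :: 'a))"
  define D where "D = (\<lambda>x. (x, x)) ` ?F"
  \<comment> \<open>\<open>R\<close> lists each unordered pair of distinct roots twice, so sum and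
    product take at least N^2 - N values on it. The double roots in \<open>D\<close> add N further
    values, and together these exhaust all N^2 pairs (s, p).\<close>
  define R where "R = (?F \<times> ?F - D) \<union> (\<lambda>x. (x, x ^ q ^ 3)) ` (UNIV - ?F)"
  have cF: "card ?F = N" by (simp add: card_GF N_def)
  have cK: "CARD('a) = N * N" by (simp add: card_field N_def flip: power_add)
  have cD: "card D = N" unfolding D_def using cF by (subst card_image) (auto simp: inj_on_def)
  have "card (?F \<times> ?F - D) = N * N - N"
    using cD cF by (subst card_Diff_subset) (auto simp: D_def)
  moreover have "card ((\<lambda>x. (x, x ^ q ^ 3)) ` (UNIV - ?F)) = N * N - N"
    using cF cK by (subst card_image) (auto simp: inj_on_def card_Diff_subset)
  moreover have "(?F \<times> ?F - D) \<inter> (\<lambda>x. (x, x ^ q ^ 3)) ` (UNIV - ?F) = {}" by auto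
  ultimately have cR: "card R = 2 * (N * N - N)"
    unfolding R_def by (subst card_Un_disjoint) auto
  have "card R \<le> 2 * card (f ` R)"
    by (rule card_le_two_card_image[where h = prod.swap])
       (auto simp: f_def dest: sum_prod_eq_cases)
  then have fR: "card (f ` R) \<ge> N * N - N" using cR by simp
  have fD: "card (f ` D) = N"
  proof (subst card_image)
    show "inj_on f D" unfolding inj_on_def f_def D_def using sum_prod_eq_cases by fast
  qed (rule cD)
  have conj: "(x ^ q ^ 3) ^ q ^ 3 = x" for x :: 'a by (simp add: pow_pow pow_q6)
  have sub: "f ` (R \<union> D) \<subseteq> ?F \<times> ?F"
  proof -
    have "x + x ^ q ^ 3 \<in> ?F" "x * x ^ q ^ 3 \<in> ?F" for x :: 'a
      by (simp_all add: GF_iff pow_add power_mult_distrib conj add.commute mult.commute)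
    then show ?thesis by (auto simp: f_def R_def D_def intro: GF_closed)
  qed
  have "f ` R \<inter> f ` D = {}"
  proof -
    have "x \<noteq> y" if "(x, y) \<in> R" for x y
      using that by (auto simp: R_def D_def GF_iff)
    then show ?thesis by (auto simp: f_def D_def dest: sum_prod_eq_cases)
  qed
  then have "card (f ` (R \<union> D)) = card (f ` R) + card (f ` D)"
    unfolding image_Un by (intro card_Un_disjoint) auto
  then have "card (f ` (R \<union> D)) \<ge> card (?F \<times> ?F)"
    using fR fD cF N1 by (auto simp: card_cartesian_product)
  then have "f ` (R \<union> D) = ?F \<times> ?F" using sub by (intro card_seteq) auto
  then have "(s, p) \<in> f ` (R \<union> D)" using assms by auto
  then obtain x y where "(x, y) \<in> R \<union> D" "s = x + y" "p = x * y" by (auto simp: f_def)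
  then show ?thesis by (intro that[of x y]) (auto simp: R_def D_def)
qed

lemma quadratic_splits:
  assumes "a \<in> GF q 3" "b \<in> GF q 3" "c \<in> GF q 3" "a \<noteq> 0"
  obtains x y :: 'a where "\<And>z. a * z^2 + b * z + c = a * (z - x) * (z - y)"
    "x \<in> GF q 3 \<and> y \<in> GF q 3 \<or> x \<notin> GF q 3 \<and> y = x ^ q ^ 3"
proof -
  obtain x y where *: "- b / a = x + y" "c / a = x * y"
    "x \<in> GF q 3 \<and> y \<in> GF q 3 \<or> x \<notin> GF q 3 \<and> y = x ^ q ^ 3"
    using quadratic_splits_monic[of "- b / a" "c / a"] assms by (metis GF_divide GF_uminus)
  have "b = - (a * (- b / a))" "c = a * (c / a)" using assms(4) by simp_all
  then have "b = - a * (x + y)" "c = a * (x * y)" unfolding * by simp_all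
  then have "a * z^2 + b * z + c = a * (z - x) * (z - y)" for z by algebra
  then show ?thesis using *(3) that by blast
qed

text \<open>Pigeonhole instead of dimension theory over the subfield: a linear map from triples to
  pairs over a finite field is not injective, and the difference of two vectors with equal image
  solves both equations.\<close>

lemma two_linear_equations:
  fixes a b :: "'a ^ 3"
  assumes "d dvd 6" "vec_over (GF q d) a" "vec_over (GF q d) b"
  obtains x where "x \<noteq> 0" "vec_over (GF q d) x"
    "(\<Sum>i\<in>UNIV. a $ i * x $ i) = 0" "(\<Sum>i\<in>UNIV. b $ i * x $ i) = 0"
proof -
  let ?F = "GF q d :: 'a set"
  define f where "f = (\<lambda>(x, y, z). (a $ 1 * x + a $ 2 * y + a $ 3 * z, b $ 1 * x + b $ 2 * y + b $ 3 * z))"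
  have d0: "d > 0" using assms(1) by (auto intro: Nat.gr0I)
  have ab: "a $ i \<in> ?F" "b $ i \<in> ?F" for i using assms by (auto simp: vec_over_def)
  have "q ^ d > 1" using q_ge d0 by (intro one_less_power) auto
  then have "card (?F \<times> ?F) < card (?F \<times> ?F \<times> ?F)"
    by (simp add: card_GF[OF assms(1)] card_cartesian_product)
  moreover have "f ` (?F \<times> ?F \<times> ?F) \<subseteq> ?F \<times> ?F"
    using ab by (auto simp: f_def intro!: GF_add GF_mult)
  ultimately have "\<not> inj_on f (?F \<times> ?F \<times> ?F)"
    by (metis card_inj_on_le finite leD)
  then obtain x y z x' y' z' where *: "f (x, y, z) = f (x', y', z')" "(x, y, z) \<noteq> (x', y', z')"
    "x \<in> ?F" "y \<in> ?F" "z \<in> ?F" "x' \<in> ?F" "y' \<in> ?F" "z' \<in> ?F"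
    by (auto simp: inj_on_def)
  define w where "w = (vector [x - x', y - y', z - z'] :: 'a ^ 3)"
  have "w \<noteq> 0" using *(2) by (auto simp: w_def vec_eq_iff forall_3)
  moreover have "vec_over ?F w" using *(3-) by (auto simp: w_def vec_over_def forall_3 intro: GF_diff)
  moreover have "(\<Sum>i\<in>UNIV. a $ i * w $ i) = 0" "(\<Sum>i\<in>UNIV. b $ i * w $ i) = 0"
    using *(1) by (simp_all add: w_def sum_3 f_def) (simp_all add: algebra_simps)
  ultimately show ?thesis by (rule that)
qed

section \<open>The Frobenius action on vectors, matrices and spans\<close>

definition frobm :: "nat \<Rightarrow> 'a ^ 'm ^ 'n \<Rightarrow> 'a ^ 'm ^ 'n" where
  "frobm k M = (\<chi> i j. (M $ i $ j) ^ q ^ k)"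

lemma frob_add: "frob (q ^ k) (x + y :: 'a ^ 'n) = frob (q ^ k) x + frob (q ^ k) y"
  and frob_scale: "frob (q ^ k) (c *s x :: 'a ^ 'n) = c ^ q ^ k *s frob (q ^ k) x"
  and frob_0 [simp]: "frob (q ^ k) (0 :: 'a ^ 'n) = 0"
  and frob_frob: "frob (q ^ j) (frob (q ^ k) (x :: 'a ^ 'n)) = frob (q ^ (k + j)) x"
  by (simp_all add: frob_def vec_eq_iff pow_add pow_diff power_mult_distrib zero_power pow_pow)

lemma frob_power_0 [simp]: "frob (q ^ 0) (x :: 'a ^ 'n) = x" "frob (Suc 0) (x :: 'a ^ 'n) = x"
  by (simp_all add: frob_def vec_eq_iff)

lemma frob_q6: "frob (q ^ 6) (x :: 'a ^ 'n) = x"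
  by (simp add: frob_def vec_eq_iff pow_q6)

lemma frob_sum: "frob (q ^ k) (sum f A :: 'a ^ 'n) = (\<Sum>i\<in>A. frob (q ^ k) (f i))"
  by (induction A rule: infinite_finite_induct) (auto simp: frob_add)

lemma frob_inj: "frob (q ^ k) (x :: 'a ^ 'n) = frob (q ^ k) y \<longleftrightarrow> x = y"
  by (simp add: frob_def vec_eq_iff pow_inj)

lemma frob_eq_0 [simp]: "frob (q ^ k) (x :: 'a ^ 'n) = 0 \<longleftrightarrow> x = 0"
  using frob_inj[of k x 0] by simp

lemma frob_inverse: "frob (q ^ k) (frob (q ^ (5 * k)) (x :: 'a ^ 'n)) = x"
    "frob (q ^ (5 * k)) (frob (q ^ k) (x :: 'a ^ 'n)) = x"
  by (simp_all add: frob_def vec_eq_iff pow_inverse)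

lemma vec_over_iff_frob: "vec_over (GF q d) x \<longleftrightarrow> frob (q ^ d) x = (x :: 'a ^ 'n)"
  by (simp add: vec_over_def GF_def frob_def vec_eq_iff)

lemma mat_over_iff_frobm: "mat_over (GF q d) M \<longleftrightarrow> frobm d M = (M :: 'a ^ 'm ^ 'n)"
  by (simp add: mat_over_def vec_over_def GF_def frobm_def vec_eq_iff)

lemma frob_mult_vec: "frob (q ^ k) (M *v x) = frobm k M *v frob (q ^ k) (x :: 'a ^ 'n)"
  by (simp add: frob_def frobm_def vec_eq_iff matrix_vector_mult_def pow_sum power_mult_distrib)

lemma frobm_mult: "frobm k (M ** N) = frobm k M ** frobm k (N :: 'a ^ 'm ^ 'n)"
  by (simp add: frobm_def vec_eq_iff matrix_matrix_mult_def pow_sum power_mult_distrib)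

lemma frobm_mat_1: "frobm k (mat 1 :: 'a ^ 'n ^ 'n) = mat 1"
  by (simp add: frobm_def vec_eq_iff mat_def zero_power)

lemma frobm_frobm: "frobm j (frobm k (M :: 'a ^ 'm ^ 'n)) = frobm (k + j) M"
  by (simp add: frobm_def vec_eq_iff pow_pow)

lemma vec_over_mult: 
  "mat_over (GF q d) M \<Longrightarrow> vec_over (GF q d) x \<Longrightarrow> vec_over (GF q d) (M *v (x :: 'a ^ 'n))"
  by (simp add: vec_over_iff_frob mat_over_iff_frobm frob_mult_vec)

lemma mat_over_mult: 
  "mat_over (GF q d) M \<Longrightarrow> mat_over (GF q d) N \<Longrightarrow> mat_over (GF q d) (M ** (N :: 'a ^ 'm ^ 'n))"
  by (simp add: mat_over_iff_frobm frobm_mult)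

lemma mat_over_1_any: "mat_over (GF q 1) M \<Longrightarrow> mat_over (GF q d) (M :: 'a ^ 'm ^ 'n)"
  using GF_1_any by (auto simp: mat_over_def vec_over_def)

lemma mat_over_3_6: "mat_over (GF q 3) M \<Longrightarrow> mat_over (GF q 6) (M :: 'a ^ 'm ^ 'n)"
  by (simp add: GF_6 mat_over_def vec_over_def)

lemma vec_over_mono: "d dvd e \<Longrightarrow> vec_over (GF q d) x \<Longrightarrow> vec_over (GF q e) (x :: 'a ^ 'n)"
  using GF_mono[of d e] by (auto simp: vec_over_def)

text \<open>The conjugate of \<open>B\<close> is again an inverse of \<open>A\<close>, and inverses
  are unique.\<close>

lemma mat_over_inverse:
  fixes A :: "'a ^ 'n ^ 'n"
  assumes "mat_over (GF q d) A" "A ** B = mat 1" "B ** A = mat 1"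
  shows "mat_over (GF q d) B"
proof -
  have "frobm d A ** frobm d B = mat 1" using assms(2) by (simp flip: frobm_mult add: frobm_mat_1)
  then have "A ** frobm d B = mat 1" using assms(1) by (simp add: mat_over_iff_frobm)
  then have "(B ** A) ** frobm d B = B" by (simp flip: matrix_mul_assoc)
  then show ?thesis using assms(3) by (simp add: mat_over_iff_frobm)
qed

text \<open>The Frobenius map is semilinear; for the reverse inclusion each scalar is replaced by
  its unique root of order q^k.\<close>

lemma frob_span: "frob (q ^ k) ` vec.span S = vec.span (frob (q ^ k) ` (S :: ('a ^ 'n) set))"
proof
  show "frob (q ^ k) ` vec.span S \<subseteq> vec.span (frob (q ^ k) ` S)"
  proof (safe, erule vec.span_induct_alt)
    fix c :: 'a and x y :: "'a ^ 'n"
    assume "x \<in> S" "frob (q ^ k) y \<in> vec.span (frob (q ^ k) ` S)"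
    then show "frob (q ^ k) (c *s x + y) \<in> vec.span (frob (q ^ k) ` S)"
      by (auto simp: frob_add frob_scale intro!: vec.span_add vec.span_scale intro: vec.span_base)
  qed (simp add: vec.span_zero)
  show "vec.span (frob (q ^ k) ` S) \<subseteq> frob (q ^ k) ` vec.span S"
  proof (rule vec.span_minimal)
    show "vec.subspace (frob (q ^ k) ` vec.span S)"
    proof (rule vec.subspaceI)
      show "0 \<in> frob (q ^ k) ` vec.span S" by (rule image_eqI[of _ _ 0]) (auto simp: vec.span_zero)
    next
      fix x y assume "x \<in> frob (q ^ k) ` vec.span S" "y \<in> frob (q ^ k) ` vec.span S"
      then show "x + y \<in> frob (q ^ k) ` vec.span S" by (auto simp: vec.span_add simp flip: frob_add)
    next
      fix c :: 'a and x assume "x \<in> frob (q ^ k) ` vec.span S"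
      then obtain y where "x = frob (q ^ k) y" "y \<in> vec.span S" by auto
      moreover obtain c' where "c = c' ^ q ^ k" using pow_surj[of k c] by auto
      ultimately show "c *s x \<in> frob (q ^ k) ` vec.span S"
        by (auto simp: vec.span_scale simp flip: frob_scale)
    qed
  qed (auto simp: vec.span_base)
qed

end

section \<open>Projective points as one-dimensional spans\<close>

lemma mat_span: "(*v) M ` vec.span S = vec.span ((*v) (M :: 'a::field ^ 'm ^ 'n) ` S)"
  by (rule vec.span_image[symmetric])

lemma proj_pt_iff: "y \<in> proj_pt x \<longleftrightarrow> (\<exists>c. y = c *s x)"
  by (auto simp: proj_pt_def vec.span_singleton)

lemma proj_pt_self: "x \<in> proj_pt x" by (simp add: proj_pt_def vec.span_base)

lemma proj_pt_subset: "vec.subspace U \<Longrightarrow> proj_pt x \<subseteq> U \<longleftrightarrow> x \<in> U"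
  using proj_pt_self vec.span_minimal[of "{x}" U] unfolding proj_pt_def by auto

lemma proj_pt_scale: "c \<noteq> 0 \<Longrightarrow> proj_pt (c *s x) = proj_pt (x :: 'a::field ^ 'n)"
  unfolding proj_pt_def
  by (rule vec.span_eq[THEN iffD2])
     (auto simp: vec.span_singleton vec.span_breakdown_eq intro: vec.span_scale[of x _ c]
       rangeI exI[of _ "inverse c"] image_eqI[of _ _ "inverse c"])

lemma proj_pt_eq: "proj_pt x = proj_pt y \<Longrightarrow> \<exists>c. x = c *s y"
  using proj_pt_self[of x] proj_pt_iff by auto

lemma proj_pt_image: "(*v) M ` proj_pt x = proj_pt (M *v x)"
  by (simp add: proj_pt_def mat_span)

lemma PG_nonzero: "proj_pt x \<in> PG F \<Longrightarrow> x \<noteq> (0 :: 'a::field ^ 'n)"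
  by (auto simp: PG_def dest: proj_pt_eq[OF sym])

lemma pts_proj_pt: "vec.subspace U \<Longrightarrow> proj_pt x \<in> pts F U \<longleftrightarrow> proj_pt x \<in> PG F \<and> x \<in> U"
  by (simp add: pts_def proj_pt_subset)


context sextic_field begin

lemma frob_proj_pt: "frob (q ^ k) ` proj_pt x = proj_pt (frob (q ^ k) (x :: 'a ^ 'n))"
  by (simp add: proj_pt_def frob_span)

text \<open>An arbitrary representative of a point over \<open>GF q d\<close> need not have its
  coordinates there, but the point is fixed, so the Frobenius map only rescales it.\<close>

lemma PG_frob:
  assumes "proj_pt x \<in> PG (GF q d)"
  shows "\<exists>c. frob (q ^ d) x = c *s (x :: 'a ^ 'n)"
proof -
  obtain y where y: "proj_pt x = proj_pt y" "frob (q ^ d) y = y"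
    using assms by (auto simp: PG_def vec_over_iff_frob)
  have "frob (q ^ d) ` proj_pt x = proj_pt x"
    unfolding y(1) frob_proj_pt y(2) ..
  then have "frob (q ^ d) x \<in> proj_pt x" using proj_pt_self by blast
  then show ?thesis by (simp add: proj_pt_iff)
qed

lemma PG_I: "x \<noteq> 0 \<Longrightarrow> vec_over F x \<Longrightarrow> proj_pt (x :: 'a ^ 'n) \<in> PG F"
  by (auto simp: PG_def)

end

section \<open>Ternary quadratic forms and conics\<close>

definition bil :: "'a::field ^ 'n ^ 'n \<Rightarrow> 'a ^ 'n \<Rightarrow> 'a ^ 'n \<Rightarrow> 'a" where
  "bil M x y = (\<Sum>i\<in>UNIV. \<Sum>j\<in>UNIV. M $ i $ j * x $ i * y $ j)"

definition pol :: "'a::field ^ 'n ^ 'n \<Rightarrow> 'a ^ 'n \<Rightarrow> 'a ^ 'n \<Rightarrow> 'a" where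
  "pol M x y = bil M x y + bil M y x"

text \<open>The gradient of \<open>qform M\<close> at \<open>x\<close>, that is, the coefficient
  vector of the linear form \<open>pol M x\<close>. It is the expression that occurs in
  \<open>nondegenerate\<close>.\<close>

definition pol_vec :: "'a::field ^ 'n ^ 'n \<Rightarrow> 'a ^ 'n \<Rightarrow> 'a ^ 'n" where
  "pol_vec M x = (\<chi> j. \<Sum>i\<in>UNIV. (M $ i $ j + M $ j $ i) * x $ i)"

lemma qform_bil: "qform M x = bil M x x" by (simp add: qform_def bil_def)

lemma bil_add: "bil M (x + y) z = bil M x z + bil M y z" "bil M z (x + y) = bil M z x + bil M z y"
  by (simp_all add: bil_def algebra_simps sum.distrib)

lemma bil_scale: "bil M (c *s x) z = c * bil M x z" "bil M z (c *s x) = c * bil M z x"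
  by (simp_all add: bil_def algebra_simps sum_distrib_left)

lemma bil_0: "bil M 0 z = 0" "bil M z 0 = 0" by (simp_all add: bil_def)

lemma bil_sum: "bil M (sum f A) z = (\<Sum>i\<in>A. bil M (f i) z)" "bil M z (sum f A) = (\<Sum>i\<in>A. bil M z (f i))"
  by (induction A rule: infinite_finite_induct) (simp_all add: bil_add bil_0)

lemma pol_add: "pol M (x + y) z = pol M x z + pol M y z" "pol M z (x + y) = pol M z x + pol M z y"
  by (simp_all add: pol_def bil_add)

lemma pol_scale: "pol M (c *s x) z = c * pol M x z" "pol M z (c *s x) = c * pol M z x"
  by (simp_all add: pol_def bil_scale algebra_simps)

lemma pol_commute: "pol M x y = pol M y x" by (simp add: pol_def add.commute)

lemma pol_self: "pol M x x = 2 * qform M x" by (simp add: pol_def qform_bil)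

lemma qform_add: "qform M (x + y) = qform M x + qform M y + pol M x y"
  by (simp add: qform_bil pol_def bil_add)

lemma qform_scale: "qform M (c *s x) = c ^ 2 * qform M x"
  by (simp add: qform_bil bil_scale power2_eq_square)

lemma qform_0 [simp]: "qform M 0 = 0" by (simp add: qform_bil bil_0)

lemma pol_pol_vec: "pol M x y = (\<Sum>j\<in>UNIV. pol_vec M x $ j * y $ j)"
proof -
  have "bil M y x = (\<Sum>j\<in>UNIV. \<Sum>i\<in>UNIV. M $ j $ i * x $ i * y $ j)"
    by (simp add: bil_def mult_ac)
  moreover have "bil M x y = (\<Sum>j\<in>UNIV. \<Sum>i\<in>UNIV. M $ i $ j * x $ i * y $ j)"
    unfolding bil_def by (rule sum.swap)
  ultimately show ?thesis
    by (simp add: pol_def pol_vec_def sum_distrib_right sum_distrib_left algebra_simps sum.distrib)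
qed

lemma pol_vec_eq_0_iff: "pol_vec M x = 0 \<longleftrightarrow> (\<forall>y. pol M x y = 0)"
proof
  assume *: "\<forall>y. pol M x y = 0"
  have "pol_vec M x $ k = pol M x (axis k 1)" for k
    by (simp add: pol_pol_vec axis_def if_distrib[of "\<lambda>z. _ * z"] cong: if_cong)
  then show "pol_vec M x = 0" using * by (simp add: vec_eq_iff)
qed (simp add: pol_pol_vec)

lemma nondegenerate_iff:
  "nondegenerate M \<longleftrightarrow> \<not> (\<exists>x. x \<noteq> 0 \<and> qform M x = 0 \<and> (\<forall>y. pol M x y = 0))"
  unfolding nondegenerate_def pol_vec_eq_0_iff[symmetric] by (simp add: pol_vec_def vec_eq_iff)

lemma qform_product: 
  "qform (\<chi> i j. a $ i * b $ j) x = (\<Sum>i\<in>UNIV. a $ i * x $ i) * (\<Sum>j\<in>UNIV. b $ j * x $ j)"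
  by (simp add: qform_def sum_product mult_ac)

lemma qform_diff_mat: "qform (M - N) x = qform M x - qform N x"
  by (simp add: qform_def algebra_simps sum_subtractf)

definition col_mat :: "'a ^ 'n \<Rightarrow> 'a ^ 'n \<Rightarrow> 'a ^ 'n \<Rightarrow> 'a ^ 3 ^ 'n" where
  "col_mat a b c = (\<chi> i j. if j = 1 then a $ i else if j = 2 then b $ i else c $ i)"

lemma col_mat_mult: "col_mat a b c *v y = y $ 1 *s a + y $ 2 *s b + y $ 3 *s (c :: 'a::field ^ 'n)"
  by (simp add: vec_eq_iff matrix_vector_mult_def col_mat_def sum_3 mult.commute)

lemma vec3_expand: "A *v y = y $ 1 *s (A *v axis 1 1) + y $ 2 *s (A *v axis 2 1) + y $ 3 *s (A *v axis 3 1)"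
  for A :: "'a::field ^ 3 ^ 'n"
  by (simp add: vec_eq_iff matrix_vector_mult_def axis_def sum_3 mult.commute)

lemma invertible_mult_cancel: "invertible A \<Longrightarrow> A *v x = A *v y \<longleftrightarrow> x = (y :: 'a::field ^ 'n)"
  by (metis invertible_def matrix_vector_mul_assoc matrix_vector_mul_lid)

lemma invertible_mult_surj: "invertible A \<Longrightarrow> \<exists>y. x = A *v (y :: 'a::field ^ 'n)"
  by (metis invertible_def matrix_vector_mul_assoc matrix_vector_mul_lid)

lemma invertible_of_kernel:
  assumes "\<And>y. A *v y = 0 \<Longrightarrow> y = 0" shows "invertible (A :: 'a::field ^ 'n ^ 'n)"
  using assms invertible_left_inverse matrix_left_invertible_ker by blast

section \<open>The standard conic y_2^2 = y_1 y_3 with homogeneous parameters (s, t)\<close>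

definition xx :: "'a::field \<Rightarrow> 'a \<Rightarrow> 'a ^ 3" where
  "xx s t = vector [s ^ 2, s * t, t ^ 2]"

lemma xx_nth [simp]: "xx s t $ 1 = s ^ 2" "xx s t $ 2 = s * t" "xx s t $ 3 = t ^ 2"
  by (simp_all add: xx_def)

definition std_conic :: "'a::field set \<Rightarrow> ('a ^ 3) set set" where
  "std_conic F = {proj_pt (xx s t) | s t. s \<in> F \<and> t \<in> F \<and> (s, t) \<noteq> (0, 0)}"

lemma std_conicI: "s \<in> F \<Longrightarrow> t \<in> F \<Longrightarrow> (s, t) \<noteq> (0, 0) \<Longrightarrow> proj_pt (xx s t) \<in> std_conic F"
  unfolding std_conic_def by blast

definition std_form :: "'a::field ^ 3 \<Rightarrow> 'a" where
  "std_form y = (y $ 2) ^ 2 - y $ 1 * y $ 3"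

lemma xx_eq_0_iff [simp]: "xx s t = 0 \<longleftrightarrow> s = 0 \<and> t = 0"
  by (auto simp: vec_eq_iff forall_3)

lemma xx_scale: "xx (c * s) (c * t) = c ^ 2 *s xx s t"
  by (simp add: vec_eq_iff forall_3 power2_eq_square mult_ac)

lemma std_form_xx [simp]: "std_form (xx s t) = 0"
  by (simp add: std_form_def power2_eq_square mult_ac)

text \<open>If y_1 is nonzero, then y_2^2 = y_1 y_3 shows that the parameters (y_1, y_2) give y_1
  times y; otherwise y is a multiple of (0, 0, 1), with parameters (0, 1).\<close>

lemma std_form_zero:
  assumes "std_form y = 0" "y \<noteq> 0" "\<And>i. y $ i \<in> F" "0 \<in> F" "1 \<in> F"
  obtains s t c where "s \<in> F" "t \<in> F" "(s, t) \<noteq> (0, 0)" "c \<noteq> 0" "xx s t = c *s y"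
proof (cases "y $ 1 = 0")
  case False
  show ?thesis
    by (rule that[of "y $ 1" "y $ 2" "y $ 1"])
       (use False assms in \<open>auto simp: vec_eq_iff forall_3 std_form_def power2_eq_square\<close>)
next
  case True
  then have "y $ 2 = 0" "y $ 3 \<noteq> 0" using assms(1,2) by (auto simp: std_form_def vec_eq_iff forall_3)
  then show ?thesis
    by (intro that[of 0 1 "inverse (y $ 3)"]) (use True assms in \<open>auto simp: vec_eq_iff forall_3\<close>)
qed

context sextic_field begin

section \<open>Zeros and normal form of ternary quadratic forms over \<open>GF q 1\<close>\<close>

lemma pol_vec_over: "mat_over (GF q d) M \<Longrightarrow> vec_over (GF q d) x \<Longrightarrow> vec_over (GF q d) (pol_vec M (x :: 'a ^ 'n))"
  by (auto simp: mat_over_def vec_over_def pol_vec_def intro!: GF_sum GF_mult GF_add)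

lemma qform_over: "mat_over (GF q d) M \<Longrightarrow> vec_over (GF q d) x \<Longrightarrow> qform M (x :: 'a ^ 'n) \<in> GF q d"
  by (auto simp: mat_over_def vec_over_def qform_def intro!: GF_sum GF_mult)

lemma pol_over: "mat_over (GF q d) M \<Longrightarrow> vec_over (GF q d) x \<Longrightarrow> vec_over (GF q d) y \<Longrightarrow> pol M (x :: 'a ^ 'n) y \<in> GF q d"
  by (auto simp: mat_over_def vec_over_def pol_def bil_def intro!: GF_sum GF_mult GF_add)

lemma vec_over_lincomb:
  "x \<in> GF q d \<Longrightarrow> vec_over (GF q d) v \<Longrightarrow> vec_over (GF q d) (x *s (v :: 'a ^ 'n))"
  "vec_over (GF q d) v \<Longrightarrow> vec_over (GF q d) w \<Longrightarrow> vec_over (GF q d) (v + (w :: 'a ^ 'n))"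
  by (auto simp: vec_over_def intro!: GF_mult GF_add)

lemma vec_over_axis: "vec_over (GF q d) (axis i 1 :: 'a ^ 'n)"
  by (simp add: vec_over_def axis_def)

text \<open>In characteristic 2, q is twice a power of 2, so x = x^q is visibly a square.\<close>

lemma sqrt_char_2: assumes "(2::'a) = 0" "(x::'a) \<in> GF q 1" obtains y where "y \<in> GF q 1" "y ^ 2 = x"
proof -
  have "CHAR('a) dvd 2" using assms(1) of_nat_eq_0_iff_char_dvd[of 2, where 'a='a] by simp
  then have "CHAR('a) = 2" using prime_CHAR by (simp add: primes_dvd_imp_eq)
  then obtain n where "q = 2 ^ n" using q_CHAR_power by auto
  then have "q = 2 * 2 ^ (n - 1)" using q_ge by (cases n) auto
  then have "(x ^ 2 ^ (n - 1)) ^ 2 = x"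
    using assms(2) by (simp add: GF_def flip: power_mult) (simp add: mult.commute)
  then show ?thesis using that GF_power[OF assms(2)] by blast
qed

text \<open>The values a x^2 and -c - b y^2 each fill at least (q + 1)/2 elements of a field with q
  elements, so the two value sets meet.\<close>

lemma sum_two_squares:
  assumes "a \<in> GF q 1" "b \<in> GF q 1" "c \<in> GF q 1" "a \<noteq> 0" "b \<noteq> 0" "(2::'a) \<noteq> 0"
  obtains x y where "x \<in> GF q 1" "y \<in> GF q 1" "a * x ^ 2 + b * y ^ 2 + c = (0 :: 'a)"
proof -
  let ?F = "GF q 1 :: 'a set"
  have card: "card (f ` ?F) * 2 \<ge> q + 1"
    if f: "\<And>x y. x \<in> ?F \<Longrightarrow> y \<in> ?F \<Longrightarrow> f x = f y \<Longrightarrow> x ^ 2 = y ^ 2" for f :: "'a \<Rightarrow> 'a"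
  proof -
    have "card (?F - {0}) \<le> 2 * card (f ` (?F - {0}))"
      by (rule card_le_two_card_image[where h = uminus])
         (use f in \<open>auto simp: power2_eq_iff\<close>)
    moreover have "card (?F - {0}) = q - 1" by (simp add: card_GF)
    moreover have "f 0 \<notin> f ` (?F - {0})"
    proof
      assume "f 0 \<in> f ` (?F - {0})"
      then obtain x where "f 0 = f x" "x \<in> ?F - {0}" by (rule imageE)
      then show False using f[of x 0] by simp
    qed
    moreover have "f ` ?F = insert (f 0) (f ` (?F - {0}))" by (auto intro: rev_image_eqI)
    ultimately show ?thesis using q_ge by simp
  qed
  let ?f = "\<lambda>x. a * x ^ 2" and ?g = "\<lambda>y. - c + (- b) * y ^ 2"
  have "card (?f ` ?F) * 2 \<ge> q + 1" by (rule card) (use assms(4) in simp)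
  moreover have "card (?g ` ?F) * 2 \<ge> q + 1" by (rule card) (use assms(5) in simp)
  moreover have un: "card (?f ` ?F \<union> ?g ` ?F) \<le> q"
  proof -
    have "?f ` ?F \<union> ?g ` ?F \<subseteq> ?F" using assms by (auto intro!: GF_closed)
    then have "card (?f ` ?F \<union> ?g ` ?F) \<le> card ?F" by (intro card_mono) auto
    then show ?thesis by (simp add: card_GF)
  qed
  ultimately have "?f ` ?F \<inter> ?g ` ?F \<noteq> {}"
    using card_Un_disjoint[of "?f ` ?F" "?g ` ?F"] by fastforce
  then obtain x y where "x \<in> ?F" "y \<in> ?F" "a * x ^ 2 = - c + (- b) * y ^ 2" by auto
  then show ?thesis by (intro that[of x y]) (simp_all add: algebra_simps)
qed

text \<open>Assume there is no zero. In characteristic 2, on two independent vectors that are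
  orthogonal for the polar form, the form is a x^2 + b y^2, and square roots of b and a give the
  value 2ab = 0. Otherwise an orthogonal triple diagonalises the form and
  \<open>sum_two_squares\<close> applies.\<close>

lemma ternary_form_rational_zero:
  fixes M :: "'a ^ 3 ^ 3"
  assumes M: "mat_over (GF q 1) M"
  obtains x where "x \<noteq> 0" "vec_over (GF q 1) x" "qform M x = 0"
proof (cases "\<exists>x. x \<noteq> 0 \<and> vec_over (GF q 1) x \<and> qform M x = 0")
  case False
  then have nz: "qform M x \<noteq> 0" if "x \<noteq> 0" "vec_over (GF q 1) x" for x using that by blast
  define e :: "'a ^ 3" where "e = axis 1 1"
  have e: "e \<noteq> 0" "vec_over (GF q 1) e" by (simp_all add: e_def vec_over_axis)
  show ?thesis
  proof (cases "(2::'a) = 0")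
    case True
    \<comment> \<open>The second equation makes the first coordinate of \<open>v\<close> zero, so
      that \<open>v\<close> is independent of \<open>e\<close>.\<close>
    obtain v where v: "v \<noteq> 0" "vec_over (GF q 1) v" "pol M e v = 0" "(\<Sum>i\<in>UNIV. e $ i * v $ i) = 0"
      unfolding pol_pol_vec by (rule two_linear_equations[OF one_dvd pol_vec_over[OF M e(2)] e(2)])
    have v1: "v $ 1 = 0" using v(4) by (simp add: e_def axis_def sum_3)
    obtain x where x: "x \<in> GF q 1" "x ^ 2 = qform M v"
      using sqrt_char_2[OF True] qform_over[OF M v(2)] by blast
    obtain y where y: "y \<in> GF q 1" "y ^ 2 = qform M e"
      using sqrt_char_2[OF True] qform_over[OF M e(2)] by blast
    have "x \<noteq> 0" using x nz[OF v(1,2)] by auto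
    then have "(x *s e + y *s v) $ 1 \<noteq> 0" using v1 by (simp add: e_def)
    then have "x *s e + y *s v \<noteq> 0" by (metis zero_index)
    moreover have "qform M (x *s e + y *s v) = 2 * (qform M v * qform M e)"
      by (simp add: qform_add qform_scale pol_scale x y v(3))
    moreover have "vec_over (GF q 1) (x *s e + y *s v)"
      by (intro vec_over_lincomb x y e v)
    ultimately show ?thesis using nz True by force
  next
    case two: False
    obtain v where v: "v \<noteq> 0" "vec_over (GF q 1) v" "pol M e v = 0"
      unfolding pol_pol_vec
      by (rule two_linear_equations[OF one_dvd pol_vec_over[OF M e(2)] pol_vec_over[OF M e(2)]])
    obtain w where w: "w \<noteq> 0" "vec_over (GF q 1) w" "pol M e w = 0" "pol M v w = 0"
      unfolding pol_pol_vec
      by (rule two_linear_equations[OF one_dvd pol_vec_over[OF M e(2)] pol_vec_over[OF M v(2)]])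
    obtain x y where xy: "x \<in> GF q 1" "y \<in> GF q 1" 
      "qform M e * x ^ 2 + qform M v * y ^ 2 + qform M w = 0"
      by (rule sum_two_squares[OF qform_over[OF M e(2)] qform_over[OF M v(2)] qform_over[OF M w(2)]
            nz[OF e] nz[OF v(1,2)] two])
    let ?z = "x *s e + y *s v + w"
    have "qform M ?z = 0"
      using xy(3) by (simp add: qform_add qform_scale pol_scale pol_add v(3) w(3,4) pol_commute[of M w] algebra_simps)
    \<comment> \<open>Pairing with \<open>w\<close> shows that the zero just found is not the zero
      vector.\<close>
    moreover have "pol M w ?z = 2 * qform M w"
      using w by (simp add: pol_add pol_scale pol_self pol_commute[of M w])
    then have "?z \<noteq> 0" using nz[OF w(1,2)] two by (auto simp: pol_def bil_0)
    moreover have "vec_over (GF q 1) ?z" by (intro vec_over_lincomb xy e v w)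
    ultimately show ?thesis using nz by blast
  qed
qed (use that in blast)

lemma col_mat_over: "vec_over F a \<Longrightarrow> vec_over F b \<Longrightarrow> vec_over F c \<Longrightarrow> mat_over F (col_mat a b c)"
  by (simp add: mat_over_def vec_over_def col_mat_def)

text \<open>A hyperbolic pair p, n of zeros and a vector m orthogonal to both bring the form to b
  y_1 y_3 + k y_2^2, in every characteristic.\<close>

lemma conic_normal_form:
  fixes M :: "'a ^ 3 ^ 3"
  assumes M: "mat_over (GF q 1) M" and nd: "nondegenerate M"
  obtains N k where "mat_over (GF q 1) N" "invertible N" "k \<noteq> 0" "\<And>y. qform M (N *v y) = k * std_form y"
proof -
  obtain p where p: "p \<noteq> 0" "vec_over (GF q 1) p" "qform M p = 0"
    using ternary_form_rational_zero[OF M] .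
  then have "pol_vec M p \<noteq> 0" using nd unfolding nondegenerate_iff pol_vec_eq_0_iff by blast
  then obtain i where "pol_vec M p $ i \<noteq> 0" by (auto simp: vec_eq_iff)
  define n0 :: "'a ^ 3" where "n0 = axis i 1"
  have n0: "pol M p n0 \<noteq> 0"
    using \<open>pol_vec M p $ i \<noteq> 0\<close>
    by (simp add: n0_def pol_pol_vec axis_def if_distrib[of "\<lambda>z. _ * z"] cong: if_cong)
  have n0F: "vec_over (GF q 1) n0" by (simp add: n0_def vec_over_axis)
  define b where "b = pol M p n0"
  \<comment> \<open>Moving \<open>n0\<close> along its line to \<open>p\<close> changes the value of
    the form linearly, by c b; this choice puts \<open>n\<close> on the conic.\<close>
  define c where "c = - qform M n0 / b"
  define n where "n = n0 + c *s p"
  have b: "b \<noteq> 0" "b \<in> GF q 1" unfolding b_def using n0 pol_over[OF M p(2) n0F] by auto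
  have nF: "vec_over (GF q 1) n"
    unfolding n_def c_def by (intro vec_over_lincomb n0F p GF_divide GF_uminus qform_over M b)
  have pp: "pol M p p = 0" using p by (simp add: pol_self)
  have pn: "pol M p n = b" by (simp add: n_def pol_add pol_scale pp b_def)
  have qn: "qform M n = 0"
    using b p by (simp add: n_def qform_add qform_scale pol_scale pol_commute[of M n0] b_def[symmetric])
      (simp add: c_def)
  have nn: "pol M n n = 0" by (simp add: pol_self qn)
  obtain m where m: "m \<noteq> 0" "vec_over (GF q 1) m" "pol M p m = 0" "pol M n m = 0"
    unfolding pol_pol_vec
    by (rule two_linear_equations[OF one_dvd pol_vec_over[OF M p(2)] pol_vec_over[OF M nF]])
  define k where "k = qform M m"
  \<comment> \<open>The factor -k/b turns b y_1 y_3 into -k y_1 y_3, so that \<open>k\<close> can be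
    taken out.\<close>
  define N where "N = col_mat p m ((- k / b) *s n)"
  have ker: "y = 0" if y: "y $ 1 *s p + y $ 2 *s m + y $ 3 *s n = 0" for y :: "'a ^ 3"
  proof -
    have "pol M p (y $ 1 *s p + y $ 2 *s m + y $ 3 *s n) = y $ 3 * b"
      by (simp add: pol_add pol_scale pp pn m)
    then have 3: "y $ 3 = 0" unfolding y using b by (simp add: pol_def bil_0)
    have "pol M n (y $ 1 *s p + y $ 2 *s m + y $ 3 *s n) = y $ 1 * b"
      by (simp add: pol_add pol_scale nn pn m pol_commute[of M n p])
    then have 1: "y $ 1 = 0" unfolding y using b by (simp add: pol_def bil_0)
    have "y $ 2 = 0" using y 1 3 m(1) by simp
    then show ?thesis using 1 3 by (simp add: vec_eq_iff forall_3)
  qed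
  \<comment> \<open>Otherwise \<open>m\<close> would be a zero orthogonal to everything, that is, a
    singular point.\<close>
  have k: "k \<noteq> 0"
  proof
    assume "k = 0"
    have inv: "invertible (col_mat p m n)"
      by (rule invertible_of_kernel) (rule ker, simp only: col_mat_mult)
    have "pol M m z = 0" for z
    proof -
      obtain y where "z = col_mat p m n *v y" using invertible_mult_surj[OF inv] by blast
      then show ?thesis
        using m \<open>k = 0\<close> by (simp add: col_mat_mult pol_add pol_scale pol_commute[of M m] pol_self k_def)
    qed
    then show False using nd m(1) \<open>k = 0\<close> unfolding nondegenerate_iff k_def by blast
  qed
  show ?thesis
  proof (rule that[of N k])
    have "k \<in> GF q 1" unfolding k_def by (intro qform_over M m)
    then show "mat_over (GF q 1) N"
      unfolding N_def by (intro col_mat_over p m vec_over_lincomb nF GF_divide GF_uminus b)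
    show "invertible N"
    proof (rule invertible_of_kernel)
      fix y assume "N *v y = 0"
      then have "y $ 1 *s p + y $ 2 *s m + (y $ 3 * (- k / b)) *s n = 0"
        by (simp add: N_def col_mat_mult)
      then have "(vector [y $ 1, y $ 2, y $ 3 * (- k / b)] :: 'a ^ 3) = 0" by - (rule ker, simp)
      then show "y = 0" using k b by (simp add: vec_eq_iff forall_3)
    qed
    fix y
    have "qform M (N *v y) = (y $ 2) ^ 2 * k + y $ 1 * (y $ 3 * (- k / b) * b)"
      unfolding N_def col_mat_mult vec.scale_scale
      by (simp only: qform_add qform_scale pol_add pol_scale p m pn qn pol_commute[of M m n]
          flip: k_def) simp
    then show "qform M (N *v y) = k * std_form y"
      using b by (simp add: std_form_def algebra_simps)
  qed (rule k)
qed

section \<open>Conics of a subplane and their extensions\<close>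

lemma quadric_eq_std_conic:
  fixes A :: "'a ^ 3 ^ 3"
  assumes A: "mat_over (GF q d) A" "invertible A" and k: "k \<noteq> 0"
    and form: "\<And>y. qform M (A *v y) = k * std_form y"
  shows "quadric (GF q d) M = (\<lambda>P. (*v) A ` P) ` std_conic (GF q d)"
proof -
  obtain B where B: "A ** B = mat 1" "B ** A = mat 1" using A(2) by (auto simp: invertible_def)
  have BF: "mat_over (GF q d) B" by (rule mat_over_inverse[OF A(1) B])
  show ?thesis
  proof (intro equalityI subsetI)
    fix P assume "P \<in> quadric (GF q d) M"
    then obtain x where x: "P = proj_pt x" "x \<noteq> 0" "vec_over (GF q d) x" "qform M x = 0"
      using proj_pt_self by (auto simp: quadric_def PG_def)
    define y where "y = B *v x"
    have xy: "x = A *v y" by (simp add: y_def matrix_vector_mul_assoc B)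
    have "std_form y = 0" using form[of y] k x(4) xy by simp
    moreover have "y \<noteq> 0" using x(2) xy by auto
    moreover have "y $ i \<in> GF q d" for i using vec_over_mult[OF BF x(3)] by (simp add: vec_over_def y_def)
    ultimately obtain s t c where *: "s \<in> GF q d" "t \<in> GF q d" "(s, t) \<noteq> (0, 0)" "c \<noteq> 0" "xx s t = c *s y"
      by (rule std_form_zero[of y "GF q d"]) auto
    then have "P = (*v) A ` proj_pt (xx s t)"
      by (simp add: x(1) xy proj_pt_image proj_pt_scale flip: vec.scale)
    then show "P \<in> (\<lambda>P. (*v) A ` P) ` std_conic (GF q d)" using std_conicI[OF *(1-3)] by blast
  next
    fix P assume "P \<in> (\<lambda>P. (*v) A ` P) ` std_conic (GF q d)"
    then obtain s t where st: "s \<in> GF q d" "t \<in> GF q d" "(s, t) \<noteq> (0, 0)" "P = proj_pt (A *v xx s t)"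
      by (auto simp: std_conic_def proj_pt_image)
    have "vec_over (GF q d) (xx s t)"
      using st by (auto simp: vec_over_def forall_3 intro: GF_power GF_mult)
    then have "vec_over (GF q d) (A *v xx s t)" by (rule vec_over_mult[OF A(1)])
    moreover have "A *v xx s t \<noteq> 0"
      using invertible_mult_cancel[OF A(2), of "xx s t" 0] st(3) by auto
    ultimately have "P \<in> PG (GF q d)" unfolding st(4) by (intro PG_I)
    moreover have "qform M (A *v xx s t) = 0" by (simp add: form)
    ultimately show "P \<in> quadric (GF q d) M"
      by (auto simp: quadric_def st(4) proj_pt_iff qform_scale)
  qed
qed

text \<open>The matrix that normalises the conic is invertible over \<open>GF q 1\<close>, hence
  permutes PG(2,q), and can be absorbed into the coordinatising matrix without changing the
  subplane.\<close>

lemma subplane_conic_normal_form: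
  assumes "subplane_conic q \<pi> \<C>"
  obtains A :: "'a ^ 3 ^ 3" where "mat_over (GF q 3) A" "invertible A"
    "\<pi> = (\<lambda>P. (*v) A ` P) ` PG (GF q 1)" "\<C> = (\<lambda>P. (*v) A ` P) ` std_conic (GF q 1)"
proof -
  obtain A D where A: "mat_over (GF q 3) A" "invertible A" "\<pi> = (\<lambda>P. (*v) A ` P) ` PG (GF q 1)"
    and D: "nondeg_conic (GF q 1) D" "\<C> = (\<lambda>P. (*v) A ` P) ` D"
    using assms unfolding subplane_conic_def by (elim exE conjE)
  obtain M where M: "mat_over (GF q 1) M" "nondegenerate M" "D = quadric (GF q 1) M"
    using D(1) unfolding nondeg_conic_def by (elim exE conjE)
  obtain N k where N: "mat_over (GF q 1) N" "invertible N" "k \<noteq> 0" 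
      "\<And>y. qform M (N *v y) = k * std_form y"
    using conic_normal_form[OF M(1,2)] by metis
  obtain N' where N': "N ** N' = mat 1" "N' ** N = mat 1" using N(2) by (auto simp: invertible_def)
  have N'F: "mat_over (GF q 1) N'" by (rule mat_over_inverse[OF N(1) N'])
  have pt: "(*v) K ` P \<in> PG (GF q 1)" if "P \<in> PG (GF q 1)" "mat_over (GF q 1) K" "invertible K" 
    for P and K :: "'a ^ 3 ^ 3"
  proof -
    obtain x where "P = proj_pt x" "x \<noteq> 0" "vec_over (GF q 1) x" using \<open>P \<in> PG (GF q 1)\<close> by (auto simp: PG_def)
    then show ?thesis
      using vec_over_mult[OF that(2)] invertible_mult_cancel[OF that(3), of x 0]
      by (auto simp: proj_pt_image intro!: PG_I)
  qed
  have PGN: "PG (GF q 1) = (\<lambda>P. (*v) N ` P) ` PG (GF q 1)"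
  proof (intro equalityI subsetI)
    fix P :: "('a ^ 3) set" assume "P \<in> PG (GF q 1)"
    moreover have "P = (*v) N ` (*v) N' ` P" by (simp add: image_image matrix_vector_mul_assoc N')
    moreover have "invertible N'" using N' by (auto simp: invertible_def)
    ultimately show "P \<in> (\<lambda>P. (*v) N ` P) ` PG (GF q 1)" using pt[OF _ N'F] by blast
  qed (use pt N in blast)
  have "mat_over (GF q 3) (A ** N)" by (rule mat_over_mult[OF A(1) mat_over_1_any[OF N(1)]])
  moreover have "invertible (A ** N)" using A(2) N(2) by (rule invertible_mult)
  moreover have "\<pi> = (\<lambda>P. (*v) (A ** N) ` P) ` PG (GF q 1)"
    unfolding A(3) by (subst PGN) (simp only: image_image matrix_vector_mul_assoc)
  moreover have "\<C> = (\<lambda>P. (*v) (A ** N) ` P) ` std_conic (GF q 1)"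
    unfolding D(2) M(3) quadric_eq_std_conic[OF N] by (simp only: image_image matrix_vector_mul_assoc)
  ultimately show ?thesis using that by blast
qed

lemma nondeg_conic_std:
  fixes A :: "'a ^ 3 ^ 3"
  assumes A: "mat_over (GF q d) A" "invertible A"
  shows "nondeg_conic (GF q d) ((\<lambda>P. (*v) A ` P) ` std_conic (GF q d))"
proof -
  obtain B where B: "A ** B = mat 1" "B ** A = mat 1" using A(2) by (auto simp: invertible_def)
  have BF: "mat_over (GF q d) B" by (rule mat_over_inverse[OF A(1) B])
  define M where "M = (\<chi> i j. B $ 2 $ i * B $ 2 $ j) - (\<chi> i j. B $ 1 $ i * B $ 3 $ j)"
  have "qform M x = std_form (B *v x)" for x
    unfolding M_def qform_diff_mat qform_product
    by (simp add: std_form_def matrix_vector_mult_def power2_eq_square)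
  then have form: "qform M (A *v y) = 1 * std_form y" for y
    by (simp add: matrix_vector_mul_assoc B)
  have "nondegenerate M"
    unfolding nondegenerate_iff
  proof (rule notI, elim exE conjE)
    fix x assume x: "x \<noteq> 0" "qform M x = 0" "\<forall>y. pol M x y = 0"
    obtain u where u: "x = A *v u" using invertible_mult_surj[OF A(2)] by blast
    \<comment> \<open>At a singular point the polar form vanishes, so the form is additive there;
      the vectors (1,0,0) and (0,0,1) then detect the third and first coordinates of
      \<open>u\<close>. No division by 2 occurs.\<close>
    have "std_form (u + v) = std_form u + std_form v" for v
    proof -
      have "qform M (A *v u + A *v v) = qform M (A *v u) + qform M (A *v v)"
        using x(3) u by (simp add: qform_add)
      then show ?thesis by (simp add: form flip: matrix_vector_right_distrib)
    qed
    from this[of "axis 1 1"] this[of "axis 3 1"] have "u $ 1 = 0" "u $ 3 = 0"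
      by (simp_all add: std_form_def axis_def algebra_simps)
    moreover have "std_form u = 0" using x(2) u form by simp
    ultimately have "u = 0" by (simp add: std_form_def vec_eq_iff forall_3)
    then show False using x(1) u by simp
  qed
  moreover have "mat_over (GF q d) M"
    using BF by (auto simp: mat_over_def vec_over_def M_def intro!: GF_diff GF_mult)
  ultimately show ?thesis
    unfolding nondeg_conic_def quadric_eq_std_conic[OF A one_neq_zero form, symmetric] by blast
qed

text \<open>A quadratic form restricts to a conic as a quartic in the parameter, so five common points
  force it to be a multiple of the form of the conic.\<close>

lemma form_vanishing_on_conic:
  fixes M :: "'a ^ 'n ^ 'n"
  assumes d: "d dvd 6" "d > 0"
    and zero: "\<And>t. t \<in> GF q d \<Longrightarrow> qform M (Y1 + t *s Y2 + t ^ 2 *s Y3) = 0"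
  shows "qform M (a *s Y1 + b *s Y2 + c *s Y3) = (b ^ 2 - a * c) * qform M Y2"
proof -
  have form: "qform M (a *s Y1 + b *s Y2 + c *s Y3) = a ^ 2 * qform M Y1 + a * b * pol M Y1 Y2
      + a * c * pol M Y1 Y3 + b ^ 2 * qform M Y2 + b * c * pol M Y2 Y3 + c ^ 2 * qform M Y3" for a b c
    by (simp add: qform_add qform_scale pol_add pol_scale algebra_simps)
  \<comment> \<open>The coefficients of the quartic in t. At t^2 two terms merge: they only cancel
    each other, and one free value \<open>qform M Y2\<close> remains.\<close>
  define e where "e i = [qform M Y1, pol M Y1 Y2, pol M Y1 Y3 + qform M Y2, pol M Y2 Y3, qform M Y3] ! i" for i
  have "e i = 0" if "i \<le> 4" for i
  proof (rule coeffs_zero_of_roots[OF _ _ that])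
    show "(\<Sum>i\<le>4. e i * t ^ i) = 0" if "t \<in> GF q d" for t
      using zero[OF that] form[of 1 t "t ^ 2"]
      by (simp add: numeral_eq_Suc e_def algebra_simps)
    have "q ^ 1 \<le> q ^ d" using d q_ge by (intro power_increasing) auto
    then show "4 < card (GF q d :: 'a set)" using d q_ge by (simp add: card_GF)
  qed
  from this[of 0] this[of 1] this[of 2] this[of 3] this[of 4] have
    "qform M Y1 = 0" "pol M Y1 Y2 = 0" "pol M Y1 Y3 = - qform M Y2" "pol M Y2 Y3 = 0" "qform M Y3 = 0"
    by (simp_all add: e_def eq_neg_iff_add_eq_0)
  then show ?thesis unfolding form by (simp add: algebra_simps)
qed

text \<open>The points over the small field already make the form of \<open>D'\<close> a multiple of
  the standard one, and the factor is nonzero because the zero form is degenerate. This is what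
  gives the description operator in \<open>conic_ext\<close> its value.\<close>

lemma nondeg_conic_unique:
  fixes A :: "'a ^ 3 ^ 3"
  assumes A: "mat_over (GF q e) A" "invertible A" and d: "d dvd 6" "d > 0"
    and D': "nondeg_conic (GF q e) D'" "(\<lambda>P. (*v) A ` P) ` std_conic (GF q d) \<subseteq> D'"
  shows "D' = (\<lambda>P. (*v) A ` P) ` std_conic (GF q e)"
proof -
  obtain M where M: "mat_over (GF q e) M" "nondegenerate M" "D' = quadric (GF q e) M"
    using D'(1) unfolding nondeg_conic_def by blast
  let ?a = "\<lambda>i. A *v axis i 1"
  have "qform M (?a 1 + t *s ?a 2 + t ^ 2 *s ?a 3) = 0" if "t \<in> GF q d" for t
  proof -
    have "proj_pt (xx 1 t) \<in> std_conic (GF q d)" using that by (auto intro!: std_conicI)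
    then have "proj_pt (A *v xx 1 t) \<in> quadric (GF q e) M" using D'(2) M(3) by (auto simp: proj_pt_image)
    then have "qform M (A *v xx 1 t) = 0" using proj_pt_self by (auto simp: quadric_def)
    then show ?thesis by (subst (asm) vec3_expand) simp
  qed
  from form_vanishing_on_conic[OF d this]
  have form: "qform M (A *v y) = qform M (?a 2) * std_form y" for y
    unfolding vec3_expand[of A y] by (simp add: std_form_def mult.commute)
  have "qform M (?a 2) \<noteq> 0"
  proof
    assume "qform M (?a 2) = 0"
    then have 0: "qform M x = 0" for x using form invertible_mult_surj[OF A(2), of x] by (metis mult_zero_left)
    have "pol M x y = 0" for x y using qform_add[of M x y] by (simp add: 0)
    moreover have "(axis 1 1 :: 'a ^ 3) \<noteq> 0" by simp
    ultimately show False using M(2) 0 unfolding nondegenerate_iff by blast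
  qed
  then show ?thesis unfolding M(3) by (rule quadric_eq_std_conic[OF A _ form])
qed

lemma conic_ext_std:
  fixes A :: "'a ^ 3 ^ 3"
  assumes A: "mat_over (GF q e) A" "invertible A" and d: "d dvd 6" "d > 0" "d dvd e"
  shows "conic_ext (GF q e) ((\<lambda>P. (*v) A ` P) ` std_conic (GF q d)) = (\<lambda>P. (*v) A ` P) ` std_conic (GF q e)"
  unfolding conic_ext_def
proof (rule the_equality)
  have "std_conic (GF q d) \<subseteq> (std_conic (GF q e) :: ('a ^ 3) set set)"
    using GF_mono[OF d(3)] unfolding std_conic_def by blast
  then show "nondeg_conic (GF q e) ((\<lambda>P. (*v) A ` P) ` std_conic (GF q e)) \<and>
      (\<lambda>P. (*v) A ` P) ` std_conic (GF q d) \<subseteq> (\<lambda>P. (*v) A ` P) ` std_conic (GF q e)"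
    using nondeg_conic_std[OF A] by blast
next
  fix D' assume "nondeg_conic (GF q e) D' \<and> (\<lambda>P. (*v) A ` P) ` std_conic (GF q d) \<subseteq> D'"
  then show "D' = (\<lambda>P. (*v) A ` P) ` std_conic (GF q e)"
    by (elim conjE) (rule nondeg_conic_unique[OF A d(1,2)])
qed

end

section \<open>The Bose scroll of a conic\<close>

lemma all_less_3: "(\<forall>k<3::nat. P k) \<longleftrightarrow> P 0 \<and> P 1 \<and> P 2"
  by (auto simp: numeral_3_eq_3 numeral_2_eq_2 less_Suc_eq)

lemma sum_less_3: "(\<Sum>k<3::nat. f k) = f 0 + f 1 + f 2"
  by (simp add: numeral_3_eq_3 numeral_2_eq_2 lessThan_Suc add_ac)

lemma sum_swap3: "(\<Sum>i\<in>A. \<Sum>j\<in>B. \<Sum>k\<in>C. g i j k) = (\<Sum>k\<in>C. \<Sum>i\<in>A. \<Sum>j\<in>B. g i j k)"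
proof -
  have "(\<Sum>i\<in>A. \<Sum>j\<in>B. \<Sum>k\<in>C. g i j k) = (\<Sum>i\<in>A. \<Sum>k\<in>C. \<Sum>j\<in>B. g i j k)"
    by (rule sum.cong[OF refl sum.swap])
  also have "\<dots> = (\<Sum>k\<in>C. \<Sum>i\<in>A. \<Sum>j\<in>B. g i j k)" by (rule sum.swap)
  finally show ?thesis .
qed

text \<open>Of \<open>bose_frame\<close> this keeps the field of definition and the fact that the
  three conjugate planes span. Both survive the passage from \<open>J\<close> to
  \<open>J ** A\<close>, which moves a subplane to standard position.\<close>

locale bose_coords = sextic_field q ty for q :: nat and ty :: "'a::{field,finite} itself" +
  fixes J :: "'a ^ 3 ^ 9"
  assumes J_over: "mat_over (GF q 3) J"
    and J_spans: "\<And>y. \<exists>z. y = (\<Sum>k<3. frobm k J *v z k)"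
begin

definition emb :: "(nat \<Rightarrow> 'a ^ 3) \<Rightarrow> 'a ^ 9" where
  "emb z = (\<Sum>k<3. frobm k J *v z k)"

text \<open>Only the blocks 0, 1, 2 are determined by the vector; values at larger indices are
  arbitrary, whence the side conditions k < 3 below.\<close>

definition co :: "'a ^ 9 \<Rightarrow> nat \<Rightarrow> 'a ^ 3" where
  "co y = (SOME z. y = emb z)"

lemma emb_co: "emb (co y) = y"
proof -
  have "\<exists>z. y = emb z" using J_spans[of y] by (simp add: emb_def)
  from someI_ex[OF this] show ?thesis unfolding co_def by (rule sym)
qed

lemma emb_cong: "(\<And>k. k < 3 \<Longrightarrow> z k = z' k) \<Longrightarrow> emb z = emb z'"
  by (simp add: emb_def)

lemma emb_add: "emb (\<lambda>k. z k + z' k) = emb z + emb z'"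
  and emb_scale: "emb (\<lambda>k. c *s z k) = c *s emb z"
  by (simp_all add: emb_def sum.distrib vec.scale vec.add vec.scale_sum_right)

text \<open>A surjection between finite sets of the same size is injective.\<close>

lemma emb_inj: assumes "emb z = emb z'" "k < 3" shows "z k = z' k"
proof -
  define f where "f = (\<lambda>(a, b, c). emb (\<lambda>k. if k = 0 then a else if k = 1 then b else c))"
  have f: "emb z = f (z 0, z 1, z 2)" for z
    by (simp add: f_def emb_def sum_less_3)
  have "range f = UNIV"
  proof -
    have "y \<in> range f" for y using f[of "co y"] emb_co[of y] by (metis rangeI)
    then show ?thesis by auto
  qed
  moreover have "card (UNIV :: (('a ^ 3) \<times> ('a ^ 3) \<times> ('a ^ 3)) set) = CARD('a ^ 9)"
    by (simp flip: power_add)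
  ultimately have "inj f" by (intro eq_card_imp_inj_on) auto
  then have "(z 0, z 1, z 2) = (z' 0, z' 1, z' 2)" using assms(1) unfolding f by (rule injD)
  then show ?thesis using assms(2) all_less_3[of "\<lambda>k. z k = z' k"] by auto
qed

lemma co_emb: "k < 3 \<Longrightarrow> co (emb z) k = z k"
  by (rule emb_inj[OF emb_co])

lemma co_eqI: "(\<And>k. k < 3 \<Longrightarrow> co x k = co y k) \<Longrightarrow> x = y"
  by (metis emb_co emb_cong)

lemma co_add: "k < 3 \<Longrightarrow> co (x + y) k = co x k + co y k"
  using co_emb[of k "\<lambda>k. co x k + co y k"] by (simp add: emb_add emb_co)

lemma co_scale: "k < 3 \<Longrightarrow> co (c *s x) k = c *s co x k"
  using co_emb[of k "\<lambda>k. c *s co x k"] by (simp add: emb_scale emb_co)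

lemma co_0: "k < 3 \<Longrightarrow> co 0 k = 0"
  using co_scale[of k 0 0] by simp

lemma co_sum: "k < 3 \<Longrightarrow> co (sum f A) k = (\<Sum>i\<in>A. co (f i) k)"
  by (induction A rule: infinite_finite_induct) (simp_all add: co_0 co_add)

lemma frobm_3: "frobm (k + 3) J = frobm k J"
  using J_over by (simp add: mat_over_iff_frobm add.commute[of k] flip: frobm_frobm)

text \<open>Conjugating block k - 1 lands in block k, and three conjugations restore
  \<open>J\<close>. Modulo 3, k + 2 stands for k - 1 and, in the iterated version, 2j for
  -j.\<close>

lemma frob_emb1: "frob (q ^ 1) (emb z) = emb (\<lambda>k. frob (q ^ 1) (z ((k + 2) mod 3)))"
  using frobm_3[of 0]
  by (simp add: emb_def sum_less_3 frob_add frob_mult_vec frobm_frobm add_ac del: power_one_right One_nat_def)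
     (simp add: eval_nat_numeral)

lemma frob_emb: "frob (q ^ j) (emb z) = emb (\<lambda>k. frob (q ^ j) (z ((k + 2 * j) mod 3)))"
proof (induction j)
  case (Suc j)
  have "frob (q ^ Suc j) (emb z) = frob (q ^ 1) (frob (q ^ j) (emb z))" using frob_frob[of 1 j "emb z"] by simp
  also have "\<dots> = emb (\<lambda>k. frob (q ^ 1) (frob (q ^ j) (z (((k + 2) mod 3 + 2 * j) mod 3))))"
    unfolding Suc frob_emb1 ..
  also have "\<dots> = emb (\<lambda>k. frob (q ^ Suc j) (z ((k + 2 * Suc j) mod 3)))"
    by (rule emb_cong) (use frob_frob[of 1 j] in \<open>simp add: mod_simps\<close>)
  finally show ?case .
qed (auto intro: emb_cong)

lemma co_frob: "k < 3 \<Longrightarrow> co (frob (q ^ j) y) k = frob (q ^ j) (co y ((k + 2 * j) mod 3))"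
  using frob_emb[of j "co y"] by (simp add: emb_co co_emb)

definition sp :: "(nat \<Rightarrow> 'a) \<Rightarrow> 'a ^ 3 \<Rightarrow> 'a ^ 9" where
  "sp w x = emb (\<lambda>k. w k *s x)"

lemma co_sp: "k < 3 \<Longrightarrow> co (sp w x) k = w k *s x"
  by (simp add: sp_def co_emb)

lemma sp_eq_0_iff: "sp w x = 0 \<longleftrightarrow> x = 0 \<or> (\<forall>k<3. w k = 0)"
proof
  assume "sp w x = 0"
  then have "w k *s x = 0" if "k < 3" for k using co_sp[OF that, of w x] that by (simp add: co_0)
  then show "x = 0 \<or> (\<forall>k<3. w k = 0)" by auto
qed (auto simp: sp_def emb_def)

lemma sp_scale: "sp (\<lambda>k. c * w k) x = c *s sp w x"
  by (simp add: sp_def flip: emb_scale)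

lemma frob_sp: "frob (q ^ j) (sp w x) = sp (\<lambda>k. w ((k + 2 * j) mod 3) ^ q ^ j) (frob (q ^ j) x)"
  by (simp add: sp_def frob_emb frob_scale)

lemma J_mult: "J *v x = emb (\<lambda>k. if k = 0 then x else 0)"
proof -
  have "frobm 0 J = J" by (simp add: frobm_def vec_eq_iff)
  then show ?thesis by (simp add: emb_def sum_less_3)
qed

text \<open>The three conjugate planes form a direct sum, so the blocks vary independently, block k
  over the k-th conjugate of \<open>U\<close>.\<close>

lemma conj_span_iff:
  assumes U: "vec.subspace U"
  shows "y \<in> conj_span q ((*v) J ` U) \<longleftrightarrow> (\<forall>k<3. co y k \<in> frob (q ^ k) ` U)" (is "_ \<longleftrightarrow> ?R y")
proof
  have sub: "vec.subspace (frob (q ^ k) ` U)" for k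
    using frob_span[of k U] vec.span_eq_iff U by (metis vec.subspace_span)
  have sub': "vec.subspace {y. ?R y}"
    using vec.subspace_0[OF sub] vec.subspace_add[OF sub] vec.subspace_scale[OF sub]
    by (auto simp: co_0 co_add co_scale intro!: vec.subspaceI)
  have "frob (q ^ j) (J *v x) \<in> {y. ?R y}" if "x \<in> U" "j = 0 \<or> j = 1 \<or> j = 2" for x j
    using that vec.subspace_0[OF U] vec.subspace_0[OF sub[of 1]] vec.subspace_0[OF sub[of 2]]
    by (elim disjE) (auto simp: frob_0[of 1, simplified] co_frob co_frob[of _ 1, simplified] J_mult co_emb all_less_3)
  from this[of _ 0] this[of _ 1] this[of _ 2]
  have "(*v) J ` U \<union> frob q ` (*v) J ` U \<union> frob (q\<^sup>2) ` (*v) J ` U \<subseteq> {y. ?R y}"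
    unfolding power_0 power_one_right frob_power_0[unfolded power_0] by blast
  with sub' have "conj_span q ((*v) J ` U) \<subseteq> {y. ?R y}"
    unfolding conj_span_def by (intro vec.span_minimal)
  then show "?R y" if "y \<in> conj_span q ((*v) J ` U)" using that by blast
next
  assume "?R y"
  then have "\<forall>k<3. \<exists>u. u \<in> U \<and> co y k = frob (q ^ k) u" by blast
  then obtain u where u: "\<And>k. k < 3 \<Longrightarrow> u k \<in> U \<and> co y k = frob (q ^ k) (u k)" by metis
  have "frob (q ^ k) (J *v u k) \<in> conj_span q ((*v) J ` U)" if "k < 3" for k
    using that u[OF that] unfolding conj_span_def
    by (intro vec.span_base) (auto simp: less_Suc_eq numeral_3_eq_3 numeral_2_eq_2 intro: image_eqI[of _ _ "u 0"])
  then have "(\<Sum>k<3. frob (q ^ k) (J *v u k)) \<in> conj_span q ((*v) J ` U)"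
    unfolding conj_span_def by (intro vec.span_sum) simp
  moreover have "(\<Sum>k<3. frob (q ^ k) (J *v u k)) = emb (co y)"
    using u by (simp add: emb_def frob_mult_vec)
  ultimately show "y \<in> conj_span q ((*v) J ` U)" by (simp add: emb_co)
qed

lemma conj_span_proj_pt:
  "y \<in> conj_span q ((*v) J ` proj_pt x) \<longleftrightarrow> (\<forall>k<3. \<exists>c. co y k = c *s frob (q ^ k) x)"
proof -
  have "vec.subspace (proj_pt x)" by (simp add: proj_pt_def)
  then show ?thesis by (simp add: conj_span_iff frob_proj_pt proj_pt_iff)
qed

section \<open>The scroll as the set cut out by quadrics over \<open>GF q 1\<close>\<close>

abbreviation "BP \<equiv> bose_points q J (std_conic (GF q 1))"

lemma sp_lincomb: "sp w (a *s x + b *s y + c *s z) = a *s sp w x + b *s sp w y + c *s sp w z"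
  by (simp add: sp_def vec.scale_right_distrib mult.commute flip: emb_add emb_scale)

lemma xx_expand: "xx s t = s ^ 2 *s axis 1 1 + (s * t) *s axis 2 1 + t ^ 2 *s axis 3 (1::'a)"
  by (simp add: vec_eq_iff forall_3 axis_def)

lemma frob_xx: "frob (q ^ k) (xx s t) = xx (s ^ q ^ k) (t ^ q ^ k :: 'a)"
  by (simp add: vec_eq_iff forall_3 frob_def power_mult_distrib flip: power_mult) (simp add: mult.commute)

text \<open>Since the Frobenius map shifts the blocks, a vector with equal rational blocks is fixed
  by it once the weights are \<alpha>, \<alpha>^q, \<alpha>^(q^2) with \<alpha> in
  \<open>GF q 3\<close>.\<close>

lemma BP_I:
  assumes "\<alpha> \<in> GF q 3" "\<alpha> \<noteq> 0" "t \<in> GF q 1"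
  shows "proj_pt (sp (\<lambda>k. \<alpha> ^ q ^ k) (xx 1 t)) \<in> BP"
proof -
  let ?x = "xx 1 t" and ?y = "sp (\<lambda>k. \<alpha> ^ q ^ k) (xx 1 t)"
  have x: "frob (q ^ k) ?x = ?x" for k
    using GF_1_any[OF assms(3)] by (simp add: frob_xx GF_iff)
  have "\<forall>k<3. (\<alpha> ^ q ^ ((k + 2 * 1) mod 3)) ^ q ^ 1 = \<alpha> ^ q ^ k"
    unfolding all_less_3 using assms(1)
    by (simp add: GF_iff power2_eq_square power3_eq_cube power_mult)
  then have "frob (q ^ 1) ?y = ?y"
    unfolding frob_sp x unfolding sp_def by (intro emb_cong) simp
  then have "vec_over (GF q 1) ?y" by (simp only: vec_over_iff_frob)
  moreover have "?y \<noteq> 0" unfolding sp_eq_0_iff all_less_3 using assms(2) by simp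
  ultimately have "proj_pt ?y \<in> PG (GF q 1)" by (rule PG_I[rotated])
  moreover have "?y \<in> conj_span q ((*v) J ` proj_pt ?x)"
    by (auto simp: conj_span_proj_pt co_sp x)
  ultimately have "proj_pt ?y \<in> pts (GF q 1) (conj_span q ((*v) J ` proj_pt ?x))"
    by (simp add: pts_proj_pt conj_span_def)
  moreover have "proj_pt ?x \<in> std_conic (GF q 1)" using assms(3) by (auto intro!: std_conicI)
  ultimately show ?thesis unfolding bose_points_def by blast
qed

lemma BP_E:
  assumes "P \<in> BP"
  obtains w s t where "P = proj_pt (sp w (xx s t))" "frob (q ^ 1) (sp w (xx s t)) = sp w (xx s t)"
proof -
  obtain s t where st: "s \<in> GF q 1" "t \<in> GF q 1" "P \<in> pts (GF q 1) (conj_span q ((*v) J ` proj_pt (xx s t)))"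
    using assms unfolding bose_points_def std_conic_def by blast
  obtain y where y: "P = proj_pt y" "frob (q ^ 1) y = y" "P \<subseteq> conj_span q ((*v) J ` proj_pt (xx s t))"
    using st(3) unfolding pts_def PG_def vec_over_iff_frob by blast
  have "frob (q ^ k) (xx s t) = xx s t" for k
    using GF_1_any[OF st(1)] GF_1_any[OF st(2)] by (simp add: frob_xx GF_iff)
  then have "\<forall>k<3. \<exists>c. co y k = c *s xx s t"
    using y(1,3) proj_pt_self[of y] conj_span_proj_pt[of y "xx s t"] by auto
  then obtain w where w: "\<And>k. k < 3 \<Longrightarrow> co y k = w k *s xx s t" by metis
  then have "y = sp w (xx s t)" by (intro co_eqI) (simp add: co_sp)
  then show ?thesis using that y by blast
qed

text \<open>Two rounds of counting. For weights \<alpha>, \<alpha>^q, \<alpha>^(q^2) the points of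
  \<open>BP\<close> give q zeros of a quartic in t. For fixed s and t the form is then quadratic in
  the weights and vanishes at all these conjugate triples, so
  \<open>quadratic_form_linearized_zero\<close> makes it vanish for arbitrary weights.\<close>

lemma scroll_in_quadric:
  assumes M: "BP \<subseteq> quadric (GF q 1) M"
  shows "qform M (sp w (xx s t)) = 0"
proof -
  have *: "qform M (sp (\<lambda>k. \<alpha> ^ q ^ k) (xx s t)) = 0" if \<alpha>: "\<alpha> \<in> GF q 3" for \<alpha> s t
  proof (cases "\<alpha> = 0")
    case False
    let ?Y = "\<lambda>i. sp (\<lambda>k. \<alpha> ^ q ^ k) (axis i 1)"
    have "qform M (?Y 1 + t *s ?Y 2 + t ^ 2 *s ?Y 3) = 0" if "t \<in> GF q 1" for t
    proof -
      have "qform M (sp (\<lambda>k. \<alpha> ^ q ^ k) (xx 1 t)) = 0"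
        using BP_I[OF \<alpha> False that] M proj_pt_self unfolding quadric_def by blast
      then show ?thesis unfolding xx_expand sp_lincomb by simp
    qed
    from form_vanishing_on_conic[OF one_dvd zero_less_one this]
    show ?thesis unfolding xx_expand sp_lincomb by (simp add: power2_eq_square)
  qed (simp add: sp_def emb_def zero_power)
  let ?e = "\<lambda>i. frobm i J *v xx s t"
  have eq: "qform M (sp w (xx s t)) = (\<Sum>i<3. \<Sum>j<3. bil M (?e i) (?e j) * w i * w j)" for w
  proof -
    have "qform M (sp w (xx s t)) = (\<Sum>i<3. \<Sum>j<3. bil M (w i *s ?e i) (w j *s ?e j))"
      by (simp only: sp_def emb_def qform_bil vec.scale bil_sum(1)) (simp only: bil_sum(2))
    then show ?thesis by (simp add: bil_scale mult_ac)
  qed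
  have "(\<Sum>i<3. \<Sum>j<3. bil M (?e i) (?e j) * \<alpha> ^ q ^ i * \<alpha> ^ q ^ j) = 0" if "\<alpha> \<in> GF q 3" for \<alpha>
    using *[OF that] eq[of "\<lambda>k. \<alpha> ^ q ^ k"] by simp
  from quadratic_form_linearized_zero[OF this] show ?thesis unfolding eq .
qed

text \<open>The forms over \<open>GF q 1\<close> that vanish on the scroll include all traces of multiples of a form
  over the whole field, and these traces vanish at a point only if the form does.\<close>

lemma quadrics_cut_out:
  assumes y: "\<And>M. mat_over (GF q 1) M \<Longrightarrow> BP \<subseteq> quadric (GF q 1) M \<Longrightarrow> qform M y = 0"
    and M: "\<And>w s t. qform M (sp w (xx s t)) = 0"
  shows "qform M y = 0"
proof -
  have "(\<Sum>k<6. qform (frobm k M) y * \<mu> ^ q ^ k) = 0" for \<mu>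
  proof -
    define T where "T = (\<chi> i j. \<Sum>k<6. (\<mu> * M $ i $ j) ^ q ^ k)"
    have "(\<Sum>k<6. a ^ q ^ k) \<in> GF q 1" for a :: 'a
    proof -
      have "(\<Sum>k<6. a ^ q ^ k) ^ q = (\<Sum>k<6. a ^ q ^ Suc k)" by (simp only: pow_sum1 pow_q_pow)
      also have "\<dots> = (\<Sum>k<6. a ^ q ^ k)" 
        using sum.lessThan_Suc_shift[of "\<lambda>k. a ^ q ^ k" 6]
        unfolding sum.lessThan_Suc pow_q6 by (simp del: power_Suc)
      finally show ?thesis by (simp add: GF_iff)
    qed
    then have TF: "mat_over (GF q 1) T" by (simp add: mat_over_def vec_over_def T_def)
    have T: "qform T x = (\<Sum>k<6. qform (frobm k M) x * \<mu> ^ q ^ k)" for x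
    proof -
      have "qform T x = (\<Sum>i\<in>UNIV. \<Sum>j\<in>UNIV. \<Sum>k<6. (M $ i $ j) ^ q ^ k * x $ i * x $ j * \<mu> ^ q ^ k)"
        by (simp add: qform_def T_def sum_distrib_left sum_distrib_right power_mult_distrib mult_ac)
      also have "\<dots> = (\<Sum>k<6. qform (frobm k M) x * \<mu> ^ q ^ k)"
        by (subst sum_swap3) (simp add: qform_def frobm_def sum_distrib_right)
      finally show ?thesis .
    qed
    have "P \<in> quadric (GF q 1) T" if PB: "P \<in> BP" for P
    proof -
      obtain w s t where P: "P = proj_pt (sp w (xx s t))" and f: "frob (q ^ 1) (sp w (xx s t)) = sp w (xx s t)"
        using BP_E[OF PB] .
      \<comment> \<open>The representative is fixed by the Frobenius map, so each conjugate form
        takes a conjugate of the value of \<open>M\<close> there, which is zero.\<close>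
      have fk: "frob (q ^ k) (sp w (xx s t)) = sp w (xx s t)" for k
      proof (induction k)
        case (Suc k) then show ?case using f by (simp flip: frob_frob[of 1 k, simplified])
      qed simp
      have "qform (frobm k M) (frob (q ^ k) x) = qform M x ^ q ^ k" for k and x :: "'a ^ 9"
        by (simp add: qform_def frobm_def frob_def pow_sum power_mult_distrib)
      from this[of _ "sp w (xx s t)"] have "qform T (sp w (xx s t)) = 0"
        unfolding T fk M by (simp add: zero_power)
      moreover have "P \<in> PG (GF q 1)" using PB by (auto simp: bose_points_def pts_def)
      ultimately show ?thesis by (auto simp: quadric_def P proj_pt_iff qform_scale)
    qed
    then have "qform T y = 0" by (intro y TF) auto
    then show ?thesis by (simp add: T)
  qed
  \<comment> \<open>The coefficient of \<mu> itself belongs to the unconjugated form.\<close>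
  from linearized_zero[OF this, of 0] have "qform (frobm 0 M) y = 0" by simp
  moreover have "frobm 0 M = M" by (simp add: frobm_def vec_eq_iff)
  ultimately show ?thesis by simp
qed

lemma co_row: "k < 3 \<Longrightarrow> co y k $ i = (\<Sum>a\<in>UNIV. (\<chi> a. co (axis a 1) k $ i) $ a * y $ a)"
proof -
  assume k: "k < 3"
  have "co y k = co (\<Sum>a\<in>UNIV. y $ a *s axis a 1) k" by (simp add: basis_expansion)
  then show ?thesis using k by (simp add: co_sum co_scale mult.commute)
qed

text \<open>The determinantal equations of the scroll: the six columns
  \<open>(co y k $ i, co y k $ (i + 1))\<close> are proportional.\<close>

lemma scroll_of_quadrics:
  assumes y: "\<And>M. mat_over (GF q 1) M \<Longrightarrow> BP \<subseteq> quadric (GF q 1) M \<Longrightarrow> qform M y = 0"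
  obtains w s t where "(s, t) \<noteq> (0, 0)" "y = sp w (xx s t)"
proof -
  have minors: "co y k $ i * co y l $ (j + 1) = co y k $ (i + 1) * co y l $ j"
    if kl: "k < 3" "l < 3" and ij: "i \<in> {1, 2}" "j \<in> {1, 2}" for k l and i j :: 3
  proof -
    define r where "r k i = (\<chi> a. co (axis a (1::'a)) k $ i)" for k and i :: 3
    define M where "M = (\<chi> a b. r k i $ a * r l (j + 1) $ b) - (\<chi> a b. r k (i + 1) $ a * r l j $ b)"
    have M: "qform M x = co x k $ i * co x l $ (j + 1) - co x k $ (i + 1) * co x l $ j" for x
      unfolding M_def qform_diff_mat qform_product r_def co_row[OF kl(1), of x] co_row[OF kl(2), of x] ..
    have "qform M (sp w (xx s t)) = 0" for w s t
      using ij by (auto simp: M co_sp kl power2_eq_square mult_ac)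
    from quadrics_cut_out[OF y this] show ?thesis by (simp add: M)
  qed
  \<comment> \<open>Any column with nonzero first entry gives the common ratio. If there is none,
    every block is a multiple of (0, 0, 1), which is the parameter s = 0.\<close>
  obtain s t where st: "(s, t) \<noteq> (0, 0)" 
    and ker: "\<And>k i. k < 3 \<Longrightarrow> i \<in> {1, 2} \<Longrightarrow> t * co y k $ i = s * co y k $ (i + 1)"
  proof (cases "\<exists>k<3. \<exists>i\<in>{1, 2}. co y k $ i \<noteq> 0")
    case True
    then obtain l j where lj: "l < 3" "j \<in> {1, 2}" "co y l $ j \<noteq> 0" by blast
    show ?thesis
      by (rule that[of "co y l $ j" "co y l $ (j + 1)"])
         (use lj minors[OF _ lj(1) _ lj(2)] in \<open>auto simp: mult.commute\<close>)
  next
    case False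
    then show ?thesis by (intro that[of 0 1]) auto
  qed
  define w where "w k = (if s = 0 then co y k $ 3 / t ^ 2 else co y k $ 1 / s ^ 2)" for k
  have "co y k = w k *s xx s t" if "k < 3" for k
  proof -
    have e: "t * co y k $ 1 = s * co y k $ 2" "t * co y k $ 2 = s * co y k $ 3"
      using ker[OF that, of 1] ker[OF that, of 2] by simp_all
    show ?thesis
    proof (cases "s = 0")
      case True
      then show ?thesis using e st by (simp add: vec_eq_iff forall_3 w_def)
    next
      case False
      then have "co y k $ 2 = t * co y k $ 1 / s" "co y k $ 3 = t * co y k $ 2 / s"
        using e by (simp_all add: field_simps)
      then show ?thesis using False by (simp add: vec_eq_iff forall_3 w_def power2_eq_square field_simps)
    qed
  qed
  then have "y = sp w (xx s t)" by (intro co_eqI) (simp add: co_sp)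
  with st show ?thesis using that by blast
qed

text \<open>The Frobenius map sends the scroll point to a multiple of itself. Comparing a block with
  nonzero weight with the block \<open>l\<close> to which it is moved shows that (s, t) and its
  conjugate are proportional.\<close>

lemma scroll_point_over:
  assumes P: "proj_pt (sp w (xx s t)) \<in> PG (GF q d)" and s: "s \<noteq> 0"
  shows "t / s \<in> GF q d"
proof -
  obtain c where c: "frob (q ^ d) (sp w (xx s t)) = c *s sp w (xx s t)" using PG_frob[OF P] by blast
  obtain k where k: "k < 3" "w k \<noteq> 0" using PG_nonzero[OF P] by (auto simp: sp_eq_0_iff)
  define l where "l = (k + d) mod 3"
  have "(l + 2 * d) mod 3 = (k + 3 * d) mod 3" unfolding l_def by (simp add: mod_simps add_ac)
  then have l: "l < 3" "(l + 2 * d) mod 3 = k" using k(1) by (auto simp: l_def)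
  have "co (frob (q ^ d) (sp w (xx s t))) l = w k ^ q ^ d *s xx (s ^ q ^ d) (t ^ q ^ d)"
    using l by (simp add: frob_sp co_sp frob_xx)
  then have "w k ^ q ^ d *s xx (s ^ q ^ d) (t ^ q ^ d) = (c * w l) *s xx s t"
    unfolding c using l by (simp add: co_scale co_sp)
  then have 1: "w k ^ q ^ d * (s ^ q ^ d) ^ 2 = c * w l * s ^ 2"
    and 2: "w k ^ q ^ d * (s ^ q ^ d * t ^ q ^ d) = c * w l * (s * t)"
    by (simp_all add: vec_eq_iff forall_3)
  have "w k ^ q ^ d * (s ^ q ^ d) ^ 2 \<noteq> 0" using k s by simp
  then have "c * w l \<noteq> 0" using 1 by auto
  have "w k ^ q ^ d * (s ^ q ^ d) ^ 2 * (s * t) = w k ^ q ^ d * (s ^ q ^ d * t ^ q ^ d) * s ^ 2"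
    unfolding 1 2 by simp
  then have "s ^ q ^ d * t = t ^ q ^ d * s" using k s by (simp add: power2_eq_square)
  then have "t ^ q ^ d / s ^ q ^ d = t / s" using s by (simp add: field_simps)
  then show ?thesis by (simp add: GF_iff power_divide)
qed

lemma bose_variety_iff:
  "P \<in> bose_variety q J (std_conic (GF q 1)) (GF q d) \<longleftrightarrow>
     P \<in> PG (GF q d) \<and> (\<exists>w. (\<exists>t\<in>GF q d. P = proj_pt (sp w (xx 1 t))) \<or> P = proj_pt (sp w (xx 0 1)))"
  (is "?L \<longleftrightarrow> ?R")
proof
  assume P: "P \<in> bose_variety q J (std_conic (GF q 1)) (GF q d)"
  then have PG: "P \<in> PG (GF q d)" by (simp add: bose_variety_def)
  then obtain y where y: "P = proj_pt y" by (auto simp: PG_def)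
  have "qform M y = 0" if "mat_over (GF q 1) M" "BP \<subseteq> quadric (GF q 1) M" for M
  proof -
    have "proj_pt y \<in> quadric (GF q d) M" using P that unfolding y bose_variety_def by blast
    then show ?thesis using proj_pt_self by (auto simp: quadric_def)
  qed
  then obtain w s t where st: "(s, t) \<noteq> (0, 0)" "y = sp w (xx s t)" by (rule scroll_of_quadrics)
  show ?R
  proof (cases "s = 0")
    case True
    then have "xx s t = t ^ 2 *s xx 0 1" using xx_scale[of t 0 1] by simp
    then have "y = sp (\<lambda>k. w k * t ^ 2) (xx 0 1)" by (simp add: st sp_def)
    then show ?thesis using y PG by blast
  next
    case False
    then have "xx s t = s ^ 2 *s xx 1 (t / s)" using xx_scale[of s 1 "t / s"] by simp
    then have "y = sp (\<lambda>k. w k * s ^ 2) (xx 1 (t / s))" by (simp add: st sp_def)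
    moreover have "t / s \<in> GF q d" by (rule scroll_point_over) (use PG y st False in auto)
    ultimately show ?thesis using y PG by blast
  qed
next
  assume R: ?R
  then obtain w s t where P: "P = proj_pt (sp w (xx s t))" by blast
  show "P \<in> bose_variety q J (std_conic (GF q 1)) (GF q d)"
    unfolding bose_variety_def mem_Collect_eq
  proof (intro conjI allI impI)
    show "P \<in> PG (GF q d)" using R by blast
    fix M assume "mat_over (GF q 1) M \<and> BP \<subseteq> quadric (GF q 1) M"
    then have "qform M (sp w (xx s t)) = 0" using scroll_in_quadric by blast
    then show "P \<in> quadric (GF q d) M"
      using \<open>P \<in> PG (GF q d)\<close> by (auto simp: quadric_def P proj_pt_iff qform_scale)
  qed
qed

end

section \<open>The line at infinity and its conjugates\<close>

definition dot :: "'a::field ^ 'n \<Rightarrow> 'a ^ 'n \<Rightarrow> 'a" where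
  "dot u x = (\<Sum>i\<in>UNIV. u $ i * x $ i)"

lemma dot_add: "dot u (x + y) = dot u x + dot u y"
  and dot_scale: "dot u (c *s x) = c * dot u x"
  and dot_scale_left: "dot (c *s u) x = c * dot u x"
  by (simp_all add: dot_def algebra_simps sum.distrib sum_distrib_left)

lemma dot_diff: "dot u (x - y) = dot u x - dot u y"
  by (simp add: dot_def algebra_simps sum_subtractf)

lemma dot_0 [simp]: "dot u 0 = 0" by (simp add: dot_def)

lemma dot_sum: "dot u (sum f A) = (\<Sum>i\<in>A. dot u (f i))"
  by (induction A rule: infinite_finite_induct) (simp_all add: dot_add)

lemma dot_subspace: "vec.subspace {x. dot u x = 0}"
  by (rule vec.subspaceI) (auto simp: dot_add dot_scale)

lemma dot_axis: "dot u (axis i c) = u $ i * c"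
  by (simp add: dot_def axis_def if_distrib[of "\<lambda>z. _ * z"] cong: if_cong)

lemma independent_of_lincomb:
  fixes v :: "nat \<Rightarrow> 'a::field ^ 'n"
  assumes "\<And>c. (\<Sum>i\<le>r. c i *s v i) = 0 \<Longrightarrow> \<forall>i\<le>r. c i = 0"
  shows "inj_on v {..r}" "vec.independent (v ` {..r})"
proof -
  show inj: "inj_on v {..r}"
  proof (rule inj_onI, rule ccontr)
    fix i j assume ij: "i \<in> {..r}" "j \<in> {..r}" "v i = v j" "i \<noteq> j"
    define c where "c k = (if k = i then 1 else if k = j then - 1 else 0 :: 'a)" for k
    have "(\<Sum>k\<le>r. c k *s v k) = (\<Sum>k\<in>{i, j}. c k *s v k)"
      by (rule sum.mono_neutral_right) (use ij in \<open>auto simp: c_def\<close>)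
    also have "\<dots> = 0" using ij by (simp add: c_def)
    finally have "c i = 0" using assms[of c] ij by simp
    then show False by (simp add: c_def)
  qed
  show "vec.independent (v ` {..r})"
  proof (rule vec.independent_if_scalars_zero)
    fix f x assume f: "(\<Sum>x\<in>v ` {..r}. f x *s x) = 0" "x \<in> v ` {..r}"
    then obtain i where i: "i \<le> r" "x = v i" by auto
    have "(\<Sum>i\<le>r. f (v i) *s v i) = 0" using f(1) by (simp add: sum.reindex[OF inj])
    from assms[OF this] show "f x = 0" by (simp add: i)
  qed simp
qed

lemma periodic_3:
  assumes "\<And>k. f (k + 3) = f k"
  shows "f k = f (k mod (3::nat))"
proof (induction k rule: less_induct)
  case (less k)
  show ?case
  proof (cases "k < 3")
    case False
    then have "f k = f (k - 3)" using assms[of "k - 3"] by simp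
    then show ?thesis using less[of "k - 3"] False by (simp add: mod_if[of k])
  qed simp
qed

text \<open>The coordinates identify the subplane with PG(2,q), so an exterior line is one whose
  equation has no nonzero solution over \<open>GF q 1\<close>.\<close>

locale bose_line = bose_coords q ty J for q :: nat and ty :: "'a::{field,finite} itself" and J +
  fixes u :: "'a ^ 3"
  assumes u_over: "vec_over (GF q 3) u"
    and u_exterior: "\<And>x. vec_over (GF q 1) x \<Longrightarrow> x \<noteq> 0 \<Longrightarrow> dot u x \<noteq> 0"
begin

definition uu :: "nat \<Rightarrow> 'a ^ 3" where "uu k = frob (q ^ k) u"
text \<open>The conjugate line equations, each read on its own block; their common zeros are the
  space at infinity. \<open>ff k\<close> below is the polynomial f_k.\<close>

definition ell :: "nat \<Rightarrow> 'a ^ 9 \<Rightarrow> 'a" where "ell k y = dot (uu k) (co y k)"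
definition ff :: "nat \<Rightarrow> 'a \<Rightarrow> 'a" where "ff k t = dot (uu k) (xx 1 t)"

lemma uu_0: "uu 0 = u" by (simp add: uu_def)

lemma uu_add_3: "uu (k + 3) = uu k"
  using u_over unfolding uu_def by (metis add.commute frob_frob vec_over_iff_frob)

lemma uu_mod: "uu k = uu (k mod 3)"
  by (rule periodic_3) (rule uu_add_3)

lemma dot_frob: "dot (uu k) (frob (q ^ j) x) = dot (uu (k + 5 * j)) x ^ q ^ j"
proof -
  have "uu k = frob (q ^ j) (uu (k + 5 * j))"
    unfolding uu_def frob_frob using frob_inverse(1)[of j "uu k"]
    by (simp add: uu_def frob_frob add_ac)
  then show ?thesis by (simp add: dot_def frob_def pow_sum power_mult_distrib)
qed

lemma dot_frob': "dot (uu (k + j)) (frob (q ^ j) x) = dot (uu k) x ^ q ^ j"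
  by (simp add: dot_def uu_def frob_def pow_sum power_mult_distrib flip: pow_pow)

text \<open>A common point of the three conjugate lines would have a nonzero trace, which is a point of the
  subplane on the line.\<close>

lemma conjugate_lines_not_concurrent:
  assumes "\<And>k. k < 3 \<Longrightarrow> dot (uu k) x = 0"
  shows "x = 0"
proof -
  have all: "dot (uu k) x = 0" for k
    using assms[of "k mod 3"] by (subst uu_mod) simp
  have "x $ i = 0" for i
  proof -
    have "(\<Sum>k<6. (x $ i) ^ q ^ k * \<mu> ^ q ^ k) = 0" for \<mu>
    proof -
      define z where "z = (\<Sum>k<6. frob (q ^ k) (\<mu> *s x))"
      have "frob (q ^ 1) z = (\<Sum>k<6. frob (q ^ Suc k) (\<mu> *s x))"
        unfolding z_def frob_sum frob_frob by simp
      also have "\<dots> = z"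
        using sum.lessThan_Suc_shift[of "\<lambda>k. frob (q ^ k) (\<mu> *s x)" 6]
        unfolding sum.lessThan_Suc frob_q6 z_def by (simp del: power_Suc)
      finally have "vec_over (GF q 1) z" by (simp only: vec_over_iff_frob)
      moreover have "dot (uu 0) z = 0"
        unfolding z_def dot_sum dot_frob dot_scale all by (simp add: zero_power)
      ultimately have "z = 0" using u_exterior uu_0 by metis
      then have "z $ i = 0" by simp
      then show ?thesis by (simp add: z_def frob_def power_mult_distrib mult.commute)
    qed
    from linearized_zero[OF this, of 0] show ?thesis by simp
  qed
  then show ?thesis by (simp add: vec_eq_iff)
qed

lemma u3_nonzero: "u $ 3 \<noteq> 0"
  using u_exterior[of "axis 3 1"] by (simp add: vec_over_axis dot_axis)

lemma uu3_nonzero: "uu k $ 3 \<noteq> 0"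
  using u3_nonzero by (simp add: uu_def frob_def)

lemma ff_eq: "ff k t = uu k $ 3 * t ^ 2 + uu k $ 2 * t + uu k $ 1"
  by (simp add: ff_def dot_def sum_3 algebra_simps)

lemma ff_pow: "ff k t ^ q ^ j = ff (k + j) (t ^ q ^ j)"
  unfolding ff_def dot_frob'[symmetric] by (simp add: frob_xx)

lemma ff_mod: "ff k = ff (k mod 3)"
  using uu_mod[of k] by (simp add: ff_def fun_eq_iff)

lemma ff_no_root: "t \<in> GF q 1 \<Longrightarrow> ff k t \<noteq> 0"
proof
  assume t: "t \<in> GF q 1" and "ff k t = 0"
  have tk: "t ^ q ^ j = t" for j using GF_1_any[OF t, of j] by (simp add: GF_iff)
  have "ff 0 t ^ q ^ k = 0" unfolding ff_pow tk using \<open>ff k t = 0\<close> by simp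
  then have "dot u (xx 1 t) = 0" by (simp add: ff_def uu_0)
  moreover have "vec_over (GF q 1) (xx 1 t)"
    unfolding vec_over_iff_frob frob_xx tk by simp
  ultimately show False using u_exterior[of "xx 1 t"] by simp
qed

lemma ell_add: "k < 3 \<Longrightarrow> ell k (x + y) = ell k x + ell k y"
  and ell_scale: "k < 3 \<Longrightarrow> ell k (c *s x) = c * ell k x"
  by (simp_all add: ell_def co_add co_scale dot_add dot_scale)

lemma ell_0: "k < 3 \<Longrightarrow> ell k 0 = 0" by (simp add: ell_def co_0)

lemma ell_diff: "k < 3 \<Longrightarrow> ell k (x - y) = ell k x - ell k y"
  using ell_add[of k "x - y" y] by simp

lemma ell_subspace: "k < 3 \<Longrightarrow> vec.subspace {y. ell k y = 0}"
  by (rule vec.subspaceI) (auto simp: ell_add ell_scale ell_0)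

lemma frob_line: "frob (q ^ k) ` {x. dot (uu j) x = 0} = {x. dot (uu (j + k)) x = 0}"
proof (intro equalityI subsetI)
  fix x assume x: "x \<in> {x. dot (uu (j + k)) x = 0}"
  define y where "y = frob (q ^ (5 * k)) x"
  have xy: "x = frob (q ^ k) y" by (simp add: y_def frob_inverse)
  then have "dot (uu j) y ^ q ^ k = 0" using x by (simp flip: dot_frob')
  then show "x \<in> frob (q ^ k) ` {x. dot (uu j) x = 0}" using xy by auto
qed (auto simp: dot_frob' zero_power)

lemma infinity_iff: "y \<in> conj_span q ((*v) J ` {x. dot u x = 0}) \<longleftrightarrow> (\<forall>k<3. ell k y = 0)"
  using conj_span_iff[OF dot_subspace[of u], of y] frob_line[of _ 0]
  by (simp add: ell_def uu_0)

text \<open>The section is the space at infinity together with one further vector over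
  \<open>GF q 1\<close>. The blocks of such a vector are conjugate to each other, so the three forms
  take conjugate values d, d^q, d^(q^2) on it.\<close>

lemma section_normalize:
  assumes \<Sigma>: "proj_subspace (GF q 1) 6 \<Sigma>" "conj_span q ((*v) J ` {x. dot u x = 0}) \<subseteq> \<Sigma>"
  obtains d where "d \<in> GF q 3" "d \<noteq> 0" "\<And>y. y \<in> \<Sigma> \<longleftrightarrow> (\<exists>e. \<forall>k<3. ell k y = e * d ^ q ^ k)"
proof -
  define I where "I = {y. \<forall>k<3. ell k y = 0}"
  have I\<Sigma>: "I \<subseteq> \<Sigma>" using \<Sigma>(2) infinity_iff by (auto simp: I_def)
  have subI: "vec.subspace I"
    by (rule vec.subspaceI) (auto simp: I_def ell_add ell_scale ell_0)
  \<comment> \<open>A dual system to the three forms. Each \<open>z k\<close> adds one to the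
    dimension, and with all three the whole 9-dimensional space is reached, so the space at infinity
    has vector dimension 6.\<close>
  define z where "z k = emb (\<lambda>j. if j = k then axis 3 (inverse (uu k $ 3)) else 0)" for k
  have z: "ell j (z k) = (if j = k then 1 else 0)" if "j < 3" for j k
    using that uu3_nonzero by (simp add: ell_def z_def co_emb dot_axis)
  have "vec.span I \<subseteq> {y. ell 2 y = 0}"
    by (rule vec.span_minimal) (auto simp: I_def intro: ell_subspace)
  then have n2: "z 2 \<notin> vec.span I" using z[of 2 2] by auto
  have "vec.span (insert (z 2) I) \<subseteq> {y. ell 1 y = 0}"
    by (rule vec.span_minimal) (use z in \<open>auto simp: I_def intro: ell_subspace[of 1, simplified]\<close>)
  then have n1: "z 1 \<notin> vec.span (insert (z 2) I)" using z[of 1 1] by auto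
  have "vec.span (insert (z 1) (insert (z 2) I)) \<subseteq> {y. ell 0 y = 0}"
    by (rule vec.span_minimal) (use z in \<open>auto simp: I_def intro: ell_subspace\<close>)
  then have n0: "z 0 \<notin> vec.span (insert (z 1) (insert (z 2) I))" using z[of 0 0] by auto
  have "y \<in> vec.span (insert (z 0) (insert (z 1) (insert (z 2) I)))" for y
  proof -
    have "y - (ell 0 y *s z 0 + ell 1 y *s z 1 + ell 2 y *s z 2) \<in> I"
      by (auto simp: I_def all_less_3 ell_diff ell_add ell_scale z)
    then have "y - (ell 0 y *s z 0 + ell 1 y *s z 1 + ell 2 y *s z 2)
        + (ell 0 y *s z 0 + ell 1 y *s z 1 + ell 2 y *s z 2)
        \<in> vec.span (insert (z 0) (insert (z 1) (insert (z 2) I)))"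
      by (intro vec.span_add vec.span_scale vec.span_base) auto
    then show ?thesis by simp
  qed
  then have "vec.span (insert (z 0) (insert (z 1) (insert (z 2) I))) = UNIV" by auto
  then have "vec.dim (vec.span (insert (z 0) (insert (z 1) (insert (z 2) I)))) = 9"
    by (simp only: vec.dim_UNIV card_cart_basis) simp
  then have "vec.dim (insert (z 0) (insert (z 1) (insert (z 2) I))) = 9"
    by (simp only: vec.dim_span)
  then have dimI: "vec.dim I = 6"
    by (simp only: vec.dim_insert n0 n1 n2 if_False)
  \<comment> \<open>The section is spanned by its vectors over \<open>GF q 1\<close> and is larger
    than \<open>I\<close>, so one of them lies outside.\<close>
  have "\<not> {x \<in> \<Sigma>. vec_over (GF q 1) x} \<subseteq> I"
  proof
    assume "{x \<in> \<Sigma>. vec_over (GF q 1) x} \<subseteq> I"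
    then have "\<Sigma> \<subseteq> I"
      using \<Sigma>(1) vec.span_minimal[OF _ subI] unfolding proj_subspace_def by metis
    then show False using dimI vec.dim_subset[of \<Sigma> I] \<Sigma>(1) by (simp add: proj_subspace_def)
  qed
  then obtain y0 where y0: "y0 \<in> \<Sigma>" "vec_over (GF q 1) y0" "y0 \<notin> I" by blast
  define d where "d = ell 0 y0"
  have yk: "frob (q ^ k) y0 = y0" for k
    using vec_over_mono[of 1 k, OF one_dvd y0(2)] by (simp add: vec_over_iff_frob)
  have coy: "co y0 k = frob (q ^ k) (co y0 0)" if "k < 3" for k
  proof -
    have "(k + 2 * k) mod 3 = 0" by simp
    then show ?thesis using co_frob[OF that, of k y0] yk by simp
  qed
  have d: "ell k y0 = d ^ q ^ k" if "k < 3" for k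
    unfolding ell_def coy[OF that] d_def using dot_frob'[of 0 k "co y0 0"] by (simp add: ell_def)
  have "d \<in> GF q 3"
  proof -
    have "co y0 0 = frob (q ^ 3) (co y0 0)" using co_frob[of 0 3 y0] yk[of 3] by simp
    then have "dot (uu 3) (co y0 0) = dot (uu 0) (co y0 0) ^ q ^ 3"
      using dot_frob'[of 0 3 "co y0 0"] by simp
    then show ?thesis using uu_mod[of 3] by (simp add: GF_iff d_def ell_def)
  qed
  moreover have "d \<noteq> 0" using y0(3) d by (auto simp: I_def)
  moreover have "y \<in> \<Sigma> \<longleftrightarrow> (\<exists>e. \<forall>k<3. ell k y = e * d ^ q ^ k)" for y
  proof -
    have sub: "vec.subspace \<Sigma>" and dim: "vec.dim \<Sigma> = 7" using \<Sigma>(1) by (auto simp: proj_subspace_def)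
    have "y0 \<notin> vec.span I" using y0(3) subI vec.span_eq_iff by metis
    then have dimy: "vec.dim (insert y0 I) = 7" by (simp add: vec.dim_insert dimI)
    have "vec.span (insert y0 I) \<subseteq> \<Sigma>"
      by (rule vec.span_minimal[OF _ sub]) (use y0(1) I\<Sigma> in auto)
    then have eq: "vec.span (insert y0 I) = \<Sigma>"
      by (rule vec.subspace_dim_equal[OF vec.subspace_span sub]) (simp add: dim dimy)
    have spI: "vec.span I = I" using subI by (simp only: vec.span_eq_iff)
    have "y \<in> \<Sigma> \<longleftrightarrow> (\<exists>e. y - e *s y0 \<in> I)"
      unfolding eq[symmetric] vec.span_breakdown_eq spI ..
    then show ?thesis by (auto simp: I_def ell_diff ell_scale d)
  qed
  ultimately show ?thesis by (rule that)
qed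

end

section \<open>Curves on the section\<close>

lemma poly_eq_sum_le: "degree p \<le> n \<Longrightarrow> poly p x = (\<Sum>i\<le>n. coeff p i * x ^ i)" for x :: "'a::field"
  unfolding poly_altdef
  by (rule sum.mono_neutral_left) (auto simp: coeff_eq_0)

text \<open>Where no \<open>g k\<close> vanishes, both weight vectors are multiples of \<open>1 / g k\<close>.\<close>

lemma proportional_weights:
  fixes w c g :: "nat \<Rightarrow> 'a::field"
  assumes w: "\<And>k. k < 3 \<Longrightarrow> w k * g k = E" and c: "\<And>k. k < 3 \<Longrightarrow> c k * g k = H"
    and c0: "\<exists>k<3. c k \<noteq> 0" and uniq: "\<And>j k. j < 3 \<Longrightarrow> k < 3 \<Longrightarrow> g j = 0 \<Longrightarrow> g k = 0 \<Longrightarrow> j = k"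
  shows "\<exists>\<mu>. \<forall>k<3. w k = \<mu> * c k"
proof (cases "\<exists>j<3. g j = 0")
  case True
  \<comment> \<open>One zero \<open>g j\<close> makes both common values zero, so all entries of
    both vectors other than the j-th vanish.\<close>
  then obtain j where j: "j < 3" "g j = 0" by blast
  then have "E = 0" "H = 0" using w[of j] c[of j] by auto
  then have *: "w k = 0 \<and> c k = 0" if "k < 3" "k \<noteq> j" for k
    using w[of k] c[of k] uniq[of k j] that j by auto
  then have "c j \<noteq> 0" using c0 by blast
  then have "\<forall>k<3. w k = (w j / c j) * c k" using * by (metis mult_zero_right nonzero_mult_div_cancel_right times_divide_eq_left)
  then show ?thesis by blast
next
  case False
  then obtain j where "j < 3" "c j \<noteq> 0" "g j \<noteq> 0" using c0 by blast
  then have "H \<noteq> 0" using c[of j] by auto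
  have "w k = (E / H) * c k" if "k < 3" for k
  proof -
    have "g k \<noteq> 0" using False that by blast
    then have "w k = E / g k" "c k = H / g k" using w[OF that] c[OF that] by (auto simp: field_simps)
    then show ?thesis using \<open>H \<noteq> 0\<close> by simp
  qed
  then show ?thesis by blast
qed

text \<open>The factors d^(q^k) of \<open>section_normalize\<close> are absorbed into
  \<open>u\<close> here, so the 6-space is simply where the three forms agree.\<close>

locale bose_section = bose_line q ty J u for q :: nat and ty :: "'a::{field,finite} itself" and J and u +
  fixes \<Sigma> :: "('a ^ 9) set"
  assumes section_iff: "\<And>y. y \<in> \<Sigma> \<longleftrightarrow> (\<exists>e. \<forall>k<3. ell k y = e)"
begin

definition Fp :: "nat \<Rightarrow> 'a poly" where "Fp k = [:uu k $ 1, uu k $ 2, uu k $ 3:]"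

lemma poly_Fp: "poly (Fp k) t = ff k t"
  by (simp add: Fp_def ff_eq power2_eq_square algebra_simps)

abbreviation "line \<equiv> {x. dot u x = 0}"
abbreviation "\<Sigma>inf \<equiv> conj_span q ((*v) J ` line)"

lemma section_subspace: "vec.subspace \<Sigma>"
proof (rule vec.subspaceI)
  show "0 \<in> \<Sigma>" by (auto simp: section_iff ell_0)
  fix x y assume "x \<in> \<Sigma>" "y \<in> \<Sigma>"
  then obtain d e where "\<forall>k<3. ell k x = d" "\<forall>k<3. ell k y = e" unfolding section_iff by blast
  then show "x + y \<in> \<Sigma>" unfolding section_iff by (intro exI[of _ "d + e"]) (simp add: ell_add)
next
  fix c x assume "x \<in> \<Sigma>"
  then obtain d where "\<forall>k<3. ell k x = d" unfolding section_iff by blast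
  then show "c *s x \<in> \<Sigma>" unfolding section_iff by (intro exI[of _ "c * d"]) (simp add: ell_scale)
qed

lemma infinity_subspace: "vec.subspace \<Sigma>inf" by (simp add: conj_span_def)

lemma ell_sp: "k < 3 \<Longrightarrow> ell k (sp w x) = w k * dot (uu k) x"
  by (simp add: ell_def co_sp dot_scale)

lemma ell_sp_xx: "k < 3 \<Longrightarrow> ell k (sp w (xx 1 t)) = w k * ff k t"
  by (simp add: ell_sp ff_def)

lemma dot_xx_0_1: "dot (uu k) (xx 0 1) = uu k $ 3"
  by (simp add: dot_def sum_3)

end

text \<open>The common frame of both cases, with \<open>r\<close> equal to 6 or 3. The degree bound
  leaves room for the factor (1, t, t^2); \<open>c_frob\<close> makes the coefficient vectors
  rational over \<open>GF q 1\<close>; \<open>c_gen\<close> yields their independence and excludes a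
  common zero of the weights.\<close>

locale section_curve = bose_section q ty J u \<Sigma> 
  for q :: nat and ty :: "'a::{field,finite} itself" and J and u and \<Sigma> +
  fixes c :: "nat \<Rightarrow> 'a poly" and h :: "'a poly" and r :: nat
  assumes deg_c: "\<And>k. k < 3 \<Longrightarrow> degree (c k) + 2 \<le> r"
    and c_frob: "\<And>k i. k < 3 \<Longrightarrow> coeff (c ((k + 2) mod 3)) i ^ q = coeff (c k) i"
    and c_prod: "\<And>k. k < 3 \<Longrightarrow> c k * Fp k = h"
    and lead_h: "coeff h r \<noteq> 0"
    and c_gen: "\<And>p. degree p \<le> r \<Longrightarrow> \<exists>A. (\<forall>k<3. degree (A k) \<le> 2) \<and> p = (\<Sum>k<3. A k * c k)"
begin

text \<open>The coefficient of t^i in the vector with blocks c_k(t) (1, t, t^2);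
  \<open>pCons 0\<close> is multiplication by t.\<close>

definition vv :: "nat \<Rightarrow> 'a ^ 9" where
  "vv i = emb (\<lambda>k. vector [coeff (c k) i, coeff (pCons 0 (c k)) i, coeff (pCons 0 (pCons 0 (c k))) i])"

definition gam :: "'a \<Rightarrow> 'a ^ 9" where "gam t = sp (\<lambda>k. poly (c k) t) (xx 1 t)"

lemma r_ge_2: "r \<ge> 2" using deg_c[of 0] by simp

lemma gam_sum: "(\<Sum>i\<le>r. t ^ i *s vv i) = gam t"
proof (rule co_eqI)
  fix k :: nat assume k: "k < 3"
  have deg: "degree (c k) \<le> r" "degree (pCons 0 (c k)) \<le> r" "degree (pCons 0 (pCons 0 (c k))) \<le> r"
    using deg_c[OF k] degree_pCons_le[of 0 "c k"] degree_pCons_le[of 0 "pCons 0 (c k)"] by auto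
  have "co (\<Sum>i\<le>r. t ^ i *s vv i) k = (\<Sum>i\<le>r. t ^ i *s 
      vector [coeff (c k) i, coeff (pCons 0 (c k)) i, coeff (pCons 0 (pCons 0 (c k))) i])"
    using k by (simp add: co_sum co_scale vv_def co_emb)
  also have "\<dots> = poly (c k) t *s xx 1 t"
    using deg[THEN poly_eq_sum_le, of t]
    by (simp add: vec_eq_iff forall_3 mult.commute) (simp add: power2_eq_square mult_ac)
  finally show "co (\<Sum>i\<le>r. t ^ i *s vv i) k = co (gam t) k" using k by (simp add: gam_def co_sp)
qed

lemma vv_r: "vv r = sp (\<lambda>k. coeff (c k) (r - 2)) (xx 0 1)"
proof (rule co_eqI)
  fix k :: nat assume k: "k < 3"
  obtain m where m: "r = Suc (Suc m)" using r_ge_2 by (metis add_2_eq_Suc le_Suc_ex)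
  have "coeff (c k) r = 0" "coeff (c k) (Suc m) = 0"
    using deg_c[OF k] m by (auto intro!: coeff_eq_0)
  then show "co (vv r) k = co (sp (\<lambda>k. coeff (c k) (r - 2)) (xx 0 1)) k"
    using k by (simp add: vv_def co_emb co_sp m vec_eq_iff forall_3)
qed

lemma frob_vv: "frob (q ^ k) (vv i) = vv i"
proof (induction k)
  case (Suc k)
  have "frob (q ^ 1) (vv i) = vv i"
    unfolding vv_def frob_emb1
  proof (rule emb_cong)
    fix k :: nat assume k: "k < 3"
    show "frob (q ^ 1) (vector [coeff (c ((k + 2) mod 3)) i, coeff (pCons 0 (c ((k + 2) mod 3))) i, 
        coeff (pCons 0 (pCons 0 (c ((k + 2) mod 3)))) i] :: 'a ^ 3)
      = vector [coeff (c k) i, coeff (pCons 0 (c k)) i, coeff (pCons 0 (pCons 0 (c k))) i]"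
      using c_frob[OF k]
      by (auto simp: frob_def vec_eq_iff forall_3 coeff_pCons zero_power split: nat.splits)
  qed
  then have "frob (q ^ k) (frob (q ^ 1) (vv i)) = vv i" using Suc by simp
  then show ?case by (simp add: frob_frob[of k 1, simplified])
qed simp

lemma frob_gam: "frob (q ^ k) (gam t) = gam (t ^ q ^ k)"
  by (simp add: frob_sum frob_scale frob_vv flip: gam_sum power_mult) (simp add: mult.commute)

lemma ell_vv: assumes "k < 3" shows "ell k (vv i) = coeff h i"
proof -
  have "ell k (vv i) = coeff (c k * Fp k) i"
    using assms by (simp add: ell_def vv_def co_emb dot_def sum_3 Fp_def coeff_pCons split: nat.splits)
  then show ?thesis using c_prod[OF assms] by simp
qed

lemma ell_gam: assumes "k < 3" shows "ell k (gam t) = poly h t"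
proof -
  have "ell k (gam t) = poly (c k * Fp k) t" by (simp add: gam_def ell_sp_xx poly_Fp assms)
  then show ?thesis by (simp only: c_prod[OF assms])
qed

lemma c_no_common_root: "\<exists>k<3. poly (c k) t \<noteq> 0"
proof (rule ccontr)
  assume "\<not> (\<exists>k<3. poly (c k) t \<noteq> 0)"
  moreover obtain A where "1 = (\<Sum>k<3. A k * c k)" using c_gen[of 1] by auto
  then have "poly 1 t = poly (\<Sum>k<3. A k * c k) t" by simp
  ultimately show False by (simp add: poly_sum)
qed

lemma gam_nonzero: "gam t \<noteq> 0"
  using c_no_common_root[of t] by (auto simp: gam_def sp_eq_0_iff)

text \<open>A relation is a functional \<open>Lam\<close> on polynomials. Its vanishing on the three
  coordinates of block k says that it kills c_k, X c_k and X^2 c_k, so by \<open>c_gen\<close> it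
  kills everything of degree at most \<open>r\<close>, in particular the monomials.\<close>

lemma vv_independent:
  assumes "(\<Sum>i\<le>r. a i *s vv i) = 0"
  shows "\<forall>i\<le>r. a i = 0"
proof (intro allI impI)
  fix i assume i: "i \<le> r"
  define Lam where "Lam p = (\<Sum>i\<le>r. a i * coeff p i)" for p
  have Lam_add: "Lam (p + p') = Lam p + Lam p'" for p p'
    by (simp add: Lam_def algebra_simps sum.distrib)
  have Lam_smult: "Lam (smult b p) = b * Lam p" for b p
    by (simp add: Lam_def sum_distrib_left mult_ac)
  have base: "Lam (c k) = 0 \<and> Lam (pCons 0 (c k)) = 0 \<and> Lam (pCons 0 (pCons 0 (c k))) = 0" if k: "k < 3" for k
  proof -
    have "co (\<Sum>i\<le>r. a i *s vv i) k = vector [Lam (c k), Lam (pCons 0 (c k)), Lam (pCons 0 (pCons 0 (c k)))]"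
      using k by (simp add: co_sum co_scale vv_def co_emb vec_eq_iff forall_3 Lam_def)
    then show ?thesis using k unfolding assms by (simp add: co_0 vec_eq_iff forall_3)
  qed
  have mult: "Lam (A * c k) = 0" if k: "k < 3" and A: "degree A \<le> 2" for A k
  proof -
    have "A = [:coeff A 0, coeff A 1, coeff A 2:]"
      using A by (auto simp: poly_eq_iff coeff_pCons coeff_eq_0 numeral_2_eq_2 split: nat.split)
    then have Ac: "A * c k = smult (coeff A 0) (c k) + smult (coeff A 1) (pCons 0 (c k)) 
        + smult (coeff A 2) (pCons 0 (pCons 0 (c k)))"
      by (metis (no_types, lifting) mult_pCons_left mult_zero_left add_0_right smult_pCons pCons_0_0 smult_add_right smult_0_right add.assoc add_pCons mult_zero_right)
    show ?thesis unfolding Ac Lam_add Lam_smult using base[OF k] by simp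
  qed
  obtain A where A: "\<forall>k<3. degree (A k) \<le> 2" "monom 1 i = (\<Sum>k<3. A k * c k)"
    using c_gen[of "monom 1 i"] i degree_monom_le[of "1::'a" i] by (metis order_trans)
  have "Lam (monom 1 i) = 0"
    unfolding A(2) sum_less_3 using mult A(1) by (simp add: Lam_add)
  moreover have "Lam (monom 1 i) = a i"
    using i by (simp add: Lam_def if_distrib[of "\<lambda>z. _ * z"] cong: if_cong)
  ultimately show "a i = 0" by simp
qed

lemma curve_basis: "nrc_basis (GF q 1) \<Sigma> r vv"
  unfolding nrc_basis_def
proof (intro conjI allI impI)
  show "vv i \<in> \<Sigma>" for i unfolding section_iff by (auto simp: ell_vv)
  show "vec_over (GF q 1) (vv i)" for i by (simp only: vec_over_iff_frob frob_vv)
qed (rule independent_of_lincomb, erule vv_independent)+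

lemma vv_r_nonzero: "vv r \<noteq> 0"
proof
  assume "vv r = 0"
  then have "(\<Sum>i\<le>r. (if i = r then 1 else 0) *s vv i) = 0"
    by (intro sum.neutral) auto
  from vv_independent[OF this] show False by (auto dest: spec[of _ r])
qed

lemma curve_points_over:
  "t \<in> GF q d \<Longrightarrow> proj_pt (gam t) \<in> PG (GF q d)" "proj_pt (vv r) \<in> PG (GF q d)"
  by (rule PG_I[OF gam_nonzero], simp add: vec_over_iff_frob frob_gam GF_iff)
     (rule PG_I[OF vv_r_nonzero], simp add: vec_over_iff_frob frob_vv)

lemma nrc_eq: "nrc (GF q d) r vv = {proj_pt (gam t) | t. t \<in> GF q d} \<union> {proj_pt (vv r)}"
  by (simp add: nrc_def gam_sum)

text \<open>On the section and on the curve alike, weight times f_k(t) does not depend on k, so the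
  weights are proportional by \<open>proportional_weights\<close>. At the parameter infinity the
  leading coefficients, all nonzero, take the place of the f_k(t).\<close>

theorem section_variety_eq:
  assumes uniq: "\<And>t j k. t \<in> GF q d \<Longrightarrow> j < 3 \<Longrightarrow> k < 3 \<Longrightarrow> ff j t = 0 \<Longrightarrow> ff k t = 0 \<Longrightarrow> j = k"
  shows "bb_variety q J \<Sigma> (std_conic (GF q 1)) (GF q d) = nrc (GF q d) r vv"
proof (intro equalityI subsetI)
  fix P assume "P \<in> nrc (GF q d) r vv"
  then consider t where "t \<in> GF q d" "P = proj_pt (gam t)" | "P = proj_pt (vv r)" unfolding nrc_eq by blast
  then show "P \<in> bb_variety q J \<Sigma> (std_conic (GF q 1)) (GF q d)"
  proof cases
    case 1
    have "gam t \<in> \<Sigma>" unfolding section_iff by (auto simp: ell_gam)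
    then have "P \<in> pts (GF q d) \<Sigma>"
      using curve_points_over(1)[OF 1(1)] by (simp add: 1(2) pts_proj_pt section_subspace)
    moreover have "P \<in> bose_variety q J (std_conic (GF q 1)) (GF q d)"
      unfolding bose_variety_iff using curve_points_over(1)[OF 1(1)] 1 gam_def by metis
    ultimately show ?thesis by (simp add: bb_variety_def)
  next
    case 2
    have "vv r \<in> \<Sigma>" unfolding section_iff by (auto simp: ell_vv)
    then have "P \<in> pts (GF q d) \<Sigma>"
      using curve_points_over(2) by (simp add: 2 pts_proj_pt section_subspace)
    moreover have "P \<in> bose_variety q J (std_conic (GF q 1)) (GF q d)"
      unfolding bose_variety_iff using curve_points_over(2) 2 vv_r by metis
    ultimately show ?thesis by (simp add: bb_variety_def)
  qed
next
  fix P assume "P \<in> bb_variety q J \<Sigma> (std_conic (GF q 1)) (GF q d)"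
  then have P: "P \<in> PG (GF q d)" "P \<subseteq> \<Sigma>"
    and "\<exists>w. (\<exists>t\<in>GF q d. P = proj_pt (sp w (xx 1 t))) \<or> P = proj_pt (sp w (xx 0 1))"
    unfolding bb_variety_def pts_def Int_iff bose_variety_iff by blast+
  then consider w t where "t \<in> GF q d" "P = proj_pt (sp w (xx 1 t))" | w where "P = proj_pt (sp w (xx 0 1))" by blast
  then show "P \<in> nrc (GF q d) r vv"
  proof cases
    case 1
    have "sp w (xx 1 t) \<in> \<Sigma>" using P(2) 1(2) proj_pt_self by blast
    then obtain E where E: "\<And>k. k < 3 \<Longrightarrow> w k * ff k t = E"
      unfolding section_iff using ell_sp_xx by metis
    have H: "poly (c k) t * ff k t = poly h t" if "k < 3" for k
      using ell_gam[OF that, of t] that by (simp add: gam_def ell_sp_xx)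
    obtain \<mu> where \<mu>: "\<forall>k<3. w k = \<mu> * poly (c k) t"
      using proportional_weights[OF E H c_no_common_root uniq[OF 1(1)]] by blast
    then have "sp w (xx 1 t) = sp (\<lambda>k. \<mu> * poly (c k) t) (xx 1 t)"
      unfolding sp_def by (intro emb_cong) simp
    then have "sp w (xx 1 t) = \<mu> *s gam t" by (simp only: sp_scale gam_def)
    moreover have "sp w (xx 1 t) \<noteq> 0" using P(1) 1(2) PG_nonzero by blast
    ultimately have "P = proj_pt (gam t)" using 1(2) by (auto simp: proj_pt_scale)
    then show ?thesis using 1(1) by (auto simp: nrc_eq)
  next
    case 2
    have "sp w (xx 0 1) \<in> \<Sigma>" using P(2) 2 proj_pt_self by blast
    then obtain E where E: "\<And>k. k < 3 \<Longrightarrow> w k * uu k $ 3 = E"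
      unfolding section_iff using ell_sp dot_xx_0_1 by metis
    have H: "coeff (c k) (r - 2) * uu k $ 3 = coeff h r" if "k < 3" for k
      using ell_vv[OF that, of r] by (simp add: vv_r ell_sp that dot_xx_0_1)
    have nz: "\<exists>k<3. coeff (c k) (r - 2) \<noteq> 0" using H[of 0] lead_h by (intro exI[of _ 0]) auto
    obtain \<mu> where \<mu>: "\<forall>k<3. w k = \<mu> * coeff (c k) (r - 2)"
      using proportional_weights[OF E H nz] uu3_nonzero by blast
    then have "sp w (xx 0 1) = sp (\<lambda>k. \<mu> * coeff (c k) (r - 2)) (xx 0 1)"
      unfolding sp_def by (intro emb_cong) simp
    then have "sp w (xx 0 1) = \<mu> *s vv r" by (simp only: sp_scale vv_r)
    moreover have "sp w (xx 0 1) \<noteq> 0" using P(1) 2 PG_nonzero by blast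
    ultimately have "P = proj_pt (vv r)" using 2 by (auto simp: proj_pt_scale)
    then show ?thesis by (auto simp: nrc_eq)
  qed
qed

text \<open>All three forms take the value h(t) on the curve, and at the parameter infinity its
  leading coefficient, which is nonzero.\<close>

theorem curve_at_infinity:
  "nrc (GF q d) r vv \<inter> pts (GF q d) \<Sigma>inf = {proj_pt (gam t) | t. t \<in> GF q d \<and> poly h t = 0}"
proof -
  have "proj_pt (gam t) \<in> pts (GF q d) \<Sigma>inf \<longleftrightarrow> poly h t = 0" if "t \<in> GF q d" for t
    using curve_points_over(1)[OF that] ell_gam[of _ t]
    unfolding pts_proj_pt[OF infinity_subspace] infinity_iff by (metis zero_less_numeral)
  moreover have "proj_pt (vv r) \<notin> pts (GF q d) \<Sigma>inf"
    using lead_h ell_vv[of _ r]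
    unfolding pts_proj_pt[OF infinity_subspace] infinity_iff by (metis zero_less_numeral)
  ultimately show ?thesis unfolding nrc_eq by blast
qed

end

section \<open>The two cases\<close>

lemma ex_less_3: "(\<exists>k<3::nat. P k) \<longleftrightarrow> P 0 \<or> P 1 \<or> P 2"
  using all_less_3[of "\<lambda>k. \<not> P k"] by blast

lemma UN_less_3: "(\<Union>k\<in>{..<3::nat}. P k) = P 0 \<union> P 1 \<union> P 2"
  using ex_less_3[of "\<lambda>k. _ \<in> P k"] by auto

lemma mod_3_shift:
  fixes j k m :: nat
  assumes "j < 3" "k < 3"
  shows "(j + 2 * m) mod 3 = k \<longleftrightarrow> j = (k + m) mod 3"
proof
  assume "(j + 2 * m) mod 3 = k"
  then have "(k + m) mod 3 = ((j + 2 * m) mod 3 + m) mod 3" by simp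
  also have "\<dots> = (j + 3 * m) mod 3" by (simp only: mod_add_left_eq) (simp add: algebra_simps)
  finally show "j = (k + m) mod 3" using assms(1) by simp
next
  assume "j = (k + m) mod 3"
  then have "(j + 2 * m) mod 3 = ((k + m) mod 3 + 2 * m) mod 3" by simp
  also have "\<dots> = (k + 3 * m) mod 3" by (simp only: mod_add_left_eq) (simp add: algebra_simps)
  finally show "(j + 2 * m) mod 3 = k" using assms(2) by simp
qed

lemma less_3_cases: "k < 3 \<Longrightarrow> k = 0 \<or> k = 1 \<or> k = (2::nat)"
  by linarith

lemma mod_3_other:
  assumes "k < (3::nat)"
  shows "(k + 1) mod 3 \<noteq> k" "(k + 2) mod 3 \<noteq> k" "(k + 2) mod 3 \<noteq> (k + 1) mod 3"
    "j < 3 \<Longrightarrow> j = k \<or> j = (k + 1) mod 3 \<or> j = (k + 2) mod 3"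
    "j < 3 \<Longrightarrow> j \<noteq> k \<Longrightarrow> (j + 1) mod 3 = k \<or> (j + 2) mod 3 = k"
    "Suc ((k + 2) mod 3) mod 3 = k"
  using less_3_cases[OF assms] less_3_cases[of j] by (auto simp del: add_2_eq_Suc')

text \<open>Bezout for the modulus \<open>(X - a) (X - b)\<close>, by dividing twice by a linear factor; this also
  covers \<open>a = b\<close>.\<close>

lemma division_by_linear_factors:
  fixes G p :: "'a::field poly"
  assumes \<kappa>: "\<kappa> \<noteq> 0" and G: "poly G a \<noteq> 0" "poly G b \<noteq> 0" and n: "degree p \<le> n" "degree G + 1 \<le> n" "n \<ge> 2"
  obtains A D where "p = A * G + smult \<kappa> ([:- a, 1:] * [:- b, 1:]) * D" "degree A \<le> 1" "degree D \<le> n - 2"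
proof -
  define c0 where "c0 = poly p a / poly G a"
  have "poly (p - [:c0:] * G) a = 0" using G by (simp add: c0_def)
  then obtain p1 where p1: "p - [:c0:] * G = [:- a, 1:] * p1" using poly_eq_0_iff_dvd by blast
  define c1 where "c1 = poly p1 b / poly G b"
  have "poly (p1 - [:c1:] * G) b = 0" using G by (simp add: c1_def)
  then obtain E where E: "p1 - [:c1:] * G = [:- b, 1:] * E" using poly_eq_0_iff_dvd by blast
  define A where "A = [:c0:] + [:- a, 1:] * [:c1:]"
  define D where "D = smult (inverse \<kappa>) E"
  have "p = [:c0:] * G + [:- a, 1:] * p1" using p1 by (simp add: algebra_simps)
  also have "p1 = [:c1:] * G + [:- b, 1:] * E" using E by (simp add: algebra_simps)
  finally have p: "p = A * G + ([:- a, 1:] * [:- b, 1:]) * E"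
    unfolding A_def by (simp only: algebra_simps)
  have degA: "degree A \<le> 1"
    unfolding A_def by (intro degree_add_le degree_mult_le[THEN order_trans]) auto
  have "degree E \<le> n - 2"
  proof (cases "E = 0")
    case False
    have "degree (([:- a, 1:] * [:- b, 1:]) * E) = 2 + degree E"
      using False by (subst degree_mult_eq) (simp_all add: degree_mult_eq)
    moreover have "([:- a, 1:] * [:- b, 1:]) * E = p - A * G" using p by (simp add: algebra_simps)
    moreover have "degree (A * G) \<le> n" using degree_mult_le[of A G] degA n by linarith
    then have "degree (p - A * G) \<le> n" using n(1) by (rule degree_diff_le[rotated])
    ultimately show ?thesis by simp
  qed simp
  then have "degree D \<le> n - 2" unfolding D_def using degree_smult_le order_trans by blast
  moreover have "smult \<kappa> ([:- a, 1:] * [:- b, 1:]) * D = ([:- a, 1:] * [:- b, 1:]) * E"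
    using \<kappa> by (simp only: D_def mult_smult_left mult_smult_right smult_smult) simp
  then have "p = A * G + smult \<kappa> ([:- a, 1:] * [:- b, 1:]) * D"
    using p by (simp only:)
  ultimately show ?thesis using that degA by blast
qed

lemma quadratic_poly_eqI:
  fixes a b c x y :: "'a::{field,finite}"
  assumes "\<And>t. poly [:c, b, a:] t = a * (t - x) * (t - y)"
  shows "[:c, b, a:] = smult a ([:- x, 1:] * [:- y, 1:])"
proof -
  have "c = a * x * y" using assms[of 0] by simp
  moreover have "c + b + a = a * (1 - x) * (1 - y)" using assms[of 1] by (simp add: algebra_simps)
  then have "b = - a * (x + y)" using \<open>c = a * x * y\<close> by algebra
  ultimately show ?thesis by (simp add: algebra_simps)
qed

context bose_section begin

lemma Fp_mod: "Fp k = Fp (k mod 3)" unfolding Fp_def uu_mod[of k] ..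

lemma uu_nth_pow: "(uu k $ i) ^ q = uu (Suc k) $ i"
  by (simp add: uu_def frob_def pow_q_pow)

lemma ff_0_mod: "ff 3 = ff 0" "ff 4 = ff 1" "ff (Suc 3) = ff 1" "ff 5 = ff 2"
  using ff_mod[of 3] ff_mod[of 4] ff_mod[of 5] by simp_all

lemma Fp_roots:
  assumes "\<And>t. ff 0 t = u $ 3 * (t - \<alpha>) * (t - \<beta>)"
  shows "Fp k = smult (uu k $ 3) ([:- (\<alpha> ^ q ^ k), 1:] * [:- (\<beta> ^ q ^ k), 1:])"
  unfolding Fp_def
proof (rule quadratic_poly_eqI)
  fix t :: 'a
  obtain s where s: "t = s ^ q ^ k" using pow_surj[of k t] by auto
  have "poly [:uu k $ 1, uu k $ 2, uu k $ 3:] t = ff 0 s ^ q ^ k"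
    using poly_Fp[of k t] ff_pow[of 0 s k] by (simp add: Fp_def s)
  also have "\<dots> = uu k $ 3 * (t - \<alpha> ^ q ^ k) * (t - \<beta> ^ q ^ k)"
    by (simp add: assms power_mult_distrib pow_diff s uu_def frob_def)
  finally show "poly [:uu k $ 1, uu k $ 2, uu k $ 3:] t = uu k $ 3 * (t - \<alpha> ^ q ^ k) * (t - \<beta> ^ q ^ k)" .
qed

lemma ff_roots:
  assumes "\<And>t. ff 0 t = u $ 3 * (t - \<alpha>) * (t - \<beta>)"
  shows "ff k t = uu k $ 3 * (t - \<alpha> ^ q ^ k) * (t - \<beta> ^ q ^ k)"
  unfolding poly_Fp[symmetric] Fp_roots[OF assms, of k] by (simp add: algebra_simps)

text \<open>Such an \<open>e\<close> is the parameter of the carrier \<open>E\<close>, and \<open>e ^ q\<close> that of its conjugate.\<close>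

definition "carrier_root e \<longleftrightarrow> ff 0 e = 0 \<and> ff 2 e = 0"

text \<open>The Frobenius map shifts the indices of the f_k cyclically, and every pair of distinct
  indices modulo 3 is a shift of {0, 2}.\<close>

lemma common_root_carrier:
  assumes "i < 3" "j < 3" "ff i t = 0" "ff j t = 0" "i \<noteq> j"
  shows "\<exists>e. carrier_root e"
proof -
  have shift: "ff (i + m) (t ^ q ^ m) = 0" "ff (j + m) (t ^ q ^ m) = 0" for m
    using assms(3,4) by (simp_all add: zero_power flip: ff_pow)
  have "i = 0 \<or> i = 1 \<or> i = 2" "j = 0 \<or> j = 1 \<or> j = 2" using assms(1,2) by linarith+
  then consider "{i, j} = {0, 1}" | "{i, j} = {0, 2}" | "{i, j} = {1, 2}"
    using assms(5) by (elim disjE) auto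
  then show ?thesis
  proof cases
    case 1
    then show ?thesis using shift[of 2] ff_0_mod unfolding carrier_root_def doubleton_eq_iff
      by (intro exI[of _ "t ^ q ^ 2"]) (auto simp: numeral_2_eq_2 numeral_3_eq_3)
  next
    case 2
    then show ?thesis using assms(3,4) unfolding carrier_root_def doubleton_eq_iff by blast
  next
    case 3
    then show ?thesis using shift[of 1] ff_0_mod unfolding carrier_root_def doubleton_eq_iff
      by (intro exI[of _ "t ^ q ^ 1"]) (auto simp: numeral_2_eq_2 numeral_3_eq_3)
  qed
qed

lemma not_all_ff_zero: "\<exists>k<3. ff k t \<noteq> 0"
proof (rule ccontr)
  assume "\<not> (\<exists>k<3. ff k t \<noteq> 0)"
  then have "xx 1 t = 0" by (intro conjugate_lines_not_concurrent) (auto simp: ff_def)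
  then show False by simp
qed

text \<open>Conjugating f_2(e) = 0 gives f_0(e^q) = 0, so e and e^q are the two roots of f_0,
  distinct because f_0 has none in \<open>GF q 1\<close>. As e^(q^3) is also a root, it is e or e^q;
  the latter gives e^(q^2) = e and then a common zero of all three f_k.\<close>

lemma carrier_root_props:
  assumes "carrier_root e"
  shows "e \<in> GF q 3" "e \<notin> GF q 1" "\<And>t. ff 0 t = u $ 3 * (t - e) * (t - e ^ q)"
proof -
  have e: "ff 0 e = 0" "ff 2 e = 0" using assms by (auto simp: carrier_root_def)
  have "ff 2 e ^ q ^ 1 = ff 3 (e ^ q)" unfolding ff_pow by simp
  then have eq: "ff 0 (e ^ q) = 0" using e ff_0_mod by (simp add: zero_power)
  show n: "e \<notin> GF q 1" using ff_no_root[of e 0] e by blast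
  then have ne: "e \<noteq> e ^ q" by (auto simp: GF_iff)
  show f: "ff 0 t = u $ 3 * (t - e) * (t - e ^ q)" for t
    using quadratic_two_roots[of "uu 0 $ 3" e "uu 0 $ 2" "uu 0 $ 1" "e ^ q" t] e(1) eq ne
    by (simp add: ff_eq uu_0)
  have "ff 0 e ^ q ^ 3 = ff 3 (e ^ q ^ 3)" unfolding ff_pow by simp
  then have "ff 0 (e ^ q ^ 3) = 0" using e ff_0_mod by (simp add: zero_power)
  then consider "e ^ q ^ 3 = e" | "e ^ q ^ 3 = e ^ q" using f u3_nonzero by auto
  then show "e \<in> GF q 3"
  proof cases
    case 2
    have "(e ^ q ^ 2) ^ q = e ^ q ^ 3" by (simp add: pow_q_pow)
    then have "e ^ q ^ 2 = e" using 2 by (simp add: pow_inj1)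
    moreover have "ff 0 (e ^ q) ^ q ^ 1 = ff 1 (e ^ q ^ 2)" 
      unfolding ff_pow by (simp add: power2_eq_square power_mult)
    ultimately have "ff 1 e = 0" using eq by (simp add: zero_power)
    then have "\<forall>k<3. ff k e = 0" using e by (simp add: all_less_3)
    then show ?thesis using not_all_ff_zero[of e] by blast
  qed (simp add: GF_iff)
qed

lemma frob_J_mult: "k < 3 \<Longrightarrow> frob (q ^ k) (J *v x) = sp (\<lambda>j. if j = k then 1 else 0) (frob (q ^ k) x)"
  unfolding J_mult frob_emb sp_def
proof (rule emb_cong)
  fix j :: nat assume "j < 3" "k < 3"
  then have "(j + 2 * k) mod 3 = 0 \<longleftrightarrow> j = k" using mod_3_shift[of j 0 k] by simp
  then show "frob (q ^ k) (if (j + 2 * k) mod 3 = 0 then x else 0) = (if j = k then 1 else 0) *s frob (q ^ k) x"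
    by simp
qed

abbreviation "Ph x \<equiv> (*v) J ` proj_pt x"

lemma sp_single_proj_pt:
  assumes "k < 3" "\<And>j. j < 3 \<Longrightarrow> j \<noteq> k \<Longrightarrow> w j = 0" "w k \<noteq> 0"
  shows "proj_pt (sp w (frob (q ^ k) x)) = frob (q ^ k) ` Ph x"
proof -
  have "sp w (frob (q ^ k) x) = sp (\<lambda>j. w k * (if j = k then 1 else 0)) (frob (q ^ k) x)"
    unfolding sp_def by (rule emb_cong) (use assms in auto)
  also have "\<dots> = w k *s frob (q ^ k) (J *v x)" unfolding sp_scale frob_J_mult[OF assms(1)] ..
  finally show ?thesis using assms(3) by (simp add: proj_pt_image frob_proj_pt proj_pt_scale)
qed

text \<open>Stated for every \<open>d\<close>, since the roots of f_0 lie in \<open>GF q 3\<close>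
  or are conjugate over it; the points at infinity are listed over each field that contains both
  roots.\<close>

theorem section_sextic:
  assumes no: "\<nexists>e. carrier_root e"
  obtains \<alpha> \<beta> v where "\<forall>t. ff 0 t = u $ 3 * (t - \<alpha>) * (t - \<beta>)"
    "\<alpha> \<in> GF q 3 \<and> \<beta> \<in> GF q 3 \<or> \<alpha> \<notin> GF q 3 \<and> \<beta> = \<alpha> ^ q ^ 3"
    "nrc_basis (GF q 1) \<Sigma> 6 v"
    "\<forall>d. bb_variety q J \<Sigma> (std_conic (GF q 1)) (GF q d) = nrc (GF q d) 6 v"
    "\<forall>d. \<alpha> \<in> GF q d \<longrightarrow> \<beta> \<in> GF q d \<longrightarrow> nrc (GF q d) 6 v \<inter> pts (GF q d) \<Sigma>inf = 
      {Ph (xx 1 \<alpha>), frob q ` Ph (xx 1 \<alpha>), frob (q^2) ` Ph (xx 1 \<alpha>), 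
       Ph (xx 1 \<beta>), frob q ` Ph (xx 1 \<beta>), frob (q^2) ` Ph (xx 1 \<beta>)}"
proof -
  have uF: "u $ i \<in> GF q 3" for i using u_over by (simp add: vec_over_def)
  obtain \<alpha> \<beta> where f': "\<And>t. u $ 3 * t ^ 2 + u $ 2 * t + u $ 1 = u $ 3 * (t - \<alpha>) * (t - \<beta>)"
    and mem: "\<alpha> \<in> GF q 3 \<and> \<beta> \<in> GF q 3 \<or> \<alpha> \<notin> GF q 3 \<and> \<beta> = \<alpha> ^ q ^ 3"
    by (rule quadratic_splits[OF uF[of 3] uF[of 2] uF[of 1] u3_nonzero]) (rule that; blast)
  have f: "ff 0 t = u $ 3 * (t - \<alpha>) * (t - \<beta>)" for t using f'[of t] by (simp add: ff_eq uu_0)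
  note fk = ff_roots[OF f]
  have uniq: "j = k" if "j < 3" "k < 3" "ff j t = 0" "ff k t = 0" for j k t
    using common_root_carrier[OF that] no by blast
  define c where "c k = Fp ((k + 1) mod 3) * Fp ((k + 2) mod 3)" for k
  define h where "h = Fp 0 * Fp 1 * Fp 2"
  have degF: "degree (Fp k) = 2" for k using uu3_nonzero[of k] by (simp add: Fp_def)
  have Fp0: "Fp k \<noteq> 0" for k using degF[of k] by auto
  interpret section_curve q ty J u \<Sigma> c h 6
  proof
    show "degree (c k) + 2 \<le> 6" for k by (simp add: c_def degree_mult_eq Fp0 degF)
    show "c k * Fp k = h" if "k < 3" for k
    proof -
      have "k = 0 \<or> k = 1 \<or> k = 2" using that by linarith
      then show ?thesis by (elim disjE) (simp_all add: c_def h_def mult_ac numeral_2_eq_2)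
    qed
    have "degree h = 6" by (simp add: h_def degree_mult_eq Fp0 degF)
    then show "coeff h 6 \<noteq> 0" using Fp0 by (metis h_def leading_coeff_0_iff mult_eq_0_iff)
    have Fp_frob: "coeff (Fp j) i ^ q = coeff (Fp (Suc j)) i" for i j
      by (simp add: Fp_def coeff_pCons uu_nth_pow zero_power split: nat.split)
    show "coeff (c ((k + 2) mod 3)) i ^ q = coeff (c k) i" if "k < 3" for k i
    proof -
      have "coeff (c ((k + 2) mod 3)) i ^ q 
          = (\<Sum>j\<le>i. coeff (Fp (Suc (((k + 2) mod 3 + 1) mod 3))) j * coeff (Fp (Suc (((k + 2) mod 3 + 2) mod 3))) (i - j))"
        unfolding c_def coeff_mult by (simp only: pow_sum1 power_mult_distrib Fp_frob)
      also have "Fp (Suc (((k + 2) mod 3 + 1) mod 3)) = Fp ((k + 1) mod 3)"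
        by (subst Fp_mod) (simp add: mod_simps)
      also have "Suc (((k + 2) mod 3 + 2) mod 3) mod 3 = (k + 2) mod 3"
        using mod_3_other(6)[of "(k + 2) mod 3"] by simp
      then have "Fp (Suc (((k + 2) mod 3 + 2) mod 3)) = Fp ((k + 2) mod 3)"
        by (subst Fp_mod) (simp only:)
      finally show ?thesis by (simp add: c_def coeff_mult)
    qed
    fix p :: "'a poly" assume p: "degree p \<le> 6"
    have nz: "poly (Fp j) (\<alpha> ^ q ^ k) \<noteq> 0" "poly (Fp j) (\<beta> ^ q ^ k) \<noteq> 0" if "j < 3" "k < 3" "j \<noteq> k" for j k
      using uniq[OF that(1,2)] that(3) fk[of k] by (auto simp: poly_Fp)
    obtain A D where A: "p = A * (Fp 1 * Fp 2) + Fp 0 * D" "degree A \<le> 1" "degree D \<le> 6 - 2"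
      unfolding Fp_roots[OF f, of 0]
      by (rule division_by_linear_factors[OF uu3_nonzero _ _ p, of "Fp 1 * Fp 2" "\<alpha> ^ q ^ 0" "\<beta> ^ q ^ 0" 0])
         (use nz[of 1 0] nz[of 2 0] in \<open>simp_all add: degree_mult_eq Fp0 degF\<close>)
    obtain A' D' where A': "D = A' * Fp 2 + Fp 1 * D'" "degree A' \<le> 1" "degree D' \<le> 4 - 2"
      unfolding Fp_roots[OF f, of 1]
      by (rule division_by_linear_factors[OF uu3_nonzero, of "Fp 2" "\<alpha> ^ q ^ 1" "\<beta> ^ q ^ 1" D 4 1])
         (use nz[of 2 1] A(3) in \<open>simp_all add: degF\<close>)
    have "p = A * c 0 + A' * c 1 + D' * c 2"
      unfolding A(1) A'(1) c_def by (simp add: algebra_simps numeral_2_eq_2)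
    then show "\<exists>A. (\<forall>k<3. degree (A k) \<le> 2) \<and> p = (\<Sum>k<3. A k * c k)"
      using A(2) A'(2,3)
      by (intro exI[of _ "\<lambda>k. if k = 0 then A else if k = 1 then A' else D'"]) (simp add: sum_less_3 all_less_3)
  qed
  \<comment> \<open>For j different from k the weight c_j contains the factor f_k; at a root of f_k
    only block k survives, and the point lies in the k-th conjugate of \<Gamma>.\<close>
  have at_root: "proj_pt (gam (a ^ q ^ k)) = frob (q ^ k) ` Ph (xx 1 a)" if "k < 3" "ff k (a ^ q ^ k) = 0" for a k
  proof -
    have other: "ff j (a ^ q ^ k) \<noteq> 0" if "j < 3" "j \<noteq> k" for j
      using uniq[of j k] \<open>k < 3\<close> \<open>ff k _ = 0\<close> that by blast
    have w: "poly (c j) (a ^ q ^ k) = ff ((j + 1) mod 3) (a ^ q ^ k) * ff ((j + 2) mod 3) (a ^ q ^ k)" for j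
      by (simp add: c_def poly_Fp)
    have x: "xx 1 (a ^ q ^ k) = frob (q ^ k) (xx 1 a)" by (simp add: frob_xx)
    show ?thesis
      unfolding gam_def x
    proof (rule sp_single_proj_pt[OF \<open>k < 3\<close>])
      show "poly (c j) (a ^ q ^ k) = 0" if "j < 3" "j \<noteq> k" for j
      proof -
        have "(j + 1) mod 3 = k \<or> (j + 2) mod 3 = k"
          using mod_3_other(5)[OF \<open>k < 3\<close> that] .
        then show ?thesis unfolding w using \<open>ff k _ = 0\<close> by auto
      qed
      have "(k + 1) mod 3 \<noteq> k" "(k + 2) mod 3 \<noteq> k"
        using mod_3_other(1,2)[OF \<open>k < 3\<close>] .
      then show "poly (c k) (a ^ q ^ k) \<noteq> 0" unfolding w using other by simp
    qed
  qed
  have inf: "nrc (GF q d) 6 vv \<inter> pts (GF q d) \<Sigma>inf = 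
      {Ph (xx 1 \<alpha>), frob q ` Ph (xx 1 \<alpha>), frob (q^2) ` Ph (xx 1 \<alpha>), 
       Ph (xx 1 \<beta>), frob q ` Ph (xx 1 \<beta>), frob (q^2) ` Ph (xx 1 \<beta>)}"
    if d: "\<alpha> \<in> GF q d" "\<beta> \<in> GF q d" for d
  proof -
    have "poly h t = 0 \<longleftrightarrow> (\<exists>k<3. t = \<alpha> ^ q ^ k \<or> t = \<beta> ^ q ^ k)" for t
    proof -
      have "poly h t = 0 \<longleftrightarrow> (\<exists>k<3. ff k t = 0)"
        unfolding ex_less_3 by (simp add: h_def poly_Fp)
      also have "\<dots> \<longleftrightarrow> (\<exists>k<3. t = \<alpha> ^ q ^ k \<or> t = \<beta> ^ q ^ k)"
        unfolding fk using uu3_nonzero by auto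
      finally show ?thesis .
    qed
    then have "{proj_pt (gam t) | t. t \<in> GF q d \<and> poly h t = 0} 
        = (\<Union>k\<in>{..<3}. {proj_pt (gam (\<alpha> ^ q ^ k)), proj_pt (gam (\<beta> ^ q ^ k))})"
      using d GF_power by auto
    also have "\<dots> = (\<Union>k\<in>{..<3}. {frob (q ^ k) ` Ph (xx 1 \<alpha>), frob (q ^ k) ` Ph (xx 1 \<beta>)})"
      using at_root fk by simp
    also have "\<dots> = {Ph (xx 1 \<alpha>), frob q ` Ph (xx 1 \<alpha>), frob (q^2) ` Ph (xx 1 \<alpha>), 
       Ph (xx 1 \<beta>), frob q ` Ph (xx 1 \<beta>), frob (q^2) ` Ph (xx 1 \<beta>)}"
      unfolding UN_less_3 by (auto simp: frob_power_0[unfolded power_0] image_comp)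
    finally show ?thesis unfolding curve_at_infinity .
  qed
  have var: "bb_variety q J \<Sigma> (std_conic (GF q 1)) (GF q d) = nrc (GF q d) 6 vv" for d
    by (rule section_variety_eq) (use uniq in blast)
  show ?thesis
  proof (rule that[OF _ mem curve_basis])
  qed (intro allI impI, rule f var inf; assumption)+
qed

end

section \<open>The cubic and its T-lines\<close>

lemma span_Un_proj_pt: "vec.span (proj_pt a \<union> proj_pt b) = vec.span {a, b :: 'a::field ^ 'n}"
proof (rule antisym)
  show "vec.span (proj_pt a \<union> proj_pt b) \<subseteq> vec.span {a, b}"
    unfolding proj_pt_def by (intro vec.span_minimal Un_least vec.span_mono) auto
  show "vec.span {a, b} \<subseteq> vec.span (proj_pt a \<union> proj_pt b)"
    by (rule vec.span_mono) (auto simp: proj_pt_self)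
qed

lemma proj_subspace_pair:
  fixes a b :: "'a::field ^ 'n"
  assumes "vec_over F a" "vec_over F b" "a \<noteq> b" "vec.independent {a, b}"
  shows "proj_subspace F 1 (vec.span {a, b})"
  unfolding proj_subspace_def
proof (intro conjI)
  show "vec.span {a, b} = vec.span {x \<in> vec.span {a, b}. vec_over F x}"
  proof (rule antisym)
    show "vec.span {a, b} \<subseteq> vec.span {x \<in> vec.span {a, b}. vec_over F x}"
      by (rule vec.span_mono) (use assms in \<open>auto intro: vec.span_base\<close>)
    show "vec.span {x \<in> vec.span {a, b}. vec_over F x} \<subseteq> vec.span {a, b}"
      by (rule vec.span_minimal) auto
  qed
  show "vec.dim (vec.span {a, b}) = 1 + 1"
    using vec.dim_span_eq_card_independent[OF assms(4)] assms(3) by simp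
qed simp

context bose_section begin

lemma sp_single_in_conj_line:
  assumes "k < 3" "ff k t = 0"
  shows "sp (\<lambda>j. if j = k then 1 else 0) (xx 1 t) \<in> frob (q ^ k) ` (*v) J ` line"
proof -
  have "xx 1 t \<in> frob (q ^ k) ` {x. dot (uu 0) x = 0}"
    unfolding frob_line using assms(2) by (simp add: ff_def)
  then obtain x where "dot u x = 0" "xx 1 t = frob (q ^ k) x" unfolding uu_0 by auto
  moreover from this have "frob (q ^ k) (J *v x) \<in> frob (q ^ k) ` (*v) J ` line" by blast
  ultimately show ?thesis by (simp only: frob_J_mult[OF assms(1)])
qed

text \<open>With e_k = e^(q^k), the roots of f_k are e_k and e_(k+1). So two of the f_k vanish at
  each e_m, two weights are free there, and over \<open>GF q 3\<close> a whole line of points at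
  infinity lies on the scroll.\<close>

theorem section_cubic:
  assumes e: "carrier_root e"
  defines "hh \<equiv> vec.span (Ph (xx 1 e) \<union> frob (q^2) ` Ph (xx 1 (e ^ q)))"
    and "gg \<equiv> (*v) J ` line"
  obtains v R where "nrc_basis (GF q 1) \<Sigma> 3 v"
    "bb_variety q J \<Sigma> (std_conic (GF q 1)) (GF q 1) = nrc (GF q 1) 3 v"
    "T_line q gg hh" "T_line q gg (frob q ` hh)" "T_line q gg (frob (q^2) ` hh)"
    "bb_variety q J \<Sigma> (std_conic (GF q 1)) (GF q 3) \<inter> pts (GF q 3) \<Sigma>inf =
       pts (GF q 3) hh \<union> pts (GF q 3) (frob q ` hh) \<union> pts (GF q 3) (frob (q^2) ` hh)"
    "nrc (GF q 3) 3 v \<inter> pts (GF q 3) \<Sigma>inf = {R, frob q ` R, frob (q^2) ` R}"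
    "R \<subseteq> hh" "\<And>X. X \<in> pts (GF q 3) gg \<Longrightarrow> \<not> R \<subseteq> conj_span q X"
proof -
  note ep = carrier_root_props[OF e]
  define ek where "ek k = e ^ q ^ k" for k
  have e3: "e ^ q ^ 3 = e" using ep(1) by (simp add: GF_iff)
  have ek_add3: "ek (k + 3) = ek k" for k
    using e3 by (simp add: ek_def add.commute[of k] flip: pow_pow)
  have ek_mod: "ek k = ek (k mod 3)" for k
    by (rule periodic_3) (rule ek_add3)
  have ek_cong: "ek a = ek b" if "a mod 3 = b mod 3" for a b
    using ek_mod[of a] ek_mod[of b] that by metis
  have ek_GF: "ek k \<in> GF q 3" for k unfolding ek_def by (intro GF_power ep(1))
  have ek_ne: "ek k \<noteq> ek (Suc k)" for k
  proof
    assume "ek k = ek (Suc k)"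
    then have "e ^ q ^ k = (e ^ q) ^ q ^ k" by (simp add: ek_def pow_pow_q)
    then have "e = e ^ q" by (simp add: pow_inj)
    then show False using ep(2) by (simp add: GF_iff)
  qed
  have fk: "ff k t = uu k $ 3 * (t - ek k) * (t - ek (Suc k))" for k t
    using ff_roots[OF ep(3), of k t] by (simp add: ek_def pow_pow_q)
  have Fk: "Fp k = smult (uu k $ 3) ([:- ek k, 1:] * [:- ek (Suc k), 1:])" for k
    using Fp_roots[OF ep(3), of k] by (simp add: ek_def pow_pow_q)
  \<comment> \<open>f_k uses up two of the three factors X - e_j; the missing one is X - e_(k+2),
    and the inverse leading coefficient makes the product independent of k.\<close>
  define c where "c k = smult (inverse (uu k $ 3)) [:- ek (k + 2), 1:]" for k
  define h where "h = [:- ek 0, 1:] * [:- ek 1, 1:] * [:- ek 2, 1:]"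
  interpret section_curve q ty J u \<Sigma> c h 3
  proof
    show "degree (c k) + 2 \<le> 3" for k
      using degree_smult_le[of "inverse (uu k $ 3)" "[:- ek (k + 2), 1:]"] by (simp add: c_def)
    show "c k * Fp k = h" if "k < 3" for k
    proof -
      have "c k * Fp k = [:- ek (k + 2), 1:] * ([:- ek k, 1:] * [:- ek (k + 1), 1:])"
        unfolding c_def Fk mult_smult_left mult_smult_right smult_smult using uu3_nonzero[of k] by simp
      moreover have "k = 0 \<or> k = 1 \<or> k = 2" using that by linarith
      ultimately show ?thesis
        unfolding h_def using ek_add3[of 0] ek_add3[of 1]
        by (elim disjE) (simp_all add: eval_nat_numeral algebra_simps)
    qed
    have "degree h = 3" by (simp add: h_def degree_mult_eq)
    moreover have "h \<noteq> 0" unfolding h_def by (simp only: mult_eq_0_iff) simp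
    ultimately show "coeff h 3 \<noteq> 0" by (metis leading_coeff_0_iff)
    show "coeff (c ((k + 2) mod 3)) i ^ q = coeff (c k) i" if "k < 3" for k i
    proof -
      have u: "(uu ((k + 2) mod 3) $ 3) ^ q = uu k $ 3"
        unfolding uu_nth_pow using that by (subst uu_mod) (simp add: mod_simps)
      have "ek ((k + 2) mod 3 + 2) ^ q = ek (Suc ((k + 2) mod 3 + 2))" unfolding ek_def by (rule pow_q_pow)
      also have "\<dots> = ek (k + 2)"
      proof -
        have "Suc ((k + 2) mod 3 + 2) mod 3 = (k + 2) mod 3" by (metis add_Suc_right mod_add_self2 mod_mod_trivial numeral_3_eq_3 numeral_2_eq_2)
        then show ?thesis by (rule ek_cong)
      qed
      finally show ?thesis
        using u by (auto simp: c_def coeff_pCons power_mult_distrib power_inverse pow_minus1 zero_power split: nat.split)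
    qed
    fix p :: "'a poly" assume p: "degree p \<le> 3"
    obtain A where A: "p - [:poly p (ek 0):] = [:- ek 0, 1:] * A"
      using poly_eq_0_iff_dvd[of "p - [:poly p (ek 0):]" "ek 0"] by auto
    have degA: "degree A \<le> 2"
    proof (cases "A = 0")
      case False
      then have "degree ([:- ek 0, 1:] * A) = 1 + degree A" by (subst degree_mult_eq) auto
      moreover have "degree (p - [:poly p (ek 0):]) \<le> 3" using p by (intro degree_diff_le) auto
      ultimately show ?thesis using A by simp
    qed simp
    \<comment> \<open>The remaining constant is a multiple of the difference of two linear factors,
      which are themselves multiples of \<open>c 0\<close> and \<open>c 1\<close>.\<close>
    define \<delta> where "\<delta> = poly p (ek 0) / (ek 0 - ek 2)"
    have "ek 0 \<noteq> ek 2" using ek_ne[of 2] ek_mod[of 3] by auto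
    then have \<delta>: "[:poly p (ek 0):] = smult \<delta> ([:- ek 2, 1:] - [:- ek 0, 1:])"
      by (simp add: \<delta>_def field_simps)
    have c0: "[:- ek 2, 1:] = smult (uu 0 $ 3) (c 0)" and c1: "[:- ek 0, 1:] = smult (uu 1 $ 3) (c 1)"
      using uu3_nonzero ek_mod[of 3] by (simp_all add: c_def numeral_3_eq_3 numeral_2_eq_2)
    have "p = [:poly p (ek 0):] + [:- ek 0, 1:] * A" using A by (simp add: algebra_simps)
    also have "\<dots> = [:\<delta> * uu 0 $ 3:] * c 0 + (smult (uu 1 $ 3) (A - [:\<delta>:])) * c 1 + 0 * c 2"
      unfolding \<delta> unfolding c0 c1 by (simp add: algebra_simps smult_diff_right)
    finally have "p = [:\<delta> * uu 0 $ 3:] * c 0 + (smult (uu 1 $ 3) (A - [:\<delta>:])) * c 1 + 0 * c 2" .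
    moreover have "degree (smult (uu 1 $ 3) (A - [:\<delta>:])) \<le> 2"
      using degA by (intro degree_smult_le[THEN order_trans] degree_diff_le) auto
    ultimately show "\<exists>A. (\<forall>k<3. degree (A k) \<le> 2) \<and> p = (\<Sum>k<3. A k * c k)"
      by (intro exI[of _ "\<lambda>k. if k = 0 then [:\<delta> * uu 0 $ 3:] 
            else if k = 1 then smult (uu 1 $ 3) (A - [:\<delta>:]) else 0"])
         (simp add: sum_less_3 all_less_3)
  qed
  \<comment> \<open>The scroll points with parameter e_m whose block m + 1 is zero: f_(m+1) is the
    one polynomial that does not vanish at e_m.\<close>
  define H where "H m = {sp w (xx 1 (ek m)) | w. w ((m + 1) mod 3) = 0}" for m
  define sg :: "nat \<Rightarrow> nat \<Rightarrow> 'a" where "sg k = (\<lambda>j. if j = k then 1 else 0)" for k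
  have H_span: "H m = vec.span {sp (sg m) (xx 1 (ek m)), sp (sg ((m + 2) mod 3)) (xx 1 (ek m))}" if "m < 3" for m
  proof -
    have idx: "(m + 1) mod 3 \<noteq> m" "(m + 2) mod 3 \<noteq> m" "(m + 2) mod 3 \<noteq> (m + 1) mod 3" 
      and cases: "\<And>k. k < 3 \<Longrightarrow> k = m \<or> k = (m + 1) mod 3 \<or> k = (m + 2) mod 3"
      using mod_3_other(1-4)[OF that] by auto
    have lin: "a *s sp (sg m) x + b *s sp (sg ((m + 2) mod 3)) x = sp (\<lambda>k. a * sg m k + b * sg ((m + 2) mod 3) k) x" 
      for a b x
      by (simp add: sp_def vec.scale_left_distrib vec.scale_scale flip: emb_add emb_scale)
    show ?thesis
    proof (intro equalityI subsetI)
      fix y assume "y \<in> H m"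
      then obtain w where w: "y = sp w (xx 1 (ek m))" "w ((m + 1) mod 3) = 0" by (auto simp: H_def)
      have "y = sp (\<lambda>k. w m * sg m k + w ((m + 2) mod 3) * sg ((m + 2) mod 3) k) (xx 1 (ek m))"
        unfolding w(1) sp_def
        by (rule emb_cong) (use cases w(2) idx in \<open>fastforce simp: sg_def\<close>)
      then show "y \<in> vec.span {sp (sg m) (xx 1 (ek m)), sp (sg ((m + 2) mod 3)) (xx 1 (ek m))}"
        unfolding lin[symmetric] by (simp add: vec.span_add vec.span_scale vec.span_base)
    next
      fix y assume "y \<in> vec.span {sp (sg m) (xx 1 (ek m)), sp (sg ((m + 2) mod 3)) (xx 1 (ek m))}"
      then obtain a b where "y = a *s sp (sg m) (xx 1 (ek m)) + b *s sp (sg ((m + 2) mod 3)) (xx 1 (ek m))"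
        by (auto simp: vec.span_insert vec.span_empty algebra_simps)
      then show "y \<in> H m" unfolding lin H_def using idx by (auto simp: sg_def)
    qed
  qed
  have frob_x: "frob (q ^ k) (xx 1 (ek m)) = xx 1 (ek (m + k))" for k m
    by (simp add: frob_xx ek_def pow_pow)
  have hh: "hh = H 0"
  proof -
    have "J *v xx 1 e = sp (sg 0) (xx 1 (ek 0))"
      using frob_J_mult[of 0 "xx 1 e"] by (simp add: sg_def ek_def)
    \<comment> \<open>Conjugating the parameter e^q twice gives e^(q^3) = e, so both points spanning
      \<open>hh\<close> carry the same plane vector, in blocks 0 and 2.\<close>
    moreover have "frob (q ^ 2) (J *v xx 1 (e ^ q)) = sp (sg 2) (xx 1 (ek 0))"
    proof -
      have "frob (q ^ 2) (J *v xx 1 (ek 1)) = sp (sg 2) (xx 1 (ek (1 + 2)))"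
        using frob_J_mult[of 2 "xx 1 (ek 1)"] unfolding frob_x sg_def by simp
      moreover have "ek (1 + 2) = ek 0" by (rule ek_cong) simp
      ultimately have "frob (q ^ 2) (J *v xx 1 (ek 1)) = sp (sg 2) (xx 1 (ek 0))" by (simp only:)
      then show ?thesis by (simp add: ek_def)
    qed
    ultimately show ?thesis
      unfolding hh_def proj_pt_image frob_proj_pt span_Un_proj_pt by (simp add: H_span numeral_2_eq_2)
  qed
  have frob_hh: "frob (q ^ m) ` hh = H m" if m: "m < 3" for m
  proof -
    have i1: "(m + 2 * m) mod 3 = 0" by simp
    have "frob (q ^ m) (sp (sg k) (xx 1 (ek 0))) = sp (sg ((k + m) mod 3)) (xx 1 (ek m))" if "k < 3" for k
      unfolding sp_def frob_emb frob_scale frob_x add_0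
    proof (rule emb_cong)
      fix j :: nat assume "j < 3"
      then have "(j + 2 * m) mod 3 = k \<longleftrightarrow> j = (k + m) mod 3" by (rule mod_3_shift[OF _ that])
      then show "sg k ((j + 2 * m) mod 3) ^ q ^ m *s xx 1 (ek m) = sg ((k + m) mod 3) j *s xx 1 (ek m)"
        by (simp add: sg_def zero_power)
    qed
    from this[of 0] this[of 2] have "frob (q ^ m) (sp (sg 0) (xx 1 (ek 0))) = sp (sg m) (xx 1 (ek m))"
      "frob (q ^ m) (sp (sg 2) (xx 1 (ek 0))) = sp (sg ((m + 2) mod 3)) (xx 1 (ek m))"
      using m by (simp_all add: add.commute)
    then show ?thesis unfolding hh H_span[OF m] by (simp add: H_span frob_span numeral_2_eq_2)
  qed
  have H_subspace: "vec.subspace (H m)" if "m < 3" for m unfolding H_span[OF that] by simp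
  have froot: "ff m (ek m) = 0" "ff ((m + 2) mod 3) (ek m) = 0" if "m < 3" for m
  proof -
    show "ff m (ek m) = 0" by (simp add: fk)
    have "Suc ((m + 2) mod 3) mod 3 = m mod 3" using mod_3_other(6)[OF that] that by simp
    then have "ek (Suc ((m + 2) mod 3)) = ek m" by (rule ek_cong)
    then show "ff ((m + 2) mod 3) (ek m) = 0" by (simp add: fk)
  qed
  have fother: "ff ((m + 1) mod 3) (ek m) \<noteq> 0" if m: "m < 3" for m
  proof
    assume "ff ((m + 1) mod 3) (ek m) = 0"
    then have "\<forall>k<3. ff k (ek m) = 0"
    proof -
      have "k = m \<or> k = (m + 1) mod 3 \<or> k = (m + 2) mod 3" if "k < 3" for k using mod_3_other(4)[OF m that] .
      then show ?thesis using froot[OF m] \<open>ff ((m + 1) mod 3) (ek m) = 0\<close> by blast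
    qed
    then show False using not_all_ff_zero by blast
  qed
  have H_inf: "H m \<subseteq> \<Sigma>inf" if m: "m < 3" for m
  proof
    fix y assume "y \<in> H m"
    then obtain w where w: "y = sp w (xx 1 (ek m))" "w ((m + 1) mod 3) = 0" by (auto simp: H_def)
    have "w k * ff k (ek m) = 0" if "k < 3" for k
    proof -
      have "k = m \<or> k = (m + 1) mod 3 \<or> k = (m + 2) mod 3" using mod_3_other(4)[OF m that] .
      then show ?thesis using froot[OF m] w(2) by auto
    qed
    then show "y \<in> \<Sigma>inf" by (simp add: infinity_iff w(1) ell_sp_xx)
  qed
  have T: "T_line q gg (H m)" if m: "m < 3" for m
    unfolding T_line_def
  proof (intro conjI)
    let ?a = "sp (sg m) (xx 1 (ek m))" and ?b = "sp (sg ((m + 2) mod 3)) (xx 1 (ek m))"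
    have i: "(m + 2) mod 3 \<noteq> m" "(m + 2) mod 3 < 3" using mod_3_other(2)[OF m] by simp_all
    have over: "vec_over (GF q 3) (sp (sg k) (xx 1 (ek m)))" for k
    proof -
      have "sg k ((j + 2 * 3) mod 3) ^ q ^ 3 = sg k j" if "j < 3" for j
      proof -
        have "(j + 2 * 3) mod 3 = j" using that by (simp only: mod_mult_self1 mod_mult_self2 mod_less)
        then show ?thesis by (simp only: sg_def) (simp add: zero_power)
      qed
      then show ?thesis
        unfolding vec_over_iff_frob sp_def frob_emb frob_scale frob_x ek_add3 by (intro emb_cong) simp
    qed
    have a0: "?a \<noteq> 0" "?b \<noteq> 0" using m i by (auto simp: sp_eq_0_iff sg_def)
    have ab: "?a \<noteq> c *s ?b" for c
    proof
      assume "?a = c *s ?b"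
      then have "co ?a m = co (c *s ?b) m" by simp
      then show False using m i by (simp add: co_sp co_scale sg_def)
    qed
    have "vec.independent {?a, ?b}"
      using a0 ab by (simp add: vec.independent_insert vec.span_singleton image_iff)
    moreover have "?a \<noteq> ?b" using ab[of 1] by simp
    ultimately show "proj_subspace (GF q 3) 1 (H m)"
      unfolding H_span[OF m] by (intro proj_subspace_pair over)
    show "H m \<subseteq> conj_span q gg" unfolding gg_def by (rule H_inf[OF m])
    have meet: "pts (GF q 3) (H m \<inter> frob (q ^ k) ` gg) \<noteq> {}" 
      if k: "k < 3" "k = m \<or> k = (m + 2) mod 3" for k
    proof -
      have "ff k (ek m) = 0" using k froot[OF m] by auto
      then have "sp (sg k) (xx 1 (ek m)) \<in> frob (q ^ k) ` gg"
        using sp_single_in_conj_line[OF k(1)] by (simp add: gg_def sg_def)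
      moreover have "sp (sg k) (xx 1 (ek m)) \<in> H m"
        unfolding H_span[OF m] using k(2) by (auto intro: vec.span_base)
      moreover have sub: "vec.subspace (frob (q ^ k) ` gg)"
      proof -
        have "vec.subspace gg" unfolding gg_def by (rule vec.subspace_image[OF dot_subspace]) 
        then show ?thesis using frob_span[of k gg] vec.span_eq_iff by (metis vec.subspace_span)
      qed
      have "vec.subspace (H m \<inter> frob (q ^ k) ` gg)" by (intro vec.subspace_inter sub H_subspace m)
      ultimately have "proj_pt (sp (sg k) (xx 1 (ek m))) \<in> pts (GF q 3) (H m \<inter> frob (q ^ k) ` gg)"
        using a0 k(2) over[of k] by (auto simp: pts_proj_pt intro!: PG_I)
      then show ?thesis by blast
    qed
    show "\<exists>i<3. \<exists>j<3. i \<noteq> j \<and> pts (GF q 3) (H m \<inter> frob (q ^ i) ` gg) \<noteq> {} \<and>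
        pts (GF q 3) (H m \<inter> frob (q ^ j) ` gg) \<noteq> {}"
      by (rule exI[of _ m], intro conjI m, rule exI[of _ "(m + 2) mod 3"])
         (use i meet[of m] meet[of "(m + 2) mod 3"] m in auto)
  qed
  have var_inf: "bb_variety q J \<Sigma> (std_conic (GF q 1)) (GF q 3) \<inter> pts (GF q 3) \<Sigma>inf 
      = pts (GF q 3) (H 0) \<union> pts (GF q 3) (H 1) \<union> pts (GF q 3) (H 2)"
  proof (intro equalityI subsetI)
    fix P assume "P \<in> bb_variety q J \<Sigma> (std_conic (GF q 1)) (GF q 3) \<inter> pts (GF q 3) \<Sigma>inf"
    then have P: "P \<in> PG (GF q 3)" "P \<subseteq> \<Sigma>inf"
      and "\<exists>w. (\<exists>t\<in>GF q 3. P = proj_pt (sp w (xx 1 t))) \<or> P = proj_pt (sp w (xx 0 1))"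
      unfolding bb_variety_def pts_def Int_iff bose_variety_iff by blast+
    then consider w t where "P = proj_pt (sp w (xx 1 t))" | w where "P = proj_pt (sp w (xx 0 1))" by blast
    then show "P \<in> pts (GF q 3) (H 0) \<union> pts (GF q 3) (H 1) \<union> pts (GF q 3) (H 2)"
    proof cases
      case 1
      have "sp w (xx 1 t) \<in> \<Sigma>inf" using P(2) 1 proj_pt_self by blast
      then have w: "w k * ff k t = 0" if "k < 3" for k using that by (simp add: infinity_iff ell_sp_xx)
      have "sp w (xx 1 t) \<noteq> 0" using P(1) 1 PG_nonzero by blast
      \<comment> \<open>At infinity a nonzero weight w_k forces f_k(t) = 0, hence t is some e_m, and
        the weight opposite the nonvanishing f_(m+1) must be zero.\<close>
      then obtain k where k: "k < 3" "w k \<noteq> 0" by (auto simp: sp_eq_0_iff)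
      then have "ff k t = 0" using w by auto
      then have "t = ek k \<or> t = ek (Suc k)" using uu3_nonzero by (simp add: fk)
      then obtain m where m: "m < 3" "t = ek m" using k(1) ek_mod[of "Suc k"] by (metis mod_less_divisor zero_less_numeral)
      have "w ((m + 1) mod 3) = 0" using w[of "(m + 1) mod 3"] fother[OF m(1)] m(2) by simp
      then have "sp w (xx 1 t) \<in> H m" using m(2) by (auto simp: H_def)
      then have "P \<in> pts (GF q 3) (H m)" using P(1) 1 by (simp add: pts_proj_pt H_subspace m)
      moreover have "m = 0 \<or> m = 1 \<or> m = 2" using m(1) by linarith
      ultimately show ?thesis by blast
    next
      case 2
      have "sp w (xx 0 1) \<in> \<Sigma>inf" using P(2) 2 proj_pt_self by blast
      then have "\<forall>k<3. w k = 0 \<or> uu k $ 3 = 0" by (simp add: infinity_iff ell_sp dot_xx_0_1)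
      then have "w k = 0" if "k < 3" for k using that uu3_nonzero by blast
      then have "sp w (xx 0 1) = 0" by (simp add: sp_eq_0_iff)
      then show ?thesis using P(1) 2 PG_nonzero by blast
    qed
  next
    fix P assume "P \<in> pts (GF q 3) (H 0) \<union> pts (GF q 3) (H 1) \<union> pts (GF q 3) (H 2)"
    then obtain m where m: "m < 3" "P \<in> pts (GF q 3) (H m)" by (auto intro: that[of 0] that[of 1] that[of 2])
    then have P: "P \<in> PG (GF q 3)" "P \<subseteq> H m" by (auto simp: pts_def)
    have inf: "P \<subseteq> \<Sigma>inf" using P(2) H_inf[OF m(1)] by blast
    obtain y where y: "P = proj_pt y" using P(1) by (auto simp: PG_def)
    then have "y \<in> H m" using P(2) proj_pt_self by blast
    then obtain w where w: "y = sp w (xx 1 (ek m))" by (auto simp: H_def)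
    have "P \<in> bose_variety q J (std_conic (GF q 1)) (GF q 3)"
      unfolding bose_variety_iff using P(1) y w ek_GF by blast
    moreover have "\<Sigma>inf \<subseteq> \<Sigma>"
    proof
      fix x assume "x \<in> \<Sigma>inf"
      then show "x \<in> \<Sigma>" unfolding section_iff infinity_iff by blast
    qed
    ultimately show "P \<in> bb_variety q J \<Sigma> (std_conic (GF q 1)) (GF q 3) \<inter> pts (GF q 3) \<Sigma>inf"
      using P(1) inf by (auto simp: bb_variety_def pts_def)
  qed
  \<comment> \<open>At the parameter e the weight c_1 vanishes and the other two do not; the former
    puts \<open>R\<close> on \<open>hh\<close>, the latter keeps it off the spread planes.\<close>
  define R where "R = proj_pt (gam e)"
  have R_frob: "frob (q ^ k) ` R = proj_pt (gam (ek k))" for k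
    by (simp add: R_def frob_proj_pt frob_gam ek_def)
  have nrc_inf: "nrc (GF q 3) 3 vv \<inter> pts (GF q 3) \<Sigma>inf = {R, frob q ` R, frob (q^2) ` R}"
  proof -
    have "poly h t = 0 \<longleftrightarrow> t = ek 0 \<or> t = ek 1 \<or> t = ek 2" for t
      unfolding h_def poly_mult mult_eq_0_iff by auto
    then have "{proj_pt (gam t) | t. t \<in> GF q 3 \<and> poly h t = 0} 
        = {proj_pt (gam (ek 0)), proj_pt (gam (ek 1)), proj_pt (gam (ek 2))}"
      using ek_GF by auto
    then show ?thesis
      unfolding curve_at_infinity R_frob[symmetric] using R_frob[of 0] by (simp add: R_def ek_def)
  qed
  have cpoly: "poly (c k) t = inverse (uu k $ 3) * (t - ek (k + 2))" for k t
    by (simp add: c_def algebra_simps)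
  have ek_e: "ek 0 = e" "ek 3 = e" "ek (Suc 2) = e" "ek (1 + 2) = e" "ek (2 + 2) = ek 1" "ek (0 + 2) = ek 2"
  proof -
    show "ek 0 = e" by (simp add: ek_def)
    then show "ek 3 = e" "ek (Suc 2) = e" "ek (1 + 2) = e" "ek (2 + 2) = ek 1" "ek (0 + 2) = ek 2"
      using ek_add3[of 0] ek_add3[of 1] by (simp_all add: eval_nat_numeral)
  qed
  have c_e: "poly (c 0) e \<noteq> 0" "poly (c 1) e = 0" "poly (c 2) e \<noteq> 0"
  proof -
    have "ek 2 \<noteq> e" "ek 1 \<noteq> e" using ek_ne[of 2] ek_ne[of 0] ek_e by auto
    then show "poly (c 0) e \<noteq> 0" "poly (c 1) e = 0" "poly (c 2) e \<noteq> 0"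
      unfolding cpoly using ek_e uu3_nonzero by auto
  qed
  have R_hh: "R \<subseteq> hh"
  proof -
    have "gam e \<in> H 0" unfolding H_def gam_def using c_e(2) by (auto simp: ek_def)
    then show ?thesis unfolding hh R_def by (simp add: proj_pt_subset H_subspace)
  qed
  have not_spread: "\<not> R \<subseteq> conj_span q X" if X: "X \<in> pts (GF q 3) gg" for X
  proof
    assume RX: "R \<subseteq> conj_span q X"
    obtain y where y: "X = proj_pt y" using X by (auto simp: pts_def PG_def)
    have "y \<in> gg" using X proj_pt_self unfolding y pts_def by blast
    then obtain x where x: "y = J *v x" by (auto simp: gg_def)
    have "gam e \<in> conj_span q (Ph x)" using RX proj_pt_self unfolding R_def y x proj_pt_image by blast
    then have "\<exists>a. co (gam e) k = a *s frob (q ^ k) x" if "k < 3" for k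
      using that by (simp add: conj_span_proj_pt)
    then have "\<exists>a. poly (c k) e *s xx 1 e = a *s frob (q ^ k) x" if "k < 3" for k
      using that by (simp add: gam_def co_sp)
    \<comment> \<open>In a spread plane blocks 0 and 2 would be multiples of x and its conjugate by
      q^2; both being nonzero multiples of \<open>xx 1 e\<close>, this gives e = e^(q^2).\<close>
    from this[of 0] this[of 2] obtain a b where a: "poly (c 0) e *s xx 1 e = a *s x"
      and b: "poly (c 2) e *s xx 1 e = b *s frob (q ^ 2) x" by auto
    have "a \<noteq> 0" using a c_e(1) by auto
    then have "x = (poly (c 0) e / a) *s xx 1 e"
      using arg_cong[OF a, of "\<lambda>z. inverse a *s z"] by (simp add: field_simps)
    then have "frob (q ^ 2) x = (poly (c 0) e / a) ^ q ^ 2 *s xx 1 (ek 2)"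
    proof -
      have "frob (q ^ 2) (xx 1 e) = xx 1 (ek 2)" using frob_x[of 2 0] unfolding ek_e(1) by (simp add: numeral_2_eq_2)
      then show ?thesis using \<open>x = _\<close> by (simp only: frob_scale)
    qed
    then obtain b' where b': "poly (c 2) e *s xx 1 e = b' *s xx 1 (ek 2)" using b by auto
    then have "poly (c 2) e = b'" "poly (c 2) e * e = b' * ek 2"
      by (auto simp: vec_eq_iff forall_3)
    then have "e = ek 2" using c_e(3) by auto
    then show False using ek_ne[of 2] ek_e by simp
  qed
  show ?thesis
  proof (rule that[OF curve_basis _ _ _ _ _ nrc_inf R_hh not_spread])
    \<comment> \<open>Over \<open>GF q 1\<close> the f_k have no roots at all, so the uniqueness
      condition is vacuous there.\<close>
    have "ff k t \<noteq> 0" if "t \<in> GF q 1" for k t using ff_no_root that by blast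
    then show "bb_variety q J \<Sigma> (std_conic (GF q 1)) (GF q 1) = nrc (GF q 1) 3 vv"
      by (intro section_variety_eq) blast
    have H: "frob q ` hh = H 1" "frob (q ^ 2) ` hh = H 2" using frob_hh[of 1] frob_hh[of 2] by simp_all
    show "T_line q gg hh" "T_line q gg (frob q ` hh)" "T_line q gg (frob (q^2) ` hh)"
      unfolding H using T[of 0] T[of 1] T[of 2] hh by simp_all
    show "bb_variety q J \<Sigma> (std_conic (GF q 1)) (GF q 3) \<inter> pts (GF q 3) \<Sigma>inf =
       pts (GF q 3) hh \<union> pts (GF q 3) (frob q ` hh) \<union> pts (GF q 3) (frob (q^2) ` hh)"
      unfolding H using var_inf hh by simp
  qed
qed

end

section \<open>Transfer to an arbitrary subplane\<close>

lemma image_mat_mult: "(*v) A ` (*v) B ` S = (*v) (A ** B) ` (S :: ('a::field ^ 'n) set)"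
  by (simp add: image_image matrix_vector_mul_assoc)

text \<open>A change of coordinates in the plane may be charged to the frame: the subplane becomes
  standard and \<open>J\<close> becomes \<open>J ** A\<close>.\<close>

lemma bb_variety_image:
  "bb_variety q J \<Sigma> ((\<lambda>P. (*v) A ` P) ` D) F = bb_variety q (J ** A) \<Sigma> D F"
  by (simp add: bb_variety_def bose_variety_def bose_points_def image_mat_mult)

lemma dot_mult: "dot u (A *v x) = dot (transpose A *v u) (x :: 'a::field ^ 'n)"
proof -
  have "dot u (A *v x) = (\<Sum>i\<in>UNIV. \<Sum>j\<in>UNIV. u $ i * A $ i $ j * x $ j)"
    by (simp add: dot_def matrix_vector_mult_def sum_distrib_left mult_ac)
  also have "\<dots> = (\<Sum>j\<in>UNIV. \<Sum>i\<in>UNIV. u $ i * A $ i $ j * x $ j)" by (rule sum.swap)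
  also have "\<dots> = dot (transpose A *v u) x"
    by (simp add: dot_def matrix_vector_mult_def transpose_def sum_distrib_left sum_distrib_right mult_ac)
  finally show ?thesis .
qed

lemma mat_over_transpose: "mat_over F A \<Longrightarrow> mat_over F (transpose A)"
  by (simp add: mat_over_def vec_over_def transpose_def)

context sextic_field begin

lemma bose_coordsI:
  assumes J: "bose_frame q \<Gamma> J" and A: "mat_over (GF q 3) A" "invertible (A :: 'a ^ 3 ^ 3)"
  shows "bose_coords q (J ** A)"
proof
  show "mat_over (GF q 3) (J ** A)" using J A by (auto simp: bose_frame_def intro: mat_over_mult)
  fix y :: "'a ^ 9"
  let ?S = "{y. \<exists>z. y = (\<Sum>k<3. frobm k (J ** A) *v z k)}"
  have "vec.subspace ?S"
  proof (rule vec.subspaceI)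
    show "0 \<in> ?S" by (auto intro!: exI[of _ "\<lambda>_. 0"])
    fix x y assume "x \<in> ?S" "y \<in> ?S"
    then obtain z z' where "x = (\<Sum>k<3. frobm k (J ** A) *v z k)" "y = (\<Sum>k<3. frobm k (J ** A) *v z' k)" by blast
    then show "x + y \<in> ?S" by (auto intro!: exI[of _ "\<lambda>k. z k + z' k"] simp: vec.add sum.distrib)
  next
    fix c x assume "x \<in> ?S"
    then obtain z where "x = (\<Sum>k<3. frobm k (J ** A) *v z k)" by blast
    then show "c *s x \<in> ?S" by (auto intro!: exI[of _ "\<lambda>k. c *s z k"] simp: vec.scale vec.scale_sum_right)
  qed
  moreover have "frob (q ^ k) x \<in> ?S" if "x \<in> \<Gamma>" "k < 3" for k x
  proof -
    obtain w where "x = J *v w" using J \<open>x \<in> \<Gamma>\<close> by (auto simp: bose_frame_def)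
    moreover obtain w' where "w = A *v w'" using invertible_mult_surj[OF A(2)] by blast
    ultimately have x: "x = (J ** A) *v w'" by (simp add: matrix_vector_mul_assoc)
    have "frob (q ^ k) x = (\<Sum>j<3. frobm j (J ** A) *v (if j = k then frob (q ^ k) w' else 0))"
      using that(2) by (simp add: x frob_mult_vec if_distrib[of "\<lambda>z. _ *v z"] cong: if_cong)
    then show ?thesis by (auto intro!: exI[of _ "\<lambda>j. if j = k then frob (q ^ k) w' else 0"])
  qed
  from this[of _ 0] this[of _ 1] this[of _ 2] have "\<Gamma> \<union> frob q ` \<Gamma> \<union> frob (q^2) ` \<Gamma> \<subseteq> ?S"
    unfolding power_0 power_one_right frob_power_0[unfolded power_0] by auto
  ultimately have "conj_span q \<Gamma> \<subseteq> ?S" unfolding conj_span_def by (intro vec.span_minimal)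
  then show "\<exists>z. y = (\<Sum>k<3. frobm k (J ** A) *v z k)" using J by (auto simp: bose_frame_def)
qed

text \<open>Two spanning vectors over \<open>GF q 3\<close> give two linear equations for
  \<open>u\<close>; the inclusion obtained is an equality because both sides have dimension
  2.\<close>

lemma line_equation:
  fixes l :: "('a ^ 3) set"
  assumes "proj_subspace (GF q 3) 1 l"
  obtains u where "vec_over (GF q 3) u" "l = {x. dot u x = 0}"
proof -
  define S where "S = {x \<in> l. vec_over (GF q 3) x}"
  have l: "vec.subspace l" "l = vec.span S" "vec.dim l = 2" using assms by (auto simp: proj_subspace_def S_def)
  obtain T where T: "T \<subseteq> S" "vec.independent T" "S \<subseteq> vec.span T" "card T = vec.dim S"
    using vec.basis_exists[of S] by metis
  have "vec.dim S = 2" using l vec.dim_span by metis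
  then obtain a b where ab: "T = {a, b}" using T(4) by (auto simp: card_2_iff)
  have lT: "l = vec.span {a, b}" using T l(2) unfolding ab by (metis vec.span_mono vec.span_span antisym)
  have over: "vec_over (GF q 3) a" "vec_over (GF q 3) b" using T(1) ab by (auto simp: S_def)
  obtain u where u: "u \<noteq> 0" "vec_over (GF q 3) u" "(\<Sum>i\<in>UNIV. a $ i * u $ i) = 0" "(\<Sum>i\<in>UNIV. b $ i * u $ i) = 0"
    by (rule two_linear_equations[OF _ over]) (simp, blast)
  have "dot u a = 0" "dot u b = 0" using u(3,4) by (simp_all add: dot_def mult.commute)
  then have sub: "l \<subseteq> {x. dot u x = 0}" unfolding lT by (intro vec.span_minimal dot_subspace) auto
  have "vec.dim {x. dot u x = 0} \<le> 2"
  proof (rule ccontr)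
    assume "\<not> vec.dim {x. dot u x = 0} \<le> 2"
    moreover have "vec.dim (UNIV :: ('a ^ 3) set) = 3" by (simp only: vec.dim_UNIV card_cart_basis) simp
    ultimately have "{x. dot u x = 0} = UNIV"
      by (intro vec.subspace_dim_equal dot_subspace vec.subspace_UNIV) auto
    then have "dot u (axis i 1) = 0" for i by blast
    then have "u $ i = 0" for i by (simp add: dot_axis)
    then show False using u(1) by (simp add: vec_eq_iff)
  qed
  then have "l = {x. dot u x = 0}" using l(1,3) sub by (intro vec.subspace_dim_equal dot_subspace) auto
  then show ?thesis using that u(2) by blast
qed

text \<open>The matrix \<open>B\<close> agrees up to a scalar with that of the Frobenius map in the coordinates of the
  subplane: a linear map fixing all points of a frame is a scalar.\<close>

lemma subplane_conj_scalar:
  fixes A B :: "'a ^ 3 ^ 3"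
  assumes A: "invertible A" and B: "invertible B"
    and fixes_pts: "\<And>P. P \<in> PG (GF q 1) \<Longrightarrow> conj_map q B ((*v) A ` P) = (*v) A ` P"
  obtains \<kappa> where "\<kappa> \<noteq> 0" "\<And>x. B *v frob q (A *v x) = \<kappa> *s (A *v frob q x)"
proof -
  obtain A' where A': "A ** A' = mat 1" "A' ** A = mat 1" using A by (auto simp: invertible_def)
  \<comment> \<open>The matrix of the collineation in the coordinates of the subplane, with the
    Frobenius part split off.\<close>
  define D where "D = A' ** B ** frobm 1 A"
  have BD: "B *v frob q (A *v x) = A *v (D *v frob q x)" for x
    using frob_mult_vec[of 1 A x]
    by (simp add: D_def matrix_vector_mul_assoc matrix_mul_assoc A')
  have eig: "\<exists>c. D *v x = c *s x" if x: "vec_over (GF q 1) x" "x \<noteq> 0" for x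
  proof -
    have fx: "frob q x = x" using x(1) by (simp add: vec_over_iff_frob)
    have "conj_map q B ((*v) A ` proj_pt x) = (*v) A ` proj_pt x" by (intro fixes_pts PG_I x)
    then have "B *v frob q (A *v x) \<in> (*v) A ` proj_pt x"
      using proj_pt_self[of x] by (auto simp: conj_map_def)
    then obtain c where "A *v (D *v x) = A *v (c *s x)" by (auto simp: BD fx proj_pt_iff)
    then show ?thesis using invertible_mult_cancel[OF A] by blast
  qed
  define e where "e i = (axis i 1 :: 'a ^ 3)" for i
  define w where "w = e 1 + e 2 + e 3"
  have eF: "vec_over (GF q 1) (e i)" "e i \<noteq> 0" for i by (simp_all add: e_def vec_over_axis)
  have wF: "vec_over (GF q 1) w" "w \<noteq> 0"
    unfolding w_def by (intro vec_over_lincomb eF) (simp add: vec_eq_iff forall_3 e_def axis_def)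
  obtain c where c: "\<And>i. D *v e i = c i *s e i" using eig[OF eF] by metis
  obtain d where d: "D *v w = d *s w" using eig[OF wF] by blast
  \<comment> \<open>The fourth point of the frame forces the three eigenvalues to agree.\<close>
  have "c 1 *s e 1 + c 2 *s e 2 + c 3 *s e 3 = d *s w"
    unfolding d[symmetric] by (simp add: w_def vec.add c)
  then have cd: "c 1 = d" "c 2 = d" "c 3 = d"
    by (auto simp: vec_eq_iff forall_3 w_def e_def axis_def)
  have D: "D *v x = d *s x" for x
    using vec3_expand[of D x] c[of 1] c[of 2] c[of 3]
    unfolding e_def cd by (simp add: vec_eq_iff forall_3 axis_def)
  have "d \<noteq> 0"
  proof
    assume "d = 0"
    then have "B *v frob q (A *v e 1) = 0" by (simp add: BD D)
    moreover have "frob q (A *v e 1) \<noteq> 0"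
      using frob_eq_0[of 1 "A *v e 1"] invertible_mult_cancel[OF A, of "e 1" 0] eF(2) by simp
    ultimately show False using invertible_mult_cancel[OF B, of "frob q (A *v e 1)" 0] by simp
  qed
  then show ?thesis by (rule that) (simp add: BD D vec.scale)
qed

end

context bose_line begin

text \<open>Replacing \<open>u\<close> by u / d divides the k-th form by d^(q^k), which is exactly
  the factor by which the forms differ on the section.\<close>

lemma normalized_section:
  assumes \<Sigma>: "proj_subspace (GF q 1) 6 \<Sigma>" "conj_span q ((*v) J ` {x. dot u x = 0}) \<subseteq> \<Sigma>"
  obtains u' where "bose_section q J u' \<Sigma>" "{x. dot u' x = 0} = {x. dot u x = 0}"
proof -
  obtain d where d: "d \<in> GF q 3" "d \<noteq> 0" "\<And>y. y \<in> \<Sigma> \<longleftrightarrow> (\<exists>e. \<forall>k<3. ell k y = e * d ^ q ^ k)"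
    by (rule section_normalize[OF \<Sigma>]) (rule that; blast)
  define u' where "u' = inverse d *s u"
  have u'F: "vec_over (GF q 3) u'" unfolding u'_def by (intro vec_over_lincomb GF_inverse d u_over)
  have dot': "dot u' x = inverse d * dot u x" for x by (simp add: u'_def dot_scale_left)
  interpret n: bose_line q ty J u'
    by unfold_locales (use u'F u_exterior d(2) in \<open>auto simp: dot'\<close>)
  have ell': "n.ell k y = ell k y / d ^ q ^ k" for k y
    unfolding n.ell_def ell_def n.uu_def uu_def
    by (simp add: u'_def frob_scale dot_scale_left power_inverse divide_inverse mult.commute)
  have "bose_section q J u' \<Sigma>"
    by unfold_locales (use d(2) in \<open>simp add: d(3) ell' field_simps\<close>)
  moreover have "{x. dot u' x = 0} = {x. dot u x = 0}" using d(2) by (simp add: dot')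
  ultimately show ?thesis by (rule that)
qed

section \<open>Conjugate lines and carriers in the coordinates of the subplane\<close>

definition ker :: "nat \<Rightarrow> ('a ^ 3) set" where "ker k = {x. dot (uu k) x = 0}"

lemma frob_ker: "frob q ` ker k = ker (Suc k)"
  using frob_line[of 1 k] by (simp add: ker_def)

lemma frob_ker_Int: "frob q ` (ker j \<inter> ker k) = ker (Suc j) \<inter> ker (Suc k)"
proof -
  have "inj (frob q :: 'a ^ 3 \<Rightarrow> _)" using frob_inj[of 1] by (auto simp: inj_def)
  then show ?thesis by (simp add: image_Int frob_ker)
qed

lemma ker_subspace: "vec.subspace (ker k)" unfolding ker_def by (rule dot_subspace)

lemma xx_in_ker: "xx 1 t \<in> ker k \<longleftrightarrow> ff k t = 0" by (simp add: ker_def ff_def)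

lemma kers_not_concurrent: "\<not> ker 1 \<inter> ker 2 \<subseteq> ker 0"
proof
  assume sub: "ker 1 \<inter> ker 2 \<subseteq> ker 0"
  have over: "vec_over (GF q 6) (uu k)" for k by (simp add: GF_6 vec_over_def)
  obtain x where x: "x \<noteq> 0" "(\<Sum>i\<in>UNIV. uu 1 $ i * x $ i) = 0" "(\<Sum>i\<in>UNIV. uu 2 $ i * x $ i) = 0"
    by (rule two_linear_equations[OF dvd_refl over[of 1] over[of 2]]) (rule that; assumption)
  then have "x \<in> ker 1" "x \<in> ker 2" by (simp_all add: ker_def dot_def)
  then have "\<forall>k<3. dot (uu k) x = 0" using sub unfolding all_less_3 by (auto simp: ker_def)
  then show False using conjugate_lines_not_concurrent[of x] x(1) by blast
qed

text \<open>The conic point with s = 0 lies in the subplane and so never on the line; algebraically,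
  the last coefficient of the equation is nonzero. Every intersection thus has an affine
  parameter.\<close>

lemma conic_line_points:
  assumes d: "3 dvd d" and A: "mat_over (GF q d) A" "invertible (A :: 'a ^ 3 ^ 3)"
  shows "(\<lambda>P. (*v) A ` P) ` std_conic (GF q d) \<inter> pts (GF q d) ((*v) A ` ker 0)
    = {(*v) A ` proj_pt (xx 1 t) | t. t \<in> GF q d \<and> ff 0 t = 0}"
proof (intro equalityI subsetI)
  have sub: "vec.subspace ((*v) A ` ker 0)" by (rule vec.subspace_image[OF ker_subspace])
  have mem: "A *v x \<in> (*v) A ` ker 0 \<longleftrightarrow> x \<in> ker 0" for x
    using invertible_mult_cancel[OF A(2)] by auto
  {
    fix P assume "P \<in> (\<lambda>P. (*v) A ` P) ` std_conic (GF q d) \<inter> pts (GF q d) ((*v) A ` ker 0)"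
    then obtain s t where st: "s \<in> GF q d" "t \<in> GF q d" "(s, t) \<noteq> (0, 0)" "P = proj_pt (A *v xx s t)"
      and "P \<in> pts (GF q d) ((*v) A ` ker 0)" by (auto simp: std_conic_def proj_pt_image)
    then have k: "xx s t \<in> ker 0" using pts_proj_pt[OF sub] mem by blast
    have "s \<noteq> 0"
    proof
      assume "s = 0"
      then have "uu 0 $ 3 * t ^ 2 = 0" using k by (simp add: ker_def dot_def sum_3)
      then show False using uu3_nonzero \<open>s = 0\<close> st(3) by simp
    qed
    then have eq: "xx s t = s ^ 2 *s xx 1 (t / s)" using xx_scale[of s 1 "t / s"] by simp
    have "dot (uu 0) (xx 1 (t / s)) = 0"
      using k \<open>s \<noteq> 0\<close> unfolding ker_def eq by (simp add: dot_scale)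
    moreover have "P = (*v) A ` proj_pt (xx 1 (t / s))"
      unfolding st(4) eq vec.scale using \<open>s \<noteq> 0\<close> by (simp add: proj_pt_scale proj_pt_image)
    moreover have "t / s \<in> GF q d" by (intro GF_divide st)
    ultimately show "P \<in> {(*v) A ` proj_pt (xx 1 t) | t. t \<in> GF q d \<and> ff 0 t = 0}"
      unfolding ff_def by blast
  next
    fix P assume "P \<in> {(*v) A ` proj_pt (xx 1 t) | t. t \<in> GF q d \<and> ff 0 t = 0}"
    then obtain t where t: "t \<in> GF q d" "ff 0 t = 0" "P = (*v) A ` proj_pt (xx 1 t)" by blast
    have "proj_pt (xx 1 t) \<in> std_conic (GF q d)" using t(1) by (auto intro!: std_conicI)
    moreover have "P \<in> pts (GF q d) ((*v) A ` ker 0)"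
    proof -
      have "vec_over (GF q d) (xx 1 t)" using t(1) by (auto simp: vec_over_def forall_3 GF_power)
      then have "vec_over (GF q d) (A *v xx 1 t)" by (rule vec_over_mult[OF A(1)])
      moreover have "A *v xx 1 t \<noteq> 0" using invertible_mult_cancel[OF A(2), of "xx 1 t" 0] by simp
      ultimately show ?thesis
        unfolding t(3) proj_pt_image pts_proj_pt[OF sub] mem xx_in_ker using t(2) by (simp add: PG_I)
    qed
    ultimately show "P \<in> (\<lambda>P. (*v) A ` P) ` std_conic (GF q d) \<inter> pts (GF q d) ((*v) A ` ker 0)"
      using t(3) by blast
  }
qed

end

locale subplane_section = bose_section q ty "J ** A" u \<Sigma>
  for q :: nat and ty :: "'a::{field,finite} itself" and J :: "'a ^ 3 ^ 9" and A :: "'a ^ 3 ^ 3" and u and \<Sigma> +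
  fixes B :: "'a ^ 3 ^ 3" and \<kappa> :: 'a
  assumes A_over: "mat_over (GF q 3) A" and A_inv: "invertible A"
    and \<kappa>: "\<kappa> \<noteq> 0" "\<And>x. B *v frob q (A *v x) = \<kappa> *s (A *v frob q x)"
begin

abbreviation "AA P \<equiv> (*v) A ` P"

text \<open>On subspaces the scalar \<kappa> is absorbed, and in subplane coordinates the
  collineation is the plain Frobenius map.\<close>

lemma conj_map_AA: 
  assumes "vec.subspace U"
  shows "conj_map q B (AA U) = AA (frob q ` U)"
proof -
  have sub: "vec.subspace (frob q ` U)"
    using frob_span[of 1 U] vec.span_eq_iff assms by (metis power_one_right vec.subspace_span)
  have "conj_map q B (AA U) = (\<lambda>x. A *v (\<kappa> *s x)) ` frob q ` U"
    by (simp add: conj_map_def image_image \<kappa>(2) vec.scale)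
  also have "\<dots> = AA (frob q ` U)"
  proof (intro equalityI subsetI)
    fix y assume "y \<in> AA (frob q ` U)"
    then obtain x where x: "x \<in> frob q ` U" "y = A *v x" by blast
    have "inverse \<kappa> *s x \<in> frob q ` U" using vec.subspace_scale[OF sub x(1)] .
    moreover have "y = A *v (\<kappa> *s (inverse \<kappa> *s x))" using \<kappa>(1) x(2) by simp
    ultimately show "y \<in> (\<lambda>x. A *v (\<kappa> *s x)) ` frob q ` U" by blast
  qed (use vec.subspace_scale[OF sub] in blast)
  finally show ?thesis .
qed

lemma AA_inj: "inj ((*v) A)" using invertible_mult_cancel[OF A_inv] by (auto simp: inj_def)

lemma AA_mem: "A *v x \<in> AA U \<longleftrightarrow> x \<in> U"
  using AA_inj by (auto simp: inj_def)

lemma AA_subset: "AA U \<subseteq> AA V \<longleftrightarrow> U \<subseteq> V" 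
  using inj_image_subset_iff[OF AA_inj] .

lemma conj_map_ker: "conj_map q B (AA (ker k)) = AA (ker (Suc k))"
  by (simp add: conj_map_AA ker_subspace frob_ker)

lemma conj_map_ker_Int: "conj_map q B (AA (ker j \<inter> ker k)) = AA (ker (Suc j) \<inter> ker (Suc k))"
  by (simp add: conj_map_AA ker_subspace vec.subspace_inter frob_ker_Int)

lemma carriers_eq:
  "carriers q B (AA (ker 0)) = {AA (ker 0 \<inter> ker 1), AA (ker 0 \<inter> ker 2), AA (ker 1 \<inter> ker 2)}"
  by (simp add: carriers_def Let_def conj_map_ker image_Int[OF AA_inj] numeral_2_eq_2)

lemma carrier_on_line:
  assumes "E \<in> carriers q B (AA (ker 0))" "E \<subseteq> AA (ker 0)" "conj_map q B E \<subseteq> AA (ker 0)"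
  shows "E = AA (ker 0 \<inter> ker 2)"
proof -
  have "E \<noteq> AA (ker 1 \<inter> ker 2)" using assms(2) kers_not_concurrent AA_subset by blast
  moreover have "E \<noteq> AA (ker 0 \<inter> ker 1)"
  proof
    assume "E = AA (ker 0 \<inter> ker 1)"
    then have "AA (ker 1 \<inter> ker 2) \<subseteq> AA (ker 0)"
      using assms(3) conj_map_ker_Int[of 0 1] by (simp add: numeral_2_eq_2)
    then show False using kers_not_concurrent AA_subset by blast
  qed
  ultimately show ?thesis using assms(1) unfolding carriers_eq by blast
qed

text \<open>After subtracting a multiple of (1, e, e^2) the first coordinate is zero, and the two
  equations read y_3 = (e + e^q) y_2 and y_3 = (e^(q^2) + e) y_2. They force y = 0 since e^q and
  e^(q^2) differ.\<close>

lemma carrier_point: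
  assumes e: "carrier_root e"
  shows "ker 0 \<inter> ker 2 = proj_pt (xx 1 e)"
proof (intro equalityI subsetI)
  fix x assume x: "x \<in> ker 0 \<inter> ker 2"
  have r: "ff 0 e = 0" "ff 2 e = 0" using e by (auto simp: carrier_root_def)
  define y where "y = x - x $ 1 *s xx 1 e"
  have y0: "dot (uu 0) y = 0" "dot (uu 2) y = 0"
    using x r by (simp_all add: y_def dot_diff dot_scale ker_def ff_def)
  have y1: "y $ 1 = 0" by (simp add: y_def)
  note f = carrier_root_props(3)[OF e]
  have F: "Fp k = smult (uu k $ 3) ([:- (e ^ q ^ k), 1:] * [:- ((e ^ q) ^ q ^ k), 1:])" for k
    by (rule Fp_roots[OF f])
  have u2: "uu k $ 2 = - uu k $ 3 * (e ^ q ^ k + e ^ q ^ Suc k)" for k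
    using F[of k] by (simp add: Fp_def pow_pow_q algebra_simps)
  have e3: "e ^ q ^ 3 = e" using carrier_root_props(1)[OF e] by (simp add: GF_iff)
  have "uu 0 $ 3 * (y $ 3 - (e + e ^ q) * y $ 2) = 0"
    using y0(1) y1 u2[of 0] by (simp add: dot_def sum_3 algebra_simps)
  then have a: "y $ 3 = (e + e ^ q) * y $ 2" using uu3_nonzero by simp
  have "uu 2 $ 3 * (y $ 3 - (e ^ q ^ 2 + e) * y $ 2) = 0"
    using y0(2) y1 u2[of 2] e3 by (simp add: dot_def sum_3 algebra_simps)
  then have b: "y $ 3 = (e ^ q ^ 2 + e) * y $ 2" using uu3_nonzero by simp
  have "(e ^ q - e ^ q ^ 2) * y $ 2 = (e + e ^ q) * y $ 2 - (e ^ q ^ 2 + e) * y $ 2"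
    by (simp add: algebra_simps)
  also have "\<dots> = 0" unfolding a[symmetric] b[symmetric] by simp
  finally have "(e ^ q - e ^ q ^ 2) * y $ 2 = 0" .
  moreover have "e ^ q \<noteq> e ^ q ^ 2"
  proof
    assume "e ^ q = e ^ q ^ 2"
    then have "e ^ q = (e ^ q) ^ q" by (simp add: power2_eq_square power_mult)
    then have "e = e ^ q" by (simp only: pow_inj1)
    then show False using carrier_root_props(2)[OF e] by (simp add: GF_iff)
  qed
  ultimately have "y $ 2 = 0" by simp
  then have "y = 0" using y1 a by (simp add: vec_eq_iff forall_3)
  then have "x = x $ 1 *s xx 1 e" by (simp add: y_def)
  then show "x \<in> proj_pt (xx 1 e)" unfolding proj_pt_iff by blast
next
  fix x assume "x \<in> proj_pt (xx 1 e)"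
  then show "x \<in> ker 0 \<inter> ker 2"
    using e by (auto simp: proj_pt_iff ker_def carrier_root_def ff_def dot_scale)
qed

lemma line_eq_ker: "line = ker 0" by (simp add: ker_def uu_0)

text \<open>The extended conic meets the line exactly in the two carriers if and only if a carrier
  root exists, which links the geometric condition to \<open>section_cubic\<close> and
  \<open>section_sextic\<close>.\<close>

theorem section_of_conic_variety:
  fixes E and C
  defines "l \<equiv> AA (ker 0)" and "g \<equiv> (*v) J ` AA (ker 0)"
    and "h \<equiv> vec.span ((*v) J ` E \<union> frob (q^2) ` ((*v) J ` conj_map q B E))"
    and "Cp \<equiv> AA ` std_conic (GF q 3)" and "Cpp \<equiv> AA ` std_conic (GF q 6)"
    and "C \<equiv> AA ` std_conic (GF q 1)"
  assumes E: "E \<in> carriers q B l" "E \<subseteq> l" "conj_map q B E \<subseteq> l"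
  shows "(Cp \<inter> pts (GF q 3) l = {E, conj_map q B E} \<longrightarrow>
        (\<exists>v R. nrc_basis (GF q 1) \<Sigma> 3 v \<and>
           bb_variety q J \<Sigma> C (GF q 1) = nrc (GF q 1) 3 v \<and>
           T_line q g h \<and> T_line q g (frob q ` h) \<and> T_line q g (frob (q^2) ` h) \<and>
           bb_variety q J \<Sigma> C (GF q 3) \<inter> pts (GF q 3) (conj_span q g) =
             pts (GF q 3) h \<union> pts (GF q 3) (frob q ` h) \<union> pts (GF q 3) (frob (q^2) ` h) \<and>
           nrc (GF q 3) 3 v \<inter> pts (GF q 3) (conj_span q g) = {R, frob q ` R, frob (q^2) ` R} \<and>
           R \<subseteq> h \<and> \<not> (\<exists>X\<in>pts (GF q 3) g. R \<subseteq> conj_span q X)))"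
    (is "?c \<longrightarrow> ?cubic")
    and "(Cp \<inter> pts (GF q 3) l \<noteq> {E, conj_map q B E} \<longrightarrow>
        (\<exists>P Q v. Cpp \<inter> pts (GF q 6) l = {P, Q} \<and>
           P \<notin> carriers q B l \<and> Q \<notin> carriers q B l \<and>
           nrc_basis (GF q 1) \<Sigma> 6 v \<and>
           bb_variety q J \<Sigma> C (GF q 1) = nrc (GF q 1) 6 v \<and>
           bb_variety q J \<Sigma> C (GF q 3) = nrc (GF q 3) 6 v \<and>
           ((Cp \<inter> pts (GF q 3) l = {P, Q} \<and>
             (*v) J ` P \<in> pts (GF q 3) g \<and> (*v) J ` Q \<in> pts (GF q 3) g \<and>
             nrc (GF q 3) 6 v \<inter> pts (GF q 3) (conj_span q g) =
               {(*v) J ` P, frob q ` (*v) J ` P, frob (q^2) ` (*v) J ` P,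
                (*v) J ` Q, frob q ` (*v) J ` Q, frob (q^2) ` (*v) J ` Q}) \<or>
            (Cp \<inter> pts (GF q 3) l = {} \<and>
             (*v) J ` P \<in> pts (GF q 6) g - pts (GF q 3) g \<and> (*v) J ` Q \<in> pts (GF q 6) g - pts (GF q 3) g \<and>
             (*v) J ` Q = frob (q^3) ` (*v) J ` P \<and>
             nrc (GF q 6) 6 v \<inter> pts (GF q 6) (conj_span q g) =
               {(*v) J ` P, frob q ` (*v) J ` P, frob (q^2) ` (*v) J ` P,
                (*v) J ` Q, frob q ` (*v) J ` Q, frob (q^2) ` (*v) J ` Q}))))"
    (is "?d \<longrightarrow> ?sextic" is "_ \<longrightarrow> (\<exists>P Q v. ?a P Q \<and> ?b P \<and> ?b' Q \<and> ?e v \<and> ?f v \<and> ?f' v \<and> ?alt P Q v)")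
proof -
  have AJ: "(*v) J ` AA S = (*v) (J ** A) ` S" for S by (rule image_mat_mult)
  have g: "g = (*v) (J ** A) ` line" unfolding g_def AJ line_eq_ker ..
  have CV: "bb_variety q J \<Sigma> C F = bb_variety q (J ** A) \<Sigma> (std_conic (GF q 1)) F" for F
    unfolding C_def by (rule bb_variety_image)
  have Ek: "E = AA (ker 0 \<inter> ker 2)" by (rule carrier_on_line[OF E[unfolded l_def]])
  have Cp: "Cp \<inter> pts (GF q 3) l = {AA (proj_pt (xx 1 t)) | t. t \<in> GF q 3 \<and> ff 0 t = 0}"
    unfolding Cp_def l_def by (rule conic_line_points[OF _ A_over A_inv]) simp
  have Cpp: "Cpp \<inter> pts (GF q 6) l = {AA (proj_pt (xx 1 t)) | t. t \<in> GF q 6 \<and> ff 0 t = 0}"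
    unfolding Cpp_def l_def by (rule conic_line_points[OF _ mat_over_3_6[OF A_over] A_inv]) simp
  show "?c \<longrightarrow> ?cubic"
  proof (rule impI)
    assume "Cp \<inter> pts (GF q 3) l = {E, conj_map q B E}"
    then obtain e where e: "ff 0 e = 0" "E = AA (proj_pt (xx 1 e))" unfolding Cp by blast
    have "A *v xx 1 e \<in> AA (ker 0 \<inter> ker 2)" using proj_pt_self e(2) unfolding Ek by blast
    then have root: "carrier_root e" unfolding AA_mem by (simp add: carrier_root_def xx_in_ker)
    have "frob q ` proj_pt (xx 1 e) = proj_pt (xx 1 (e ^ q))"
      using frob_proj_pt[of 1 "xx 1 e"] frob_xx[of 1 1 e] by simp
    then have cE: "conj_map q B E = AA (proj_pt (xx 1 (e ^ q)))"
      using conj_map_AA[of "proj_pt (xx 1 e)"] by (simp add: e(2) proj_pt_def)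
    have h: "h = vec.span (Ph (xx 1 e) \<union> frob (q^2) ` Ph (xx 1 (e ^ q)))"
      unfolding h_def cE unfolding e(2) AJ ..
    show ?cubic
      unfolding CV g h
      by (rule section_cubic[OF root], rule exI, rule exI, intro conjI, assumption+, blast)
  qed
  show "?d \<longrightarrow> ?sextic"
  proof (rule impI)
    assume ne: "Cp \<inter> pts (GF q 3) l \<noteq> {E, conj_map q B E}"
    \<comment> \<open>A carrier root e would make e and e^q the two parameters on the line, and
      these belong to \<open>E\<close> and its conjugate.\<close>
    have no: "\<nexists>e. carrier_root e"
    proof
      assume "\<exists>e. carrier_root e"
      then obtain e where root: "carrier_root e" by blast
      have E': "E = AA (proj_pt (xx 1 e))" unfolding Ek carrier_point[OF root] ..
      have "frob q ` proj_pt (xx 1 e) = proj_pt (xx 1 (e ^ q))"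
        using frob_proj_pt[of 1 "xx 1 e"] frob_xx[of 1 1 e] by simp
      then have cE: "conj_map q B E = AA (proj_pt (xx 1 (e ^ q)))"
        using conj_map_AA[of "proj_pt (xx 1 e)"] by (simp add: E' proj_pt_def)
      have "ff 0 t = 0 \<longleftrightarrow> t = e \<or> t = e ^ q" for t
        unfolding carrier_root_props(3)[OF root] using u3_nonzero by simp
      then have "Cp \<inter> pts (GF q 3) l = {E, conj_map q B E}"
        unfolding Cp cE unfolding E' using carrier_root_props(1)[OF root] GF_power by auto
      with ne show False by simp
    qed
    obtain \<alpha> \<beta> v where f': "\<forall>t. ff 0 t = u $ 3 * (t - \<alpha>) * (t - \<beta>)"
      and mem: "\<alpha> \<in> GF q 3 \<and> \<beta> \<in> GF q 3 \<or> \<alpha> \<notin> GF q 3 \<and> \<beta> = \<alpha> ^ q ^ 3"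
      and basis: "nrc_basis (GF q 1) \<Sigma> 6 v"
      and var: "\<forall>d. bb_variety q (J ** A) \<Sigma> (std_conic (GF q 1)) (GF q d) = nrc (GF q d) 6 v"
      and inf: "\<forall>d. \<alpha> \<in> GF q d \<longrightarrow> \<beta> \<in> GF q d \<longrightarrow> nrc (GF q d) 6 v \<inter> pts (GF q d) \<Sigma>inf = 
        {Ph (xx 1 \<alpha>), frob q ` Ph (xx 1 \<alpha>), frob (q^2) ` Ph (xx 1 \<alpha>), 
         Ph (xx 1 \<beta>), frob q ` Ph (xx 1 \<beta>), frob (q^2) ` Ph (xx 1 \<beta>)}"
      by (rule section_sextic[OF no])
    note f = f'[rule_format] and var = var[rule_format] and inf = inf[rule_format]
    define P where "P = AA (proj_pt (xx 1 \<alpha>))"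
    define Q where "Q = AA (proj_pt (xx 1 \<beta>))"
    have JP: "(*v) J ` P = Ph (xx 1 \<alpha>)" and JQ: "(*v) J ` Q = Ph (xx 1 \<beta>)"
      unfolding P_def Q_def AJ by (rule refl)+
    have zero: "ff 0 t = 0 \<longleftrightarrow> t = \<alpha> \<or> t = \<beta>" for t
      unfolding f using u3_nonzero by simp
    have PQ6: "Cpp \<inter> pts (GF q 6) l = {P, Q}"
      unfolding Cpp zero P_def Q_def by (auto simp: GF_6)
    \<comment> \<open>Each carrier is the meet of two conjugate lines, so the parameter of a conic
      point there would be a common root of two of the f_k.\<close>
    have not_carrier: "AA (proj_pt (xx 1 t)) \<notin> carriers q B l" if t: "ff 0 t = 0" for t
    proof
      assume "AA (proj_pt (xx 1 t)) \<in> carriers q B l"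
      then have cases: "AA (proj_pt (xx 1 t)) = AA (ker 0 \<inter> ker 1) \<or> AA (proj_pt (xx 1 t)) = AA (ker 0 \<inter> ker 2)
          \<or> AA (proj_pt (xx 1 t)) = AA (ker 1 \<inter> ker 2)"
        unfolding l_def carriers_eq insert_iff empty_iff by blast
      have "AA (proj_pt (xx 1 t)) \<noteq> AA (ker i \<inter> ker j)" if ij: "i < 3" "j < 3" "i \<noteq> j" for i j
      proof
        assume "AA (proj_pt (xx 1 t)) = AA (ker i \<inter> ker j)"
        then have "A *v xx 1 t \<in> AA (ker i \<inter> ker j)" using proj_pt_self by blast
        then have "ff i t = 0" "ff j t = 0" unfolding AA_mem by (simp_all add: xx_in_ker)
        then show False using common_root_carrier[OF ij(1,2)] ij(3) no by blast
      qed
      then have "AA (proj_pt (xx 1 t)) \<noteq> AA (ker 0 \<inter> ker 1)" "AA (proj_pt (xx 1 t)) \<noteq> AA (ker 0 \<inter> ker 2)"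
        "AA (proj_pt (xx 1 t)) \<noteq> AA (ker 1 \<inter> ker 2)" by simp_all
      with cases show False by blast
    qed
    have P_nc: "P \<notin> carriers q B l" "Q \<notin> carriers q B l"
      unfolding P_def Q_def using not_carrier zero by blast+
    have gsub: "vec.subspace ((*v) (J ** A) ` ker 0)" by (rule vec.subspace_image[OF ker_subspace])
    have J_inj: "(J ** A) *v x = (J ** A) *v y \<Longrightarrow> x = y" for x y
      using emb_inj[of "\<lambda>k. if k = 0 then x else 0" "\<lambda>k. if k = 0 then y else 0" 0] by (simp add: J_mult)
    \<comment> \<open>The first coordinate 1 of \<open>xx 1 t\<close> forces the Frobenius scalar to
      be 1, so the point is defined over a field exactly when its parameter is.\<close>
    have Ph_pts: "Ph (xx 1 t) \<in> pts (GF q d) g \<longleftrightarrow> t \<in> GF q d" if t: "ff 0 t = 0" and d: "d = 3 \<or> d = 6" for t d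
    proof -
      have JF: "mat_over (GF q d) (J ** A)" using d J_over mat_over_3_6 by blast
      have "(J ** A) *v xx 1 t \<in> (*v) (J ** A) ` ker 0" using t xx_in_ker by blast
      then have "Ph (xx 1 t) \<in> pts (GF q d) g \<longleftrightarrow> proj_pt ((J ** A) *v xx 1 t) \<in> PG (GF q d)"
        unfolding g_def AJ proj_pt_image pts_proj_pt[OF gsub] by blast
      also have "\<dots> \<longleftrightarrow> t \<in> GF q d"
      proof
        assume "proj_pt ((J ** A) *v xx 1 t) \<in> PG (GF q d)"
        then obtain c where "frob (q ^ d) ((J ** A) *v xx 1 t) = c *s ((J ** A) *v xx 1 t)" using PG_frob by blast
        then have "(J ** A) *v xx 1 (t ^ q ^ d) = (J ** A) *v (c *s xx 1 t)"
          using JF by (simp add: frob_mult_vec mat_over_iff_frobm frob_xx vec.scale)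
        then have "xx 1 (t ^ q ^ d) = c *s xx 1 t" by (rule J_inj)
        then have "1 = c" "t ^ q ^ d = c * t" by (simp_all add: vec_eq_iff forall_3)
        then show "t \<in> GF q d" by (simp add: GF_iff)
      next
        assume "t \<in> GF q d"
        then have "vec_over (GF q d) (xx 1 t)" by (auto simp: vec_over_def forall_3 GF_power)
        then have "vec_over (GF q d) ((J ** A) *v xx 1 t)" by (rule vec_over_mult[OF JF])
        moreover have "(J ** A) *v xx 1 t \<noteq> 0" using J_inj[of "xx 1 t" 0] by auto
        ultimately show "proj_pt ((J ** A) *v xx 1 t) \<in> PG (GF q d)" by (intro PG_I)
      qed
      finally show ?thesis .
    qed
    have z: "ff 0 \<alpha> = 0" "ff 0 \<beta> = 0" by (simp_all add: zero)
    have gconj: "conj_span q g = \<Sigma>inf" unfolding g ..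
    have "?alt P Q v"
      using mem
    proof (elim disjE)
      assume ab: "\<alpha> \<in> GF q 3 \<and> \<beta> \<in> GF q 3"
      then have "Cp \<inter> pts (GF q 3) l = {P, Q}" unfolding Cp zero P_def Q_def by auto
      then show ?thesis
        unfolding JP JQ gconj using ab inf[of 3] Ph_pts[OF z(1), of 3] Ph_pts[OF z(2), of 3] by simp
    next
      assume ab: "\<alpha> \<notin> GF q 3 \<and> \<beta> = \<alpha> ^ q ^ 3"
      have b3: "\<beta> ^ q ^ 3 = \<alpha>" using ab by (simp add: pow_pow pow_q6)
      have b: "\<beta> \<notin> GF q 3"
      proof
        assume "\<beta> \<in> GF q 3"
        then have "\<beta> = \<alpha>" using b3 by (simp add: GF_iff)
        then show False using ab \<open>\<beta> \<in> GF q 3\<close> by simp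
      qed
      have "Cp \<inter> pts (GF q 3) l = {}" unfolding Cp zero using ab b by auto
      moreover have "Ph (xx 1 \<beta>) = frob (q ^ 3) ` Ph (xx 1 \<alpha>)"
        using J_over ab by (simp add: proj_pt_image frob_proj_pt frob_mult_vec mat_over_iff_frobm frob_xx)
      ultimately show ?thesis
        unfolding JP JQ gconj
        using ab b inf[of 6] Ph_pts[OF z(1), of 3] Ph_pts[OF z(2), of 3] Ph_pts[OF z(1), of 6] Ph_pts[OF z(2), of 6]
        by (simp add: GF_6)
    qed
    then show ?sextic
      using PQ6 P_nc basis var[of 1] var[of 3] unfolding CV by (intro exI conjI)
  qed
qed

end

theorem corollary4p6:
  fixes q :: nat
    and l :: "('a::{field,finite} ^ 3) set"
    and \<pi> \<C> :: "('a ^ 3) set set"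
    and B :: "'a ^ 3 ^ 3"
    and E :: "('a ^ 3) set"
    and \<Gamma> \<Sigma> :: "('a ^ 9) set"
    and J :: "'a ^ 3 ^ 9"
  defines "Fq \<equiv> GF q 1 :: 'a set"
    and "Fq3 \<equiv> GF q 3 :: 'a set"
    and "Fq6 \<equiv> GF q 6 :: 'a set"
    and "\<phi> \<equiv> (\<lambda>X. (*v) J ` X)"
    and "c \<equiv> conj_map q B"
    and "g \<equiv> (*v) J ` l"
    and "\<Sigma>inf \<equiv> conj_span q ((*v) J ` l)"
    and "h \<equiv> vec.span ((*v) J ` E \<union> frob (q^2) ` ((*v) J ` conj_map q B E))"
    and "Cp \<equiv> conic_ext (GF q 3) \<C>"
    and "Cpp \<equiv> conic_ext (GF q 6) (conic_ext (GF q 3) \<C>)"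
  assumes q: "primepow q" "q \<ge> 6"
    and card: "CARD('a) = q ^ 6"
    and l: "proj_subspace Fq3 1 l"
    and \<pi>: "subplane Fq3 q \<pi>" "exterior \<pi> l"
    and \<C>: "subplane_conic q \<pi> \<C>"
    and B: "subplane_conj q \<pi> B"
    and E: "E \<in> carriers q B l" "E \<subseteq> l" "c E \<subseteq> l"
    and \<Gamma>: "bose_frame q \<Gamma> J"
    and \<Sigma>: "proj_subspace Fq 6 \<Sigma>" "\<Sigma>inf \<subseteq> \<Sigma>"
  shows
    "(Cp \<inter> pts Fq3 l = {E, c E} \<longrightarrow>
        (\<exists>v R. nrc_basis Fq \<Sigma> 3 v \<and>
           bb_variety q J \<Sigma> \<C> Fq = nrc Fq 3 v \<and>
           T_line q g h \<and> T_line q g (frob q ` h) \<and> T_line q g (frob (q^2) ` h) \<and>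
           bb_variety q J \<Sigma> \<C> Fq3 \<inter> pts Fq3 \<Sigma>inf =
             pts Fq3 h \<union> pts Fq3 (frob q ` h) \<union> pts Fq3 (frob (q^2) ` h) \<and>
           nrc Fq3 3 v \<inter> pts Fq3 \<Sigma>inf = {R, frob q ` R, frob (q^2) ` R} \<and>
           R \<subseteq> h \<and>
           \<not> (\<exists>X\<in>pts Fq3 g. R \<subseteq> conj_span q X))) \<and>
     (Cp \<inter> pts Fq3 l \<noteq> {E, c E} \<longrightarrow>
        (\<exists>P Q v. Cpp \<inter> pts Fq6 l = {P, Q} \<and>
           P \<notin> carriers q B l \<and> Q \<notin> carriers q B l \<and>
           nrc_basis Fq \<Sigma> 6 v \<and>
           bb_variety q J \<Sigma> \<C> Fq = nrc Fq 6 v \<and>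
           bb_variety q J \<Sigma> \<C> Fq3 = nrc Fq3 6 v \<and>
           ((Cp \<inter> pts Fq3 l = {P, Q} \<and>
             \<phi> P \<in> pts Fq3 g \<and> \<phi> Q \<in> pts Fq3 g \<and>
             nrc Fq3 6 v \<inter> pts Fq3 \<Sigma>inf =
               {\<phi> P, frob q ` \<phi> P, frob (q^2) ` \<phi> P,
                \<phi> Q, frob q ` \<phi> Q, frob (q^2) ` \<phi> Q}) \<or>
            (Cp \<inter> pts Fq3 l = {} \<and>
             \<phi> P \<in> pts Fq6 g - pts Fq3 g \<and> \<phi> Q \<in> pts Fq6 g - pts Fq3 g \<and>
             \<phi> Q = frob (q^3) ` \<phi> P \<and>
             nrc Fq6 6 v \<inter> pts Fq6 \<Sigma>inf =
               {\<phi> P, frob q ` \<phi> P, frob (q^2) ` \<phi> P,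
                \<phi> Q, frob q ` \<phi> Q, frob (q^2) ` \<phi> Q}))))"
proof -
  interpret F: sextic_field q "TYPE('a)" by unfold_locales (use q card in auto)
  obtain A :: "'a ^ 3 ^ 3" where A: "mat_over (GF q 3) A" "invertible A"
    and \<pi>A: "\<pi> = (\<lambda>P. (*v) A ` P) ` PG (GF q 1)" and \<C>A: "\<C> = (\<lambda>P. (*v) A ` P) ` std_conic (GF q 1)"
    by (rule F.subplane_conic_normal_form[OF \<C>])
  have B': "invertible B" "\<And>P. P \<in> PG (GF q 1) \<Longrightarrow> conj_map q B ((*v) A ` P) = (*v) A ` P"
    using B unfolding subplane_conj_def \<pi>A by blast+
  obtain \<kappa> where \<kappa>: "\<kappa> \<noteq> 0" "\<And>x. B *v frob q (A *v x) = \<kappa> *s (A *v frob q x)"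
    using F.subplane_conj_scalar[OF A(2) B'] by metis
  obtain u0 where u0: "vec_over (GF q 3) u0" "l = {x. dot u0 x = 0}"
    using l unfolding Fq3_def by (rule F.line_equation)
  \<comment> \<open>Pulled back along \<open>A\<close>, the equation of the line refers to the
    coordinates in which the subplane is PG(2,q).\<close>
  define u where "u = transpose A *v u0"
  have u_dot: "dot u0 (A *v x) = dot u x" for x unfolding u_def by (rule dot_mult)
  have l_eq: "l = (*v) A ` {x. dot u x = 0}"
  proof (intro equalityI subsetI)
    fix x assume "x \<in> l"
    moreover obtain y where "x = A *v y" using invertible_mult_surj[OF A(2)] by blast
    ultimately show "x \<in> (*v) A ` {x. dot u x = 0}" using u_dot by (auto simp: u0(2))
  qed (auto simp: u0(2) u_dot)
  have bc: "bose_coords q (J ** A)" by (rule F.bose_coordsI[OF \<Gamma> A])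
  have ext: "dot u x \<noteq> 0" if x: "vec_over (GF q 1) x" "x \<noteq> 0" for x
  proof
    assume "dot u x = 0"
    then have "(*v) A ` proj_pt x \<subseteq> l" unfolding l_eq using proj_pt_subset[OF dot_subspace] by blast
    moreover have "(*v) A ` proj_pt x \<in> \<pi>" unfolding \<pi>A using F.PG_I[OF x(2,1)] by blast
    ultimately show False using \<pi>(2) unfolding exterior_def by blast
  qed
  have uF: "vec_over (GF q 3) u"
    unfolding u_def by (intro F.vec_over_mult mat_over_transpose A u0)
  have bl: "bose_line q (J ** A) u"
    by (intro bose_line.intro bc bose_line_axioms.intro uF ext)
  have g_eq: "(*v) J ` l = (*v) (J ** A) ` {x. dot u x = 0}"
    unfolding l_eq by (rule image_mat_mult)
  have "conj_span q ((*v) (J ** A) ` {x. dot u x = 0}) \<subseteq> \<Sigma>"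
    using \<Sigma>(2) unfolding \<Sigma>inf_def g_eq .
  \<comment> \<open>Rescaling makes the three forms agree on \<Sigma> and leaves the line itself
    unchanged.\<close>
  then obtain u' where u': "bose_section q (J ** A) u' \<Sigma>" "{x. dot u' x = 0} = {x. dot u x = 0}"
    using bose_line.normalized_section[OF bl] \<Sigma>(1) unfolding Fq_def by metis
  have "subplane_section q J A u' \<Sigma> B \<kappa>"
    by (intro subplane_section.intro u'(1) subplane_section_axioms.intro A \<kappa>)
  then interpret S: subplane_section q "TYPE('a)" J A u' \<Sigma> B \<kappa> .
  have l_ker: "l = (*v) A ` S.ker 0"
    unfolding l_eq S.line_eq_ker[symmetric] u'(2) ..
  have Cp: "Cp = (\<lambda>P. (*v) A ` P) ` std_conic (GF q 3)"
    unfolding Cp_def \<C>A by (rule F.conic_ext_std[OF A]) simp_all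
  have Cpp: "Cpp = (\<lambda>P. (*v) A ` P) ` std_conic (GF q 6)"
    unfolding Cpp_def Cp[unfolded Cp_def] by (rule F.conic_ext_std[OF F.mat_over_3_6[OF A(1)] A(2)]) simp_all
  note E' = E[unfolded c_def l_ker]
  show ?thesis
    unfolding c_def \<phi>_def Fq_def Fq3_def Fq6_def \<Sigma>inf_def g_def h_def Cp Cpp \<C>A l_ker
    by (rule conjI[OF S.section_of_conic_variety[OF E']])
qed

end
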